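(* Let $n\in\mathbb Z_{>0}$. Fix $\tau\in\mathbb H$ and $\widetilde B\in\mathbb C$. On the two-sheeted cover of $E_\tau\setminus E_\tau[2]$ (with coordinate $p$) defined by $$T(p)^2=n(n+1)\wp(p)+\widetilde B,$$ the family of equations $\mathrm{GLE}^{(1)}_n(p,T(p),\tau)$ is isomonodromic, i.e. its period monodromy is the same (up to simultaneous conjugation) for all points of the cover. In particular its two local branches $T(p)$ and $-T(p)$ have the same period monodromy.
   Context: Notation: $\Lambda_\tau=\mathbb Z+\mathbb Z\tau$, $E_\tau=\mathbb C/\Lambda_\tau$, $\omega_1=1,\omega_2=\tau$; $\wp,\zeta,\sigma$ are the Weierstrass functions of $\Lambda_\tau$. $\mathrm{GLE}^{(1)}_n(p,T,\tau)$ is $y''=q^{(1)}_n(z;p,T)y$ with $$q_n^{(1)}=n(n+1)\wp(z)+\tfrac34(\wp(z+p)+\wp(z-p))+T(\zeta(z+p)+\zeta(z-p)-2\zeta(z))-\tfrac{\wp''(p)}{4\wp'(p)}(\zeta(z+p)-\zeta(z-p))+B,$$ $B=T^2+\frac{\wp''(p)}{2\wp'(p)}\zeta(p)-\frac12(2n^2+2n-3)\wp(p)$. It is log-free at $0,\pm p$, with local monodromy $I$ at $0$ and $-I$ at $\pm p$. Period monodromy: for a row $Y$ of two independent solutions, $Y(z+\omega_j)=Y(z)M_j$ by continuation along cycles $\ell_j$ ($z\to z+\omega_j$), $j=1,2$, chosen so that the continuation of $\Psi_p(z)=\sigma(z)/\sqrt{\sigma(z-p)\sigma(z+p)}$ along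 $\ell_j$ satisfies $\Psi_p(z+\omega_j)=\Psi_p(z)$. The period monodromy is the pair $(M_1,M_2)$ up to simultaneous conjugation. *)

theory Defs
  imports "HOL-Complex_Analysis.Complex_Analysis"
begin

definition period_lattice :: "complex \<Rightarrow> complex set" where
  "period_lattice \<tau> = range (\<lambda>(a, b). of_int a + of_int b * \<tau>)"

definition weierstrass_p :: "complex \<Rightarrow> complex \<Rightarrow> complex" where
  "weierstrass_p \<tau> z =
     1 / z ^ 2 + (\<Sum>\<^sub>\<infinity>w\<in>period_lattice \<tau> - {0}. 1 / (z - w) ^ 2 - 1 / w ^ 2)"

definition weierstrass_zeta :: "complex \<Rightarrow> complex \<Rightarrow> complex" where
  "weierstrass_zeta \<tau> z =
     1 / z + (\<Sum>\<^sub>\<infinity>w\<in>period_lattice \<tau> - {0}. 1 / (z - w) + 1 / w + z / w ^ 2)"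

text \<open>The infinite product over the lattice converges absolutely, so it is the limit of the
  finite subproducts, in analogy with \<^const>\<open>infsum\<close>.\<close>

definition weierstrass_sigma :: "complex \<Rightarrow> complex \<Rightarrow> complex" where
  "weierstrass_sigma \<tau> z =
     z * Lim (finite_subsets_at_top (period_lattice \<tau> - {0}))
       (\<lambda>F. \<Prod>w\<in>F. (1 - z / w) * exp (z / w + z ^ 2 / (2 * w ^ 2)))"

definition GLE_B :: "nat \<Rightarrow> complex \<Rightarrow> complex \<Rightarrow> complex \<Rightarrow> complex" where
  "GLE_B n \<tau> p T =
     T ^ 2
     + deriv (deriv (weierstrass_p \<tau>)) p / (2 * deriv (weierstrass_p \<tau>) p) * weierstrass_zeta \<tau> p
     - 1 / 2 * (2 * of_nat n ^ 2 + 2 * of_nat n - 3) * weierstrass_p \<tau> p"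

definition GLE_q :: "nat \<Rightarrow> complex \<Rightarrow> complex \<Rightarrow> complex \<Rightarrow> complex \<Rightarrow> complex" where
  "GLE_q n \<tau> p T z =
     of_nat n * (of_nat n + 1) * weierstrass_p \<tau> z
     + 3 / 4 * (weierstrass_p \<tau> (z + p) + weierstrass_p \<tau> (z - p))
     + T * (weierstrass_zeta \<tau> (z + p) + weierstrass_zeta \<tau> (z - p) - 2 * weierstrass_zeta \<tau> z)
     - deriv (deriv (weierstrass_p \<tau>)) p / (4 * deriv (weierstrass_p \<tau>) p)
         * (weierstrass_zeta \<tau> (z + p) - weierstrass_zeta \<tau> (z - p))
     + GLE_B n \<tau> p T"

definition GLE_singularities :: "complex \<Rightarrow> complex \<Rightarrow> complex set" where
  "GLE_singularities \<tau> p =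
     {z. z \<in> period_lattice \<tau> \<or> z - p \<in> period_lattice \<tau> \<or> z + p \<in> period_lattice \<tau>}"

text \<open>Continuation of the germ of \<open>f\<close> at \<open>\<gamma> 0\<close> along the path \<open>\<gamma>\<close>, ending in the germ of \<open>g\<close>
  at \<open>\<gamma> 1\<close>. The germ at time \<open>t\<close> is represented by \<open>F t\<close>, of which only the values
  near \<open>\<gamma> t\<close> are meaningful.\<close>

definition continues_along ::
    "(real \<Rightarrow> complex) \<Rightarrow> (complex \<Rightarrow> complex) \<Rightarrow> (complex \<Rightarrow> complex) \<Rightarrow> bool" where
  "continues_along \<gamma> f g \<longleftrightarrow>
     (\<exists>F. (\<forall>\<^sub>F z in nhds (\<gamma> 0). F 0 z = f z) \<and>
          (\<forall>\<^sub>F z in nhds (\<gamma> 1). F 1 z = g z) \<and>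
          (\<forall>t\<in>{0..1}. F t analytic_on {\<gamma> t} \<and>
             (\<forall>\<^sub>F s in at t within {0..1}. \<forall>\<^sub>F z in nhds (\<gamma> s). F s z = F t z)))"

text \<open>A row of two linearly independent solution germs of \<open>y'' = q y\<close> at \<open>z\<^sub>0\<close>.\<close>

definition GLE_solution_row ::
    "nat \<Rightarrow> complex \<Rightarrow> complex \<Rightarrow> complex \<Rightarrow> complex \<Rightarrow> (complex \<Rightarrow> complex ^ 2) \<Rightarrow> bool" where
  "GLE_solution_row n \<tau> p T z\<^sub>0 Y \<longleftrightarrow>
     (\<forall>i. (\<lambda>z. Y z $ i) analytic_on {z\<^sub>0} \<and>
          (\<forall>\<^sub>F z in nhds z\<^sub>0. deriv (deriv (\<lambda>z. Y z $ i)) z = GLE_q n \<tau> p T z * Y z $ i)) \<and>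
     (\<forall>c :: complex ^ 2. (\<forall>\<^sub>F z in nhds z\<^sub>0. (\<Sum>i\<in>UNIV. c $ i * Y z $ i) = 0) \<longrightarrow> c = 0)"

text \<open>Admissible cycles \<open>z \<rightarrow> z + \<omega>\<close>: the function
  \<open>\<Psi>(z) = \<sigma>(z) / sqrt (\<sigma>(z - p) \<sigma>(z + p))\<close>, with \<open>r\<close> a local branch of the square root at \<open>z\<^sub>0\<close>,
  returns to itself and not to its negative. This does not depend on the branch.\<close>

definition GLE_cycle :: "complex \<Rightarrow> complex \<Rightarrow> complex \<Rightarrow> complex \<Rightarrow> (real \<Rightarrow> complex) \<Rightarrow> bool" where
  "GLE_cycle \<tau> p z\<^sub>0 \<omega> \<gamma> \<longleftrightarrow>
     path \<gamma> \<and> path_image \<gamma> \<inter> GLE_singularities \<tau> p = {} \<and>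
     pathstart \<gamma> = z\<^sub>0 \<and> pathfinish \<gamma> = z\<^sub>0 + \<omega> \<and>
     (\<exists>r \<Psi>'. r analytic_on {z\<^sub>0} \<and>
        (\<forall>\<^sub>F z in nhds z\<^sub>0. r z ^ 2 = weierstrass_sigma \<tau> (z - p) * weierstrass_sigma \<tau> (z + p)) \<and>
        continues_along \<gamma> (\<lambda>z. weierstrass_sigma \<tau> z / r z) \<Psi>' \<and>
        (\<forall>\<^sub>F z in nhds z\<^sub>0. \<Psi>' (z + \<omega>) = weierstrass_sigma \<tau> z / r z))"

definition monodromy_along ::
    "(real \<Rightarrow> complex) \<Rightarrow> complex \<Rightarrow> (complex \<Rightarrow> complex ^ 2) \<Rightarrow> complex ^ 2 ^ 2 \<Rightarrow> bool" where
  "monodromy_along \<gamma> \<omega> Y M \<longleftrightarrow>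
     (\<exists>Z. (\<forall>i. continues_along \<gamma> (\<lambda>z. Y z $ i) (\<lambda>z. Z z $ i)) \<and>
          (\<forall>\<^sub>F z in nhds (pathstart \<gamma>). Z (z + \<omega>) = Y z v* M))"

text \<open>All pairs \<open>(M\<^sub>1, M\<^sub>2)\<close> arising from some choice of base point, solution row and cycles.\<close>

definition period_monodromy ::
    "nat \<Rightarrow> complex \<Rightarrow> complex \<Rightarrow> complex \<Rightarrow> ((complex ^ 2 ^ 2) \<times> (complex ^ 2 ^ 2)) set" where
  "period_monodromy n \<tau> p T =
     {(M\<^sub>1, M\<^sub>2). \<exists>z\<^sub>0 Y \<gamma>\<^sub>1 \<gamma>\<^sub>2.
        z\<^sub>0 \<notin> GLE_singularities \<tau> p \<and> GLE_solution_row n \<tau> p T z\<^sub>0 Y \<and>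
        GLE_cycle \<tau> p z\<^sub>0 1 \<gamma>\<^sub>1 \<and> monodromy_along \<gamma>\<^sub>1 1 Y M\<^sub>1 \<and>
        GLE_cycle \<tau> p z\<^sub>0 \<tau> \<gamma>\<^sub>2 \<and> monodromy_along \<gamma>\<^sub>2 \<tau> Y M\<^sub>2}"

definition simultaneous_conjugacy_class ::
    "complex ^ 2 ^ 2 \<Rightarrow> complex ^ 2 ^ 2 \<Rightarrow> ((complex ^ 2 ^ 2) \<times> (complex ^ 2 ^ 2)) set" where
  "simultaneous_conjugacy_class M\<^sub>1 M\<^sub>2 =
     {(matrix_inv C ** M\<^sub>1 ** C, matrix_inv C ** M\<^sub>2 ** C) | C. invertible C}"

text \<open>The coordinate \<open>p\<close> on the torus minus its 2-torsion points is represented by its lifts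
  to the complex plane; \<open>GLE_q\<close> and the set of admissible cycles depend only on \<open>p\<close> modulo the lattice.\<close>

definition GLE_cover :: "nat \<Rightarrow> complex \<Rightarrow> complex \<Rightarrow> (complex \<times> complex) set" where
  "GLE_cover n \<tau> B =
     {(p, T). 2 * p \<notin> period_lattice \<tau> \<and>
        T ^ 2 = of_nat n * (of_nat n + 1) * weierstrass_p \<tau> p + B}"

end

(* Let h(z) = wp(z) - wp(p) and a = h'/h = zeta(z - p) + zeta(z + p) - 2 zeta(z). If y solves the
   Lame equation y'' = (n(n+1) wp + B) y, where T^2 = n(n+1) wp(p) + B, then u = y' - T y satisfies
   u'' = a u' + (n(n+1) h + T^2 + T a) u, and w = u / sqrt h solves GLE_n(p, T). Up to a constant,
   1 / sqrt h is Psi_p, which returns to itself along the admissible cycles, so the period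
   monodromy of GLE_n(p, T) is that of the Lame equation, whatever (p, T) is. This makes sense
   because every solution of the Lame equation is single-valued on the complement of the lattice:
   the Frobenius solutions at a lattice point contain no logarithm. *)
theory Submission
  imports Defs
begin

section \<open>Second-order linear differential equations\<close>

text \<open>The complement of the lattice is not simply connected, so local solutions of the Lame
  equation must be shown to continue without branching. They are continued to growing discs with the
  lattice removed: all overlaps of the new balls and the old disc are convex, every nonempty one
  meets the old disc, and the absence of logarithms supplies solution pairs on whole punctured
  balls. A period then acts on a global pair by a constant matrix, and y' - T y has the same matrix
  since T does not depend on z; hence neither p nor T enters it. The potential of GLE is recognised
  through the partial fractions of a^2: double poles with coefficients 1, 1, 4 at p, -p, 0, opposite
  residues at p and -p given by wp''(p)/wp'(p), and a constant fixed by the expansion at 0. This is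
  the origin of the zeta terms and of B. The monodromy is a set of pairs that has to be a full
  conjugacy class, so admissible cycles must be constructed. A path on which \<Psi> returns to its
  negative is preceded by a circle around p, a simple pole of \<Psi>^2, which changes the
  sign.\<close>

definition ode_sol :: "(complex \<Rightarrow> complex) \<Rightarrow> complex set \<Rightarrow> (complex \<Rightarrow> complex) \<Rightarrow> bool" where
  "ode_sol q U f \<longleftrightarrow> f holomorphic_on U \<and> (\<forall>z\<in>U. deriv (deriv f) z = q z * f z)"

definition wronskian :: "(complex \<Rightarrow> complex) \<Rightarrow> (complex \<Rightarrow> complex) \<Rightarrow> complex \<Rightarrow> complex" where
  "wronskian f g z = f z * deriv g z - deriv f z * g z"

text \<open>Independence is encoded by a Wronskian without zeros: the condition restricts to smaller
  sets at once, and on a connected open set one point decides it because the Wronskian is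
  constant.\<close>

definition fund_pair ::
    "(complex \<Rightarrow> complex) \<Rightarrow> complex set \<Rightarrow> (complex \<Rightarrow> complex) \<Rightarrow> (complex \<Rightarrow> complex) \<Rightarrow> bool" where
  "fund_pair q U f g \<longleftrightarrow>
     ode_sol q U f \<and> ode_sol q U g \<and> (\<forall>z\<in>U. wronskian f g z \<noteq> 0)"

lemma ode_sol_subset: "ode_sol q U f \<Longrightarrow> V \<subseteq> U \<Longrightarrow> ode_sol q V f"
  unfolding ode_sol_def by (meson holomorphic_on_subset subsetD)

lemma fund_pair_subset: "fund_pair q U f g \<Longrightarrow> V \<subseteq> U \<Longrightarrow> fund_pair q V f g"
  unfolding fund_pair_def by (meson ode_sol_subset subsetD)

lemma deriv_eq_open:
  assumes "open U" "z \<in> U" "\<And>x. x \<in> U \<Longrightarrow> f x = g x"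
  shows "deriv f z = deriv g z"
  using assms by (intro deriv_cong_ev) (auto simp: eventually_nhds)

lemma deriv2_eq_open:
  assumes "open U" "z \<in> U" "\<And>x. x \<in> U \<Longrightarrow> f x = g x"
  shows "deriv (deriv f) z = deriv (deriv g) z"
  using assms by (intro deriv_eq_open[of U]) (auto intro: deriv_eq_open)

lemma ode_sol_cong:
  assumes "open U" "\<And>x. x \<in> U \<Longrightarrow> f x = g x" "ode_sol q U f"
  shows "ode_sol q U g"
proof -
  have "g holomorphic_on U"
    using assms holomorphic_cong unfolding ode_sol_def by metis
  moreover have "deriv (deriv g) z = q z * g z" if "z \<in> U" for z
    using assms that deriv2_eq_open[of U z f g] unfolding ode_sol_def by auto
  ultimately show ?thesis unfolding ode_sol_def by blast
qed

lemma ode_sol_DERIV: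
  assumes "open U" "ode_sol q U f" "z \<in> U"
  shows "(f has_field_derivative deriv f z) (at z)"
    and "(deriv f has_field_derivative q z * f z) (at z)"
proof -
  show "(f has_field_derivative deriv f z) (at z)"
    using assms holomorphic_derivI unfolding ode_sol_def by blast
  have "deriv f holomorphic_on U"
    using assms unfolding ode_sol_def by (auto intro: holomorphic_deriv)
  hence "(deriv f has_field_derivative deriv (deriv f) z) (at z)"
    using assms holomorphic_derivI by blast
  thus "(deriv f has_field_derivative q z * f z) (at z)"
    using assms unfolding ode_sol_def by simp
qed

text \<open>The derivative is supplied as an explicit function f', so that a solution is verified by
  two derivative computations and the value of \<open>deriv f\<close> comes with it.\<close>

lemma ode_solI:
  assumes "open U" "\<And>z. z \<in> U \<Longrightarrow> (f has_field_derivative f' z) (at z)"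
    "\<And>z. z \<in> U \<Longrightarrow> (f' has_field_derivative q z * f z) (at z)"
  shows "ode_sol q U f" "\<And>z. z \<in> U \<Longrightarrow> deriv f z = f' z"
proof -
  show *: "deriv f z = f' z" if "z \<in> U" for z
    using assms(2)[OF that] by (rule DERIV_imp_deriv)
  have "f holomorphic_on U"
    using assms(1,2) by (auto simp: holomorphic_on_open)
  moreover have "deriv (deriv f) z = q z * f z" if "z \<in> U" for z
  proof -
    have "deriv (deriv f) z = deriv f' z" by (rule deriv_eq_open[OF assms(1) that *])
    thus ?thesis using assms(3)[OF that] by (simp add: DERIV_imp_deriv)
  qed
  ultimately show "ode_sol q U f" unfolding ode_sol_def by blast
qed

lemma ode_sol_lincomb:
  assumes "open U" "ode_sol q U f" "ode_sol q U g"
  shows "ode_sol q U (\<lambda>z. a * f z + b * g z)"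
    and "\<And>z. z \<in> U \<Longrightarrow> deriv (\<lambda>z. a * f z + b * g z) z = a * deriv f z + b * deriv g z"
proof -
  have 1: "((\<lambda>z. a * f z + b * g z) has_field_derivative a * deriv f z + b * deriv g z) (at z)"
    and 2: "((\<lambda>z. a * deriv f z + b * deriv g z) has_field_derivative q z * (a * f z + b * g z)) (at z)"
    if "z \<in> U" for z
    using ode_sol_DERIV[OF assms(1,2) that] ode_sol_DERIV[OF assms(1,3) that]
    by (auto intro!: derivative_eq_intros simp: algebra_simps)
  show "ode_sol q U (\<lambda>z. a * f z + b * g z)"
    and "\<And>z. z \<in> U \<Longrightarrow> deriv (\<lambda>z. a * f z + b * g z) z = a * deriv f z + b * deriv g z"
    using ode_solI[OF assms(1) 1 2] by auto
qed

text \<open>Abel's identity for an equation without first-order term: f (q g) - (q f) g = 0.\<close>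

lemma wronskian_DERIV:
  assumes "open U" "ode_sol q U f" "ode_sol q U g" "z \<in> U"
  shows "(wronskian f g has_field_derivative 0) (at z)"
  using ode_sol_DERIV[OF assms(1,2,4)] ode_sol_DERIV[OF assms(1,3,4)]
  unfolding wronskian_def[abs_def] by (auto intro!: derivative_eq_intros simp: algebra_simps)

text \<open>Cramer's rule: the coefficients are quotients of Wronskians, and these are constant on
  U.\<close>

lemma ode_sol_span:
  assumes U: "open U" "connected U" "U \<noteq> {}" and fg: "fund_pair q U f g" and y: "ode_sol q U y"
  obtains a b where "\<And>z. z \<in> U \<Longrightarrow> y z = a * f z + b * g z"
proof -
  have f: "ode_sol q U f" and g: "ode_sol q U g" and W: "\<And>z. z \<in> U \<Longrightarrow> wronskian f g z \<noteq> 0"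
    using fg unfolding fund_pair_def by auto
  obtain w where w: "\<And>z. z \<in> U \<Longrightarrow> wronskian f g z = w"
    using has_field_derivative_0_imp_constant_on[of U "wronskian f g"] wronskian_DERIV[OF U(1) f g] U
    unfolding constant_on_def by metis
  obtain a where a: "\<And>z. z \<in> U \<Longrightarrow> wronskian y g z = a"
    using has_field_derivative_0_imp_constant_on[of U "wronskian y g"] wronskian_DERIV[OF U(1) y g] U
    unfolding constant_on_def by metis
  obtain b where b: "\<And>z. z \<in> U \<Longrightarrow> wronskian f y z = b"
    using has_field_derivative_0_imp_constant_on[of U "wronskian f y"] wronskian_DERIV[OF U(1) f y] U
    unfolding constant_on_def by metis
  show ?thesis
  proof (rule that[of "a / w" "b / w"])
    fix z assume z: "z \<in> U"
    have "wronskian f g z * y z = wronskian y g z * f z + wronskian f y z * g z"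
      unfolding wronskian_def by (simp add: algebra_simps)
    thus "y z = a / w * f z + b / w * g z"
      using W[OF z] w[OF z] a[OF z] b[OF z] by (simp add: field_simps)
  qed
qed

lemma ode_sol_unique:
  assumes "open U" "connected U" "open V" "V \<subseteq> U" "V \<noteq> {}"
    "ode_sol q U f" "ode_sol q U g" "\<And>z. z \<in> V \<Longrightarrow> f z = g z" "z \<in> U"
  shows "f z = g z"
  using analytic_continuation_open[of V U f g z] assms unfolding ode_sol_def by auto

lemma ode_sol_glue:
  assumes op: "\<And>i. i \<in> I \<Longrightarrow> open (U i)"
    and sol: "\<And>i. i \<in> I \<Longrightarrow> ode_sol q (U i) (y i)"
    and eq: "\<And>i j z. \<lbrakk>i \<in> I; j \<in> I; z \<in> U i; z \<in> U j\<rbrakk> \<Longrightarrow> y i z = y j z"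
  obtains Y where "ode_sol q (\<Union>i\<in>I. U i) Y" "\<And>i z. \<lbrakk>i \<in> I; z \<in> U i\<rbrakk> \<Longrightarrow> Y z = y i z"
proof -
  define Y where "Y z = y (SOME i. i \<in> I \<and> z \<in> U i) z" for z
  have Y: "Y z = y i z" if "i \<in> I" "z \<in> U i" for i z
  proof -
    have "(SOME i. i \<in> I \<and> z \<in> U i) \<in> I \<and> z \<in> U (SOME i. i \<in> I \<and> z \<in> U i)"
      by (rule someI[of _ i]) (use that in auto)
    thus ?thesis unfolding Y_def using eq that by blast
  qed
  have s: "ode_sol q (U i) Y" if "i \<in> I" for i
    by (rule ode_sol_cong[OF op[OF that] _ sol[OF that]]) (use Y that in auto)
  have "Y holomorphic_on (\<Union>i\<in>I. U i)"
    by (rule holomorphic_on_UN_open) (use s op in \<open>auto simp: ode_sol_def\<close>)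
  moreover have "deriv (deriv Y) z = q z * Y z" if "z \<in> (\<Union>i\<in>I. U i)" for z
    using that s unfolding ode_sol_def by blast
  ultimately have "ode_sol q (\<Union>i\<in>I. U i) Y"
    unfolding ode_sol_def by blast
  thus ?thesis using Y that by blast
qed

section \<open>Continuation over the complement of a closed countable set\<close>

lemma connected_Diff_countable_complex:
  fixes U :: "complex set"
  assumes "open U" "connected U" "countable S"
  shows "connected (U - S)"
  by (rule connected_open_diff_countable) (use assms in auto)

lemma open_Diff_countable_nonempty:
  fixes U :: "complex set"
  assumes "open U" "U \<noteq> {}" "countable S"
  shows "U - S \<noteq> {}"
proof
  assume "U - S = {}"
  hence "countable U" using assms(3) by (meson Diff_eq_empty_iff countable_subset)
  moreover obtain x e where "e > 0" "ball x e \<subseteq> U"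
    using assms(1,2) by (metis all_not_in_conv openE)
  ultimately show False using uncountable_ball countable_subset by blast
qed

text \<open>One step of continuation. At each point x of the bounding circle, y is on the overlap a
  combination of the local pair and so extends to a ball around x; compactness of the closed disc
  then gives room for a larger disc. Branching at points of S is excluded by \<open>loc\<close>,
  whose pairs live on a whole ball minus S.\<close>

lemma ode_sol_extend_ball:
  fixes S :: "complex set"
  assumes S: "closed S" "countable S" and R: "R > 0"
    and loc: "\<And>x. \<exists>e>0. \<exists>f g. fund_pair q (ball x e - S) f g"
    and y: "ode_sol q (ball 0 R - S) y"
  obtains R' Y where "R' > R" "ode_sol q (ball 0 R' - S) Y" "\<And>z. z \<in> ball 0 R - S \<Longrightarrow> Y z = y z"
proof -
  have "\<exists>e Y. e > 0 \<and> ode_sol q (ball x e - S) Y \<and> (\<forall>z\<in>ball 0 R \<inter> ball x e - S. Y z = y z)"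
    if x: "x \<in> sphere 0 R" for x
  proof -
    obtain e f g where e: "e > 0" and fg: "fund_pair q (ball x e - S) f g" using loc by metis
    let ?V = "ball 0 R \<inter> ball x e"
    have ne: "?V \<noteq> {}"
      using x R e open_Int_closure_eq_empty[of "ball x e" "ball 0 R"]
      by (metis Int_commute Int_iff centre_in_ball closure_ball empty_iff mem_cball mem_sphere open_ball order_refl)
    have "open (?V - S)" using S by auto
    moreover have "connected (?V - S)"
      by (intro connected_Diff_countable_complex convex_connected) (auto simp: S convex_Int)
    moreover have "?V - S \<noteq> {}" by (rule open_Diff_countable_nonempty) (use ne S in auto)
    moreover have "fund_pair q (?V - S) f g" by (rule fund_pair_subset[OF fg]) auto
    moreover have "ode_sol q (?V - S) y" by (rule ode_sol_subset[OF y]) auto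
    ultimately obtain a b where ab: "\<And>z. z \<in> ?V - S \<Longrightarrow> y z = a * f z + b * g z"
      by (rule ode_sol_span) blast
    have "ode_sol q (ball x e - S) (\<lambda>z. a * f z + b * g z)"
      by (rule ode_sol_lincomb) (use fg S in \<open>auto simp: fund_pair_def\<close>)
    thus ?thesis using e ab by (intro exI[of _ e] exI[of _ "\<lambda>z. a * f z + b * g z"]) auto
  qed
  then obtain e Yx where e: "\<And>x. x \<in> sphere 0 R \<Longrightarrow> e x > 0"
    and Yx: "\<And>x. x \<in> sphere 0 R \<Longrightarrow> ode_sol q (ball x (e x) - S) (Yx x)"
    and Yxy: "\<And>x z. x \<in> sphere 0 R \<Longrightarrow> z \<in> ball 0 R \<inter> ball x (e x) - S \<Longrightarrow> Yx x z = y z"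
    by metis
  define I where "I = insert None (Some ` sphere (0::complex) R)"
  define B where "B i = (case i of None \<Rightarrow> ball 0 R | Some x \<Rightarrow> ball x (e x))" for i
  define yy where "yy i = (case i of None \<Rightarrow> y | Some x \<Rightarrow> Yx x)" for i
  have sol: "ode_sol q (B i - S) (yy i)" if "i \<in> I" for i
    using that Yx y by (auto simp: I_def B_def yy_def)
  have eq: "yy i z = yy j z" if ij: "i \<in> I" "j \<in> I" and z: "z \<in> B i - S" "z \<in> B j - S" for i j z
  proof -
    have BI: "open (B i)" "convex (B i)" for i
      by (auto simp: B_def split: option.split)
    let ?U = "B i \<inter> B j"
    \<comment> \<open>The nearest-point projection onto the closed disc is 1-Lipschitz and fixes the
      centres of the new balls, so it maps every \<open>B i\<close> into itself. Hence two sets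
      \<open>B i\<close> that meet also meet inside the closed disc and, being open, inside the open
      disc, where both extensions equal y.\<close>
    have cp: "closest_point (cball 0 R) z \<in> B i" if "i \<in> I" "z \<in> B i" for i
    proof (cases i)
      case None
      hence "z \<in> cball 0 R" using that by (auto simp: B_def)
      thus ?thesis using that closest_point_self by metis
    next
      case (Some x)
      hence x: "x \<in> sphere 0 R" using that by (auto simp: I_def)
      have "dist (closest_point (cball 0 R) x) (closest_point (cball 0 R) z) \<le> dist x z"
        by (rule closest_point_lipschitz) (use R in auto)
      moreover have "closest_point (cball 0 R) x = x"
        by (rule closest_point_self) (use x in auto)
      ultimately show ?thesis using that Some by (auto simp: B_def)
    qed
    have "closest_point (cball 0 R) z \<in> ?U \<inter> closure (ball 0 R)"
      using cp ij z R closest_point_in_set[of "cball (0::complex) R" z] by auto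
    hence ne: "?U \<inter> ball 0 R \<noteq> {}"
      using open_Int_closure_eq_empty[of ?U "ball 0 R"] BI by blast
    have "connected (?U - S)"
      by (intro connected_Diff_countable_complex convex_connected) (auto simp: S convex_Int BI)
    moreover have "open (?U - S)" using BI S by auto
    moreover have "open (?U \<inter> ball 0 R - S)" by (intro open_Diff open_Int BI S open_ball)
    moreover have "open (?U \<inter> ball 0 R)" by (intro open_Int BI open_ball)
    hence "?U \<inter> ball 0 R - S \<noteq> {}"
      using ne S(2) by (rule open_Diff_countable_nonempty)
    moreover have "ode_sol q (?U - S) (yy i)" "ode_sol q (?U - S) (yy j)"
      by (rule ode_sol_subset[OF sol]; use ij in auto)+
    moreover have "yy i w = yy j w" if "w \<in> ?U \<inter> ball 0 R - S" for w
    proof -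
      have "yy k w = y w" if "k \<in> I" "w \<in> B k \<inter> ball 0 R - S" for k
        using that Yxy by (cases k) (auto simp: I_def yy_def B_def)
      from this[of i] this[of j] show ?thesis using that ij by simp
    qed
    moreover have "?U \<inter> ball 0 R - S \<subseteq> ?U - S" "z \<in> ?U - S" using z by auto
    ultimately show ?thesis
      by (meson ode_sol_unique)
  qed
  obtain Y where Y: "ode_sol q (\<Union>i\<in>I. B i - S) Y" and Yy: "\<And>i z. \<lbrakk>i \<in> I; z \<in> B i - S\<rbrakk> \<Longrightarrow> Y z = yy i z"
  proof (rule ode_sol_glue[of I "\<lambda>i. B i - S" q yy])
    show "open (B i - S)" for i using S by (auto simp: B_def split: option.split)
  qed (use sol eq in blast)+
  have cb: "cball 0 R \<subseteq> (\<Union>i\<in>I. B i)"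
  proof
    fix z :: complex assume "z \<in> cball 0 R"
    hence "z \<in> ball 0 R \<or> z \<in> sphere 0 R" by auto
    thus "z \<in> (\<Union>i\<in>I. B i)"
    proof
      assume "z \<in> ball 0 R"
      thus ?thesis by (auto simp: I_def B_def)
    next
      assume "z \<in> sphere 0 R"
      hence "Some z \<in> I" "z \<in> B (Some z)" using e by (auto simp: I_def B_def)
      thus ?thesis by blast
    qed
  qed
  have "open (\<Union>i\<in>I. B i)" by (intro open_UN) (auto simp: B_def split: option.split)
  then obtain d where d: "d > 0" "(\<Union>x\<in>cball 0 R. cball x d) \<subseteq> (\<Union>i\<in>I. B i)"
    using compact_subset_open_imp_cball_epsilon_subset[OF compact_cball _ cb] by blast
  have "ball 0 (R + d) \<subseteq> (\<Union>x\<in>cball (0::complex) R. cball x d)"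
  proof
    fix z :: complex assume z: "z \<in> ball 0 (R + d)"
    show "z \<in> (\<Union>x\<in>cball (0::complex) R. cball x d)"
    proof (cases "norm z \<le> R")
      case True
      thus ?thesis using d by (intro UN_I[of z]) auto
    next
      case False
      let ?x = "of_real (R / norm z) * z"
      have "norm z > 0" using False R by linarith
      have "norm ?x = R" using \<open>norm z > 0\<close> R by (auto simp: norm_mult norm_divide)
      moreover have "?x - z = of_real (R / norm z - 1) * z" by (simp add: algebra_simps)
      hence "norm (?x - z) = \<bar>R / norm z - 1\<bar> * norm z" by (simp only: norm_mult norm_of_real)
      moreover have "\<bar>R / norm z - 1\<bar> * norm z = norm z - R"
        using False \<open>norm z > 0\<close> R by (simp add: abs_if field_simps)
      ultimately have "norm ?x = R" "norm (?x - z) \<le> d" using z by auto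
      thus ?thesis by (intro UN_I[of ?x]) (auto simp: dist_norm)
    qed
  qed
  hence "ball 0 (R + d) - S \<subseteq> (\<Union>i\<in>I. B i - S)" using d by blast
  hence "ode_sol q (ball 0 (R + d) - S) Y" by (rule ode_sol_subset[OF Y])
  moreover have "Y z = y z" if "z \<in> ball 0 R - S" for z
    using Yy[of None z] that by (auto simp: I_def B_def yy_def)
  ultimately show ?thesis using that[of "R + d" Y] d by auto
qed

text \<open>The radii to which y extends are unbounded: with a finite supremum s, the extensions to
  smaller discs would glue to one on the disc of radius s, and \<open>ode_sol_extend_ball\<close>
  would enlarge that disc.\<close>

lemma ode_sol_extend_UNIV:
  fixes S :: "complex set"
  assumes S: "closed S" "countable S" and r: "r > 0"
    and loc: "\<And>x. \<exists>e>0. \<exists>f g. fund_pair q (ball x e - S) f g"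
    and y: "ode_sol q (ball 0 r - S) y"
  obtains Y where "ode_sol q (- S) Y" "\<And>z. z \<in> ball 0 r - S \<Longrightarrow> Y z = y z"
proof -
  define E where "E R Y \<longleftrightarrow> R \<ge> r \<and> ode_sol q (ball 0 R - S) Y \<and> (\<forall>z\<in>ball 0 r - S. Y z = y z)" for R Y
  define A where "A = {R. \<exists>Y. E R Y}"
  define ys where "ys R = (SOME Y. E R Y)" for R
  have ys: "E R (ys R)" if "R \<in> A" for R
    using that unfolding A_def ys_def mem_Collect_eq by (rule someI_ex)
  have rA: "r \<in> A" using y by (auto simp: A_def E_def)
  have uniq: "ys R z = ys R' z" if "R \<in> A" "R' \<in> A" "z \<in> ball 0 R - S" "z \<in> ball 0 R' - S" for R R' z
  proof -
    let ?m = "min R R'"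
    have E: "E R (ys R)" "E R' (ys R')" using ys that by auto
    have "ode_sol q (ball 0 ?m - S) (ys R)" "ode_sol q (ball 0 ?m - S) (ys R')"
      using E by (auto simp: E_def intro: ode_sol_subset)
    moreover have "ys R w = ys R' w" if "w \<in> ball 0 r - S" for w using E that by (auto simp: E_def)
    moreover have "open (ball 0 ?m - S)" "open (ball 0 r - S)" using S by auto
    moreover have "connected (ball 0 ?m - S)"
      by (rule connected_Diff_countable_complex) (use S in auto)
    moreover have "ball 0 r - S \<noteq> {}"
      by (rule open_Diff_countable_nonempty) (use r S in auto)
    moreover have "ball 0 r - S \<subseteq> ball 0 ?m - S" using E by (auto simp: E_def)
    ultimately show ?thesis
      by (intro ode_sol_unique[of "ball 0 ?m - S" "ball 0 r - S" q "ys R" "ys R'" z]) (use that in auto)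
  qed
  obtain Y where Y: "ode_sol q (\<Union>R\<in>A. ball 0 R - S) Y" and Yy: "\<And>R z. \<lbrakk>R \<in> A; z \<in> ball 0 R - S\<rbrakk> \<Longrightarrow> Y z = ys R z"
  proof (rule ode_sol_glue[of A "\<lambda>R. ball 0 R - S" q ys])
    show "open (ball 0 R - S)" for R using S by auto
    show "ode_sol q (ball 0 R - S) (ys R)" if "R \<in> A" for R
      using ys[OF that] by (simp add: E_def)
  qed (use uniq in blast)+
  have Yr: "Y z = y z" if "z \<in> ball 0 r - S" for z
    using Yy[OF rA that] ys[OF rA] that by (auto simp: E_def)
  have unb: "\<exists>R\<in>A. R > b" for b
  proof (rule ccontr)
    assume "\<not> ?thesis"
    hence bd: "bdd_above A" by (auto simp: bdd_above_def not_less)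
    define s where "s = Sup A"
    have sr: "s \<ge> r" unfolding s_def using rA bd by (rule cSup_upper)
    have "ball 0 s - S \<subseteq> (\<Union>R\<in>A. ball 0 R - S)"
    proof
      fix z assume z: "z \<in> ball 0 s - S"
      then obtain R where "R \<in> A" "norm z < R"
        using less_cSup_iff[OF _ bd, of "norm z"] rA by (auto simp: s_def)
      thus "z \<in> (\<Union>R\<in>A. ball 0 R - S)" using z by auto
    qed
    hence "ode_sol q (ball 0 s - S) Y" by (rule ode_sol_subset[OF Y])
    then obtain R' Y' where R': "R' > s" "ode_sol q (ball 0 R' - S) Y'" "\<And>z. z \<in> ball 0 s - S \<Longrightarrow> Y' z = Y z"
      by (rule ode_sol_extend_ball[OF S less_le_trans[OF r sr] loc]) blast
    have "E R' Y'" using R' sr Yr by (auto simp: E_def)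
    hence "R' \<in> A" by (auto simp: A_def)
    hence "R' \<le> s" unfolding s_def using bd by (rule cSup_upper)
    thus False using R' by simp
  qed
  have "- S \<subseteq> (\<Union>R\<in>A. ball 0 R - S)"
  proof
    fix z assume z: "z \<in> - S"
    obtain R where "R \<in> A" "R > norm z" using unb by blast
    thus "z \<in> (\<Union>R\<in>A. ball 0 R - S)" using z by auto
  qed
  hence "ode_sol q (- S) Y" by (rule ode_sol_subset[OF Y])
  thus ?thesis using Yr that by blast
qed

text \<open>The two members of a local pair at 0 are continued separately. Their Wronskian is
  constant on the connected complement of S, so it stays nonzero.\<close>

theorem fund_pair_global:
  fixes S :: "complex set"
  assumes S: "closed S" "countable S"
    and loc: "\<And>x. \<exists>e>0. \<exists>f g. fund_pair q (ball x e - S) f g"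
  obtains f g where "fund_pair q (- S) f g"
proof -
  obtain r f0 g0 where r: "r > 0" and fg: "fund_pair q (ball 0 r - S) f0 g0" using loc by metis
  have fg0: "ode_sol q (ball 0 r - S) f0" "ode_sol q (ball 0 r - S) g0"
    using fg unfolding fund_pair_def by auto
  obtain f where f: "ode_sol q (- S) f" "\<And>z. z \<in> ball 0 r - S \<Longrightarrow> f z = f0 z"
    by (rule ode_sol_extend_UNIV[OF S r loc fg0(1)]) blast
  obtain g where g: "ode_sol q (- S) g" "\<And>z. z \<in> ball 0 r - S \<Longrightarrow> g z = g0 z"
    by (rule ode_sol_extend_UNIV[OF S r loc fg0(2)]) blast
  have o: "open (- S)" "open (ball 0 r - S)" using S by auto
  have "connected (UNIV - S)" by (rule connected_Diff_countable_complex) (use S in auto)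
  hence c: "connected (- S)" unfolding Compl_eq_Diff_UNIV .
  obtain w where w: "\<And>z. z \<in> - S \<Longrightarrow> wronskian f g z = w"
    using has_field_derivative_0_imp_constant_on[of "- S" "wronskian f g"] wronskian_DERIV[OF o(1) f(1) g(1)] c o(1)
    unfolding constant_on_def by blast
  have "ball 0 r - S \<noteq> {}" by (rule open_Diff_countable_nonempty) (use r S in auto)
  then obtain z where z: "z \<in> ball 0 r - S" by blast
  have "wronskian f g z = wronskian f0 g0 z"
    unfolding wronskian_def using f(2)[OF z] g(2)[OF z] deriv_eq_open[OF o(2) z f(2)] deriv_eq_open[OF o(2) z g(2)] by simp
  hence "w \<noteq> 0" using w z fg unfolding fund_pair_def by auto
  hence "fund_pair q (- S) f g" unfolding fund_pair_def using f g w by auto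
  thus ?thesis using that by blast
qed

section \<open>Frobenius solutions\<close>

text \<open>Series coefficients of the solution \<open>z\<^sup>\<rho> (1 + c\<^sub>1 z + \<dots>)\<close> of \<open>z\<^sup>2 y'' = Q y\<close>.
  At a resonance the denominator vanishes, and the coefficient is 0 since \<open>x / 0 = 0\<close>.\<close>

fun frobenius_coeff :: "complex fps \<Rightarrow> complex \<Rightarrow> nat \<Rightarrow> complex" where
  "frobenius_coeff Q \<rho> k =
     (if k = 0 then 1
      else (\<Sum>i<k. fps_nth Q (k - i) * frobenius_coeff Q \<rho> i) /
             ((\<rho> + of_nat k) * (\<rho> + of_nat k - 1) - fps_nth Q 0))"

declare frobenius_coeff.simps [simp del]

lemma fps_nth_geometric_bound:
  fixes Q :: "complex fps"
  assumes "fps_conv_radius Q > 0"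
  obtains M r :: real where "M > 0" "r > 0" "\<And>k. norm (fps_nth Q k) \<le> M * r ^ k"
proof -
  obtain s :: real where s: "0 < s" "ereal s < fps_conv_radius Q"
    using assms ereal_dense2 by (metis ereal_less(2))
  have "summable (\<lambda>k. norm (fps_nth Q k * of_real s ^ k))"
    by (rule norm_summable_fps) (use s in auto)
  from summable_imp_Bseq[OF this] obtain M where M: "\<And>k. norm (fps_nth Q k * of_real s ^ k) \<le> M"
    unfolding Bseq_def by auto
  show ?thesis
  proof (rule that[of "max M 1" "1 / s"])
    show "norm (fps_nth Q k) \<le> max M 1 * (1 / s) ^ k" for k
      using M[of k] s by (simp add: norm_mult norm_power field_simps)
  qed (use s in auto)
qed

text \<open>The k-th coefficient is a sum of k terms divided by a number of norm at least k. The two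
  factors k cancel, so a geometric bound \<open>K ^ k\<close> survives the recursion; a resonant
  coefficient is 0 and satisfies it trivially.\<close>

lemma frobenius_coeff_radius:
  assumes "fps_conv_radius Q > 0"
    and d: "\<And>k. k > 0 \<Longrightarrow> (\<rho> + of_nat k) * (\<rho> + of_nat k - 1) - fps_nth Q 0 \<noteq> 0 \<Longrightarrow>
              norm ((\<rho> + of_nat k) * (\<rho> + of_nat k - 1) - fps_nth Q 0) \<ge> real k"
  shows "fps_conv_radius (Abs_fps (frobenius_coeff Q \<rho>)) > 0"
proof -
  obtain M r where M: "M > 0" and r: "r > 0" and Q: "\<And>k. norm (fps_nth Q k) \<le> M * r ^ k"
    using fps_nth_geometric_bound[OF assms(1)] by blast
  \<comment> \<open>K bounds both r and M r, the factors into which \<open>M * r ^ (k - i)\<close>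
    splits when k - i is at least 1.\<close>
  define K where "K = r * (1 + M)"
  have K: "K > 0" "r \<le> K" "M * r \<le> K" using M r by (auto simp: K_def distrib_left intro!: add_pos_pos)
  have c: "norm (frobenius_coeff Q \<rho> k) \<le> K ^ k" for k
  proof (induction k rule: less_induct)
    case (less k)
    show ?case
    proof (cases "k = 0")
      case True thus ?thesis by (simp add: frobenius_coeff.simps)
    next
      case False
      let ?d = "(\<rho> + of_nat k) * (\<rho> + of_nat k - 1) - fps_nth Q 0"
      let ?s = "\<Sum>i<k. fps_nth Q (k - i) * frobenius_coeff Q \<rho> i"
      have eq: "frobenius_coeff Q \<rho> k = ?s / ?d"
        using False by (subst frobenius_coeff.simps) simp
      show ?thesis
      proof (cases "?d = 0")
        case True thus ?thesis using eq K by simp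
      next
        case nz: False
        have "norm ?s \<le> (\<Sum>i<k. K * K ^ (k - 1))"
        proof (rule sum_norm_le)
          fix i assume "i \<in> {..<k}"
          hence i: "i < k" by simp
          then obtain j where j: "k = Suc (i + j)" using less_imp_Suc_add by blast
          have "norm (fps_nth Q (k - i) * frobenius_coeff Q \<rho> i) \<le> (M * r ^ (k - i)) * K ^ i"
            unfolding norm_mult by (rule mult_mono) (use Q less[OF i] M r in auto)
          also have "\<dots> = (M * r) * r ^ j * K ^ i" using j by simp
          also have "\<dots> \<le> K * K ^ j * K ^ i"
            by (intro mult_right_mono mult_mono power_mono) (use K M r in auto)
          also have "\<dots> = K * K ^ (k - 1)" using j by (simp add: power_add)
          finally show "norm (fps_nth Q (k - i) * frobenius_coeff Q \<rho> i) \<le> K * K ^ (k - 1)" .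
        qed
        also have "\<dots> = real k * K ^ k" using False by (cases k) auto
        finally have 1: "norm ?s \<le> real k * K ^ k" .
        have "norm ?d \<ge> real k" using d[of k] nz False by simp
        have "norm (frobenius_coeff Q \<rho> k) = norm ?s / norm ?d" unfolding eq by (rule norm_divide)
        also have "\<dots> \<le> (real k * K ^ k) / real k"
          by (rule frac_le) (use 1 \<open>norm ?d \<ge> real k\<close> False K in auto)
        finally show ?thesis using False by simp
      qed
    qed
  qed
  have "summable (\<lambda>k. frobenius_coeff Q \<rho> k * of_real (1 / (2 * K)) ^ k)"
  proof (rule summable_comparison_test[OF _ summable_geometric[of "1/2::real"]])
    have "norm (frobenius_coeff Q \<rho> k * of_real (1 / (2 * K)) ^ k) \<le> (1/2) ^ k" for k
    proof -
      have "norm (frobenius_coeff Q \<rho> k * of_real (1 / (2 * K)) ^ k) \<le> K ^ k * (1 / (2 * K)) ^ k"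
        unfolding norm_mult norm_power norm_of_real using c[of k] K by (intro mult_mono power_mono) auto
      also have "\<dots> = (1/2) ^ k" using K by (simp flip: power_mult_distrib)
      finally show ?thesis .
    qed
    thus "\<exists>N. \<forall>k\<ge>N. norm (frobenius_coeff Q \<rho> k * of_real (1 / (2 * K)) ^ k) \<le> (1/2) ^ k" by blast
  qed auto
  hence "ereal (norm (of_real (1 / (2 * K)) :: complex)) \<le> conv_radius (frobenius_coeff Q \<rho>)" by (rule conv_radius_geI)
  moreover have "norm (of_real (1 / (2 * K)) :: complex) > 0" using K by simp
  ultimately show ?thesis unfolding fps_conv_radius_def
    by (metis ereal_less(2) fps_nth_Abs_fps order_less_le_trans ext)
qed

text \<open>This is z^2 y'' = Q y for y = z^\<rho> C after division by z^\<rho>, with \<rho> (\<rho>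
  - 1) replaced by the constant coefficient of Q. The hypothesis \<open>res\<close> is the absence
  of a logarithm: where the factor of the k-th coefficient vanishes, the rest of the recursion must
  vanish as well.\<close>

lemma frobenius_fps_eq:
  assumes ind: "\<rho> * (\<rho> - 1) = fps_nth Q 0"
    and res: "\<And>k. k > 0 \<Longrightarrow> (\<rho> + of_nat k) * (\<rho> + of_nat k - 1) = fps_nth Q 0 \<Longrightarrow>
                (\<Sum>i<k. fps_nth Q (k - i) * frobenius_coeff Q \<rho> i) = 0"
  defines "C \<equiv> Abs_fps (frobenius_coeff Q \<rho>)"
  shows "fps_X ^ 2 * fps_deriv (fps_deriv C) + fps_const (2 * \<rho>) * (fps_X * fps_deriv C) + fps_const (fps_nth Q 0) * C = Q * C"
proof (rule fps_ext)
  fix k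
  let ?c = "frobenius_coeff Q \<rho>"
  have L: "fps_nth (fps_X ^ 2 * fps_deriv (fps_deriv C) + fps_const (2 * \<rho>) * (fps_X * fps_deriv C) + fps_const (fps_nth Q 0) * C) k
      = (of_nat k * (of_nat k - 1) + 2 * \<rho> * of_nat k + fps_nth Q 0) * ?c k"
  proof (cases k)
    case 0 thus ?thesis by (simp add: C_def fps_X_power_mult_nth)
  next
    case (Suc j) thus ?thesis
      by (cases j) (auto simp add: C_def fps_X_power_mult_nth algebra_simps power2_eq_square)
  qed
  have R: "fps_nth (Q * C) k = fps_nth Q 0 * ?c k + (\<Sum>i<k. fps_nth Q (k - i) * ?c i)"
  proof -
    have "fps_nth (Q * C) k = (\<Sum>i\<le>k. fps_nth Q (k - i) * ?c i)"
      unfolding mult.commute[of Q C] by (simp add: fps_mult_nth C_def atLeast0AtMost mult.commute[of "fps_nth Q _"])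
    also have "{..k} = insert k {..<k}" by auto
    finally show ?thesis by simp
  qed
  have "(of_nat k * (of_nat k - 1) + 2 * \<rho> * of_nat k) * ?c k = (\<Sum>i<k. fps_nth Q (k - i) * ?c i)"
  proof (cases "k = 0")
    case False
    let ?d = "(\<rho> + of_nat k) * (\<rho> + of_nat k - 1) - fps_nth Q 0"
    have d: "of_nat k * (of_nat k - 1) + 2 * \<rho> * of_nat k = ?d"
      unfolding ind[symmetric] by (simp add: algebra_simps)
    have eq: "?c k = (\<Sum>i<k. fps_nth Q (k - i) * ?c i) / ?d"
      using False by (subst frobenius_coeff.simps) simp
    show ?thesis
    proof (cases "?d = 0")
      case True
      thus ?thesis using res[of k] False unfolding d by simp
    next
      case False
      thus ?thesis unfolding d using eq by simp
    qed
  qed auto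
  thus "fps_nth (fps_X ^ 2 * fps_deriv (fps_deriv C) + fps_const (2 * \<rho>) * (fps_X * fps_deriv C) + fps_const (fps_nth Q 0) * C) k
      = fps_nth (Q * C) k" unfolding L R by (simp add: algebra_simps)
qed

section \<open>Frobenius solutions with integer exponents\<close>

text \<open>An integer exponent m makes \<open>z powi m\<close> single-valued on the punctured ball.
  It also makes the denominator k (k + 2 m - 1) an integer multiple of k, hence of norm at least k
  unless it is 0, as the radius estimate demands.\<close>

lemma frobenius_solution:
  fixes m :: int
  assumes Q: "F has_fps_expansion Q" and ind: "of_int m * (of_int m - 1) = fps_nth Q 0"
    and res: "\<And>k. k > 0 \<Longrightarrow> (of_int m + of_nat k) * (of_int m + of_nat k - 1) = fps_nth Q 0 \<Longrightarrow>
                (\<Sum>i<k. fps_nth Q (k - i) * frobenius_coeff Q (of_int m) i) = 0"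
  obtains e P where "e > 0" "P holomorphic_on ball 0 e" "P 0 = 1"
    "ode_sol (\<lambda>z. F z / z ^ 2) (ball 0 e - {0}) (\<lambda>z. z powi m * P z)"
    "\<And>z. z \<in> ball 0 e - {0} \<Longrightarrow>
       deriv (\<lambda>z. z powi m * P z) z = of_int m * z powi (m - 1) * P z + z powi m * deriv P z"
proof -
  define C where "C = Abs_fps (frobenius_coeff Q (of_int m))"
  define P where "P = eval_fps C"
  have Cr: "fps_conv_radius C > 0" unfolding C_def
  proof (rule frobenius_coeff_radius)
    show "fps_conv_radius Q > 0" using Q unfolding has_fps_expansion_def by blast
  next
    fix k :: nat
    let ?d = "(of_int m + of_nat k) * (of_int m + of_nat k - 1) - fps_nth Q 0"
    assume k: "k > 0" and nz: "?d \<noteq> 0"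
    have d: "?d = of_int (int k * (int k + 2 * m - 1))"
      unfolding ind[symmetric] by (simp add: algebra_simps)
    hence "int k * (int k + 2 * m - 1) \<noteq> 0" using nz by (metis of_int_0)
    hence "\<bar>int k + 2 * m - 1\<bar> \<ge> 1" by auto
    hence "int k * 1 \<le> int k * \<bar>int k + 2 * m - 1\<bar>" by (intro mult_left_mono) auto
    also have "\<dots> = \<bar>int k * (int k + 2 * m - 1)\<bar>" by (simp add: abs_mult)
    finally have "real_of_int (int k) \<le> real_of_int \<bar>int k * (int k + 2 * m - 1)\<bar>" by linarith
    thus "norm ?d \<ge> real k" unfolding d norm_of_int by simp
  qed
  have PC: "P has_fps_expansion C" unfolding P_def using Cr by (rule eval_fps_has_fps_expansion)
  let ?L = "\<lambda>z. z ^ 2 * deriv (deriv P) z + 2 * of_int m * (z * deriv P z) + fps_nth Q 0 * P z"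
  have "?L has_fps_expansion
      fps_X ^ 2 * fps_deriv (fps_deriv C) + fps_const (2 * of_int m) * (fps_X * fps_deriv C) + fps_const (fps_nth Q 0) * C"
    by (intro fps_expansion_intros PC)
  also have "\<dots> = Q * C" unfolding C_def by (rule frobenius_fps_eq[OF ind res])
  finally have "\<forall>\<^sub>F z in nhds 0. eval_fps (Q * C) z = ?L z" by (simp add: has_fps_expansion_def)
  moreover have "(\<lambda>z. F z * P z) has_fps_expansion Q * C" by (intro fps_expansion_intros Q PC)
  hence "\<forall>\<^sub>F z in nhds 0. eval_fps (Q * C) z = F z * P z" by (simp add: has_fps_expansion_def)
  ultimately have "\<forall>\<^sub>F z in nhds 0. ?L z = F z * P z" by eventually_elim simp
  then obtain e1 where e1: "e1 > 0" "\<And>z. dist z 0 < e1 \<Longrightarrow> ?L z = F z * P z"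
    unfolding eventually_nhds_metric by blast
  have "P analytic_on {0}" using PC by (rule has_fps_expansion_imp_analytic_0)
  then obtain e2 where e2: "e2 > 0" "P holomorphic_on ball 0 e2" by (auto simp: analytic_at_ball)
  define e where "e = min e1 e2"
  have e: "e > 0" "e \<le> e1" "e \<le> e2" using e1 e2 by (auto simp: e_def)
  have hP: "P holomorphic_on ball 0 e" using e2(2) subset_ball[OF e(3)] by (rule holomorphic_on_subset)
  have P: "(P has_field_derivative deriv P z) (at z)"
    and P': "(deriv P has_field_derivative deriv (deriv P) z) (at z)" if "z \<in> ball 0 e" for z
    by (rule holomorphic_derivI[OF _ open_ball that]; intro holomorphic_deriv hP open_ball)+
  have id: "z ^ 2 * deriv (deriv P) z + 2 * of_int m * (z * deriv P z) + of_int m * (of_int m - 1) * P z = F z * P z"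
    if "z \<in> ball 0 e" for z
    unfolding ind using e1(2)[of z] that e by simp
  let ?f = "\<lambda>z. z powi m * P z"
  let ?f' = "\<lambda>z. of_int m * z powi (m - 1) * P z + z powi m * deriv P z"
  have f: "(?f has_field_derivative ?f' z) (at z)" if "z \<in> ball 0 e - {0}" for z
    using that P[of z] by (auto intro!: derivative_eq_intros)
  have f': "(?f' has_field_derivative (F z / z ^ 2) * ?f z) (at z)" if z: "z \<in> ball 0 e - {0}" for z
  proof -
    let ?g = "of_int m * (of_int (m - 1) * z powi (m - 1 - 1)) * P z + of_int m * z powi (m - 1) * deriv P z
       + (of_int m * z powi (m - 1) * deriv P z + z powi m * deriv (deriv P) z)"
    have "(?f' has_field_derivative ?g) (at z)"
      using z P[of z] P'[of z] by (auto intro!: derivative_eq_intros simp: algebra_simps)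
    moreover have "?g = (F z / z ^ 2) * ?f z"
    proof -
      have p: "z powi (m - 1) = z powi m / z" "z powi (m - 1 - 1) = z powi m / z ^ 2"
        using z by (auto simp: power_int_diff power2_eq_square)
      have "?g = z powi m / z ^ 2 * (z ^ 2 * deriv (deriv P) z + 2 * of_int m * (z * deriv P z) + of_int m * (of_int m - 1) * P z)"
        using z unfolding p by (simp add: field_simps power2_eq_square)
      also have "\<dots> = z powi m / z ^ 2 * (F z * P z)" using id[of z] z by simp
      finally show ?thesis by simp
    qed
    ultimately show ?thesis by simp
  qed
  show ?thesis
  proof (rule that[of e P])
    show "e > 0" by fact
    show "P holomorphic_on ball 0 e" by fact
    show "P 0 = 1" by (simp add: P_def eval_fps_at_0 C_def frobenius_coeff.simps)
    have o: "open (ball 0 e - {0::complex})" by auto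
    show "ode_sol (\<lambda>z. F z / z ^ 2) (ball 0 e - {0}) ?f"
      by (rule ode_solI(1)[OF o f f'])
    show "deriv ?f z = of_int m * z powi (m - 1) * P z + z powi m * deriv P z" if "z \<in> ball 0 e - {0}" for z
      using ode_solI(2)[OF o f f' that] by simp
  qed
qed

text \<open>Two integers with sum 1 are distinct, and their difference is the limit of the Wronskian
  at 0; this makes the two solutions a fundamental pair on a small punctured ball.\<close>

lemma frobenius_pair:
  fixes m1 m2 :: int
  assumes Q: "F has_fps_expansion Q"
    and m: "m1 + m2 = 1" "m1 * m2 = -N" "fps_nth Q 0 = of_int N"
    and res: "\<And>m k. m \<in> {m1, m2} \<Longrightarrow> k > 0 \<Longrightarrow> (of_int m + of_nat k) * (of_int m + of_nat k - 1) = fps_nth Q 0 \<Longrightarrow>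
                (\<Sum>i<k. fps_nth Q (k - i) * frobenius_coeff Q (of_int m) i) = 0"
  obtains e P1 P2 where "e > 0" "P1 holomorphic_on ball 0 e" "P2 holomorphic_on ball 0 e"
    "fund_pair (\<lambda>z. F z / z ^ 2) (ball 0 e - {0}) (\<lambda>z. z powi m1 * P1 z) (\<lambda>z. z powi m2 * P2 z)"
proof -
  have ind: "of_int m * (of_int m - 1) = fps_nth Q 0" if "m \<in> {m1, m2}" for m
  proof -
    have m2: "m2 = 1 - m1" using m(1) by auto
    have "m1 - m1 * m1 = - N" using m(2) unfolding m2 by (simp add: algebra_simps)
    hence "m1 * (m1 - 1) = N" "m2 * (m2 - 1) = N" unfolding m2 by (simp_all add: algebra_simps)
    hence "m * (m - 1) = N" using that by auto
    hence "of_int (m * (m - 1)) = (of_int N :: complex)" by simp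
    thus ?thesis using m(3) by simp
  qed
  obtain e1 P1 where 1: "e1 > 0" "P1 holomorphic_on ball 0 e1" "P1 0 = 1"
    "ode_sol (\<lambda>z. F z / z ^ 2) (ball 0 e1 - {0}) (\<lambda>z. z powi m1 * P1 z)"
    "\<And>z. z \<in> ball 0 e1 - {0} \<Longrightarrow>
       deriv (\<lambda>z. z powi m1 * P1 z) z = of_int m1 * z powi (m1 - 1) * P1 z + z powi m1 * deriv P1 z"
    by (rule frobenius_solution[OF Q ind[of m1] res[of m1]]) auto
  obtain e2 P2 where 2: "e2 > 0" "P2 holomorphic_on ball 0 e2" "P2 0 = 1"
    "ode_sol (\<lambda>z. F z / z ^ 2) (ball 0 e2 - {0}) (\<lambda>z. z powi m2 * P2 z)"
    "\<And>z. z \<in> ball 0 e2 - {0} \<Longrightarrow>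
       deriv (\<lambda>z. z powi m2 * P2 z) z = of_int m2 * z powi (m2 - 1) * P2 z + z powi m2 * deriv P2 z"
    by (rule frobenius_solution[OF Q ind[of m2] res[of m2]]) auto
  define e0 where "e0 = min e1 e2"
  have e0: "e0 > 0" "e0 \<le> e1" "e0 \<le> e2" using 1 2 by (auto simp: e0_def)
  have hP: "P1 holomorphic_on ball 0 e0" "P2 holomorphic_on ball 0 e0"
    by (rule holomorphic_on_subset[OF 1(2) subset_ball[OF e0(2)]], rule holomorphic_on_subset[OF 2(2) subset_ball[OF e0(3)]])
  \<comment> \<open>Since z^m1 z^m2 = z, all powers of z cancel in the Wronskian up to H, which is
    holomorphic also at 0, with value m2 - m1 there.\<close>
  define H where "H z = of_int (m2 - m1) * P1 z * P2 z + z * (P1 z * deriv P2 z - deriv P1 z * P2 z)" for z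
  have W: "wronskian (\<lambda>z. z powi m1 * P1 z) (\<lambda>z. z powi m2 * P2 z) z = H z" if z: "z \<in> ball 0 e0 - {0}" for z
  proof -
    have "z powi m1 * z powi m2 = z" using m(1) z power_int_add[of z m1 m2] by simp
    hence p: "z powi m2 = z / z powi m1" using z by (auto simp: field_simps)
    have d1: "deriv (\<lambda>z. z powi m1 * P1 z) z = of_int m1 * (z powi m1 / z) * P1 z + z powi m1 * deriv P1 z"
      and d2: "deriv (\<lambda>z. z powi m2 * P2 z) z = of_int m2 * (z powi m2 / z) * P2 z + z powi m2 * deriv P2 z"
      using 1(5)[of z] 2(5)[of z] z e0 by (auto simp: power_int_diff)
    show ?thesis unfolding wronskian_def d1 d2 H_def p using z by (simp add: field_simps)
  qed
  have "H holomorphic_on ball 0 e0" unfolding H_def[abs_def]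
    by (intro holomorphic_intros holomorphic_deriv hP) auto
  hence "continuous (at 0) H"
    using e0 by (auto intro: holomorphic_on_imp_continuous_on continuous_on_interior)
  moreover have "m1 \<noteq> m2" using m(1) by presburger
  hence "H 0 \<noteq> 0" by (simp add: H_def 1 2)
  ultimately obtain d where d: "d > 0" "\<And>z. dist 0 z < d \<Longrightarrow> H z \<noteq> 0"
    using continuous_at_avoid[of 0 H 0] by (metis dist_commute)
  define e where "e = min d e0"
  have e: "e > 0" "e \<le> e0" "e \<le> d" using d e0 by (auto simp: e_def)
  show ?thesis
  proof (rule that[of e P1 P2])
    show "P1 holomorphic_on ball 0 e" "P2 holomorphic_on ball 0 e"
      using hP e by (auto intro: holomorphic_on_subset)
    show "fund_pair (\<lambda>z. F z / z ^ 2) (ball 0 e - {0}) (\<lambda>z. z powi m1 * P1 z) (\<lambda>z. z powi m2 * P2 z)"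
      unfolding fund_pair_def
    proof (intro conjI ballI)
      show "ode_sol (\<lambda>z. F z / z ^ 2) (ball 0 e - {0}) (\<lambda>z. z powi m1 * P1 z)"
        by (rule ode_sol_subset[OF 1(4)]) (use e e0 in auto)
      show "ode_sol (\<lambda>z. F z / z ^ 2) (ball 0 e - {0}) (\<lambda>z. z powi m2 * P2 z)"
        by (rule ode_sol_subset[OF 2(4)]) (use e e0 in auto)
      show "wronskian (\<lambda>z. z powi m1 * P1 z) (\<lambda>z. z powi m2 * P2 z) z \<noteq> 0" if "z \<in> ball 0 e - {0}" for z
        using W[of z] d(2)[of z] that e by (auto simp: dist_norm)
    qed
  qed (use e in auto)
qed

section \<open>Solution pairs at ordinary points and at double poles\<close>

lemma fund_pair_cong_potential:
  "fund_pair q U f g \<Longrightarrow> (\<And>z. z \<in> U \<Longrightarrow> q z = q' z) \<Longrightarrow> fund_pair q' U f g"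
  unfolding fund_pair_def ode_sol_def by auto

text \<open>An ordinary point is a Frobenius case with Q = z^2 q and exponents 0 and 1. The only
  resonance is at k = 1 for the exponent 0, where the sum is the coefficient of z in z^2 q and so
  vanishes. The solutions are holomorphic at 0, and the equation extends there by the identity
  theorem.\<close>

lemma fund_pair_ordinary:
  assumes q: "q analytic_on {0}"
  obtains e f g where "e > 0" "fund_pair q (ball 0 e) f g"
proof -
  obtain r where r: "r > 0" "q holomorphic_on ball 0 r" using q by (auto simp: analytic_at_ball)
  obtain G where G: "q has_fps_expansion G"
    using analytic_at_imp_has_fps_expansion_0[OF q] by blast
  define Q where "Q = fps_X ^ 2 * G"
  have Q: "(\<lambda>z. z ^ 2 * q z) has_fps_expansion Q" unfolding Q_def
    by (intro fps_expansion_intros G)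
  have Qk: "fps_nth Q k = (if k < 2 then 0 else fps_nth G (k - 2))" for k
    by (simp add: Q_def fps_X_power_mult_nth)
  obtain e0 P1 P2 where e0: "e0 > 0" "P1 holomorphic_on ball 0 e0" "P2 holomorphic_on ball 0 e0"
    "fund_pair (\<lambda>z. (z ^ 2 * q z) / z ^ 2) (ball 0 e0 - {0}) (\<lambda>z. z powi 0 * P1 z) (\<lambda>z. z powi 1 * P2 z)"
  proof (rule frobenius_pair[OF Q, of 0 1 0])
    fix m :: int and k :: nat
    assume "m \<in> {0, 1}" "k > 0" "(of_int m + of_nat k) * (of_int m + of_nat k - 1) = fps_nth Q 0"
    hence "(of_int m + of_nat k) * (of_int m + of_nat k - 1) = (0 :: complex)" by (simp add: Qk)
    hence "of_int ((m + int k) * (m + int k - 1)) = (0 :: complex)" by simp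
    hence "(m + int k) * (m + int k - 1) = 0" by (simp only: of_int_eq_0_iff)
    hence "k = 1" using \<open>m \<in> {0, 1}\<close> \<open>k > 0\<close> by auto
    thus "(\<Sum>i<k. fps_nth Q (k - i) * frobenius_coeff Q (of_int m) i) = 0" by (simp add: Qk)
  qed (auto simp: Qk)
  define e where "e = min e0 r"
  have e: "e > 0" "e \<le> e0" "e \<le> r" using e0 r by (auto simp: e_def)
  define f where "f z = P1 z" for z
  define g where "g z = z * P2 z" for z
  have hol: "f holomorphic_on ball 0 e" "g holomorphic_on ball 0 e"
    unfolding f_def[abs_def] g_def[abs_def]
    by (intro holomorphic_intros holomorphic_on_subset[OF e0(2)] holomorphic_on_subset[OF e0(3)] subset_ball e)+
  have pair: "fund_pair q (ball 0 e - {0}) f g"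
  proof (rule fund_pair_cong_potential)
    have "ball 0 e - {0::complex} \<subseteq> ball 0 e0 - {0}" using e by auto
    from fund_pair_subset[OF e0(4) this]
    show "fund_pair (\<lambda>z. (z ^ 2 * q z) / z ^ 2) (ball 0 e - {0}) f g"
      by (simp add: f_def[abs_def] g_def[abs_def])
  qed auto
  have ext: "ode_sol q (ball 0 e) y" if y: "y holomorphic_on ball 0 e" "ode_sol q (ball 0 e - {0}) y" for y
    unfolding ode_sol_def
  proof (intro conjI ballI y)
    fix z :: complex assume z: "z \<in> ball 0 e"
    have o: "open (ball 0 e - {0::complex})" by auto
    have ne: "ball 0 e - {0::complex} \<noteq> {}"
      using e by (metis Diff_eq_empty_iff finite.emptyI finite_insert finite_subset not_open_singleton open_ball subset_singletonD ball_eq_empty not_less)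
    show "deriv (deriv y) z = q z * y z"
    proof (rule analytic_continuation_open[where f = "deriv (deriv y)" and g = "\<lambda>z. q z * y z", OF o open_ball ne connected_ball])
      show "deriv (deriv y) holomorphic_on ball 0 e" by (intro holomorphic_deriv y) auto
      show "(\<lambda>z. q z * y z) holomorphic_on ball 0 e"
        by (intro holomorphic_intros y holomorphic_on_subset[OF r(2)]) (use e in auto)
    qed (use y(2) z in \<open>auto simp: ode_sol_def\<close>)
  qed
  have sol: "ode_sol q (ball 0 e) f" "ode_sol q (ball 0 e) g"
    using ext hol pair unfolding fund_pair_def by auto
  obtain w where w: "\<And>z. z \<in> ball 0 e \<Longrightarrow> wronskian f g z = w"
    using has_field_derivative_0_imp_constant_on[of "ball 0 e" "wronskian f g"] wronskian_DERIV[OF open_ball sol]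
    unfolding constant_on_def by auto
  have "of_real (e / 2) \<in> ball (0::complex) e - {0}" using e by auto
  hence "w \<noteq> 0" using w[of "of_real (e / 2)"] pair unfolding fund_pair_def by auto
  hence "fund_pair q (ball 0 e) f g" unfolding fund_pair_def using sol w by auto
  thus ?thesis using that e by blast
qed

text \<open>Since \<open>G\<close> is even, the recursion for the exponent \<open>- n\<close> only involves even indices,
  while its resonance \<open>2 n + 1\<close> is odd. Hence no logarithm appears.\<close>

lemma fund_pair_double_pole:
  fixes n :: nat
  assumes G: "G analytic_on {0}" and even: "\<And>z. G (- z) = G z"
    and q: "\<And>z. z \<noteq> 0 \<Longrightarrow> q z = of_nat n * (of_nat n + 1) / z ^ 2 + G z"
  obtains e f g where "e > 0" "fund_pair q (ball 0 e - {0}) f g"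
proof -
  obtain g where g: "G has_fps_expansion g"
    using analytic_at_imp_has_fps_expansion_0[OF G] by blast
  have "(G \<circ> (\<lambda>z. - z)) has_fps_expansion (fps_compose g (- fps_X))"
    by (rule has_fps_expansion_compose[OF g]) (auto intro: fps_expansion_intros)
  hence "G has_fps_expansion (fps_compose g (- fps_X))" by (simp add: o_def even)
  hence "fps_compose g (- fps_X) = g" using g fps_expansion_unique_complex by blast
  hence gk: "fps_nth g k = (-1) ^ k * fps_nth g k" for k
    by (metis fps_compose_uminus' fps_nth_Abs_fps)
  have godd: "fps_nth g k = 0" if "odd k" for k using gk[of k] that by simp
  define N :: int where "N = int n * (int n + 1)"
  define Q where "Q = fps_const (of_int N) + fps_X ^ 2 * g"
  have Q: "(\<lambda>z. of_int N + z ^ 2 * G z) has_fps_expansion Q" unfolding Q_def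
    by (intro fps_expansion_intros g)
  have Qk: "fps_nth Q k = (if k = 0 then of_int N else if k < 2 then 0 else fps_nth g (k - 2))" for k
    by (simp add: Q_def fps_X_power_mult_nth)
  have Qodd: "fps_nth Q k = 0" if "odd k" for k using that godd[of "k - 2"] by (auto simp: Qk)
  obtain e P1 P2 where e: "e > 0"
    "fund_pair (\<lambda>z. (of_int N + z ^ 2 * G z) / z ^ 2) (ball 0 e - {0}) (\<lambda>z. z powi (- int n) * P1 z) (\<lambda>z. z powi (int n + 1) * P2 z)"
  proof (rule frobenius_pair[OF Q, of "- int n" "int n + 1" N])
    fix m :: int and k :: nat
    assume m: "m \<in> {- int n, int n + 1}" and k: "k > 0"
      and "(of_int m + of_nat k) * (of_int m + of_nat k - 1) = fps_nth Q 0"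
    hence "of_int ((m + int k) * (m + int k - 1)) = (of_int N :: complex)" by (simp add: Qk)
    hence "(m + int k) * (m + int k - 1) = int n * (int n + 1)" unfolding N_def by (simp only: of_int_eq_iff)
    hence eq: "(m + int k + int n) * (m + int k - (int n + 1)) = 0" by (simp add: algebra_simps)
    have odd: "odd k"
    proof (cases "m = - int n")
      case True
      hence "int k = 2 * int n + 1" using eq k by auto
      thus ?thesis by presburger
    next
      case False
      hence False using eq k m by auto
      thus ?thesis ..
    qed
    have c0: "j < k \<Longrightarrow> odd j \<Longrightarrow> frobenius_coeff Q (of_int m) j = 0" for j
    proof (induction j rule: less_induct)
      case (less j)
      have "(\<Sum>i<j. fps_nth Q (j - i) * frobenius_coeff Q (of_int m) i) = 0"
      proof (rule sum.neutral, rule ballI)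
        fix i assume "i \<in> {..<j}"
        thus "fps_nth Q (j - i) * frobenius_coeff Q (of_int m) i = 0"
          using less Qodd[of "j - i"] by (cases "odd i") auto
      qed
      thus ?case by (subst frobenius_coeff.simps) (use less odd_pos[of j] in simp)
    qed
    show "(\<Sum>i<k. fps_nth Q (k - i) * frobenius_coeff Q (of_int m) i) = 0"
    proof (rule sum.neutral, rule ballI)
      fix i assume "i \<in> {..<k}"
      thus "fps_nth Q (k - i) * frobenius_coeff Q (of_int m) i = 0"
        using c0[of i] Qodd[of "k - i"] odd by (cases "odd i") auto
    qed
  qed (auto simp: Qk N_def algebra_simps)
  have "fund_pair q (ball 0 e - {0}) (\<lambda>z. z powi (- int n) * P1 z) (\<lambda>z. z powi (int n + 1) * P2 z)"
    by (rule fund_pair_cong_potential[OF e(2)]) (auto simp: q N_def field_simps)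
  thus ?thesis using that e(1) by blast
qed

lemma ode_sol_shift:
  assumes "open U" "open V" "ode_sol q U f" "\<And>z. z \<in> V \<Longrightarrow> z + a \<in> U" "\<And>z. z \<in> V \<Longrightarrow> q' z = q (z + a)"
  shows "ode_sol q' V (\<lambda>z. f (z + a))" "\<And>z. z \<in> V \<Longrightarrow> deriv (\<lambda>z. f (z + a)) z = deriv f (z + a)"
proof -
  have 1: "((\<lambda>z. f (z + a)) has_field_derivative deriv f (z + a)) (at z)"
    and 2: "((\<lambda>z. deriv f (z + a)) has_field_derivative q' z * f (z + a)) (at z)" if "z \<in> V" for z
    using ode_sol_DERIV[OF assms(1,3) assms(4)[OF that]] unfolding DERIV_shift assms(5)[OF that] by auto
  show "ode_sol q' V (\<lambda>z. f (z + a))" "\<And>z. z \<in> V \<Longrightarrow> deriv (\<lambda>z. f (z + a)) z = deriv f (z + a)"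
    using ode_solI[OF assms(2) 1 2] by auto
qed

lemma fund_pair_shift:
  assumes "open U" "open V" "fund_pair q U f g" "\<And>z. z \<in> V \<Longrightarrow> z + a \<in> U" "\<And>z. z \<in> V \<Longrightarrow> q' z = q (z + a)"
  shows "fund_pair q' V (\<lambda>z. f (z + a)) (\<lambda>z. g (z + a))"
proof -
  have fg: "ode_sol q U f" "ode_sol q U g" using assms(3) unfolding fund_pair_def by auto
  note s = ode_sol_shift[where q = q and q' = q' and a = a, OF assms(1,2) _ assms(4,5)]
  show ?thesis using s[OF fg(1)] s[OF fg(2)] assms(3,4) unfolding fund_pair_def wronskian_def by auto
qed

section \<open>Continuation along paths\<close>

lemma eventually_eq_imp_eq_on_ball:
  assumes "f holomorphic_on ball c r" "g holomorphic_on ball c r" "x \<in> ball c r"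
    "\<forall>\<^sub>F z in nhds x. f z = g z" "z \<in> ball c r"
  shows "f z = g z"
proof -
  obtain V where V: "open V" "x \<in> V" "\<And>z. z \<in> V \<Longrightarrow> f z = g z"
    using assms(4) unfolding eventually_nhds by blast
  show ?thesis
    by (rule analytic_continuation_open[of "V \<inter> ball c r" "ball c r" f g])
       (use V assms in auto)
qed

text \<open>The agreement of germs is locally constant in the time. Near t both families are given
  by the fixed functions \<open>F t\<close> and \<open>G t\<close> on one ball, and there the
  identity theorem makes agreement near one point equivalent to agreement on the whole ball.\<close>

lemma continues_along_unique:
  assumes \<gamma>: "path \<gamma>" and fg: "continues_along \<gamma> f g" "continues_along \<gamma> f' g'"
    and eq: "\<forall>\<^sub>F z in nhds (\<gamma> 0). f z = f' z"
  shows "\<forall>\<^sub>F z in nhds (\<gamma> 1). g z = g' z"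
proof -
  obtain F where F0: "\<forall>\<^sub>F z in nhds (\<gamma> 0). F 0 z = f z" and F1: "\<forall>\<^sub>F z in nhds (\<gamma> 1). F 1 z = g z"
    and F: "\<And>t. t \<in> {0..1} \<Longrightarrow> F t analytic_on {\<gamma> t}"
      "\<And>t. t \<in> {0..1} \<Longrightarrow> \<forall>\<^sub>F s in at t within {0..1}. \<forall>\<^sub>F z in nhds (\<gamma> s). F s z = F t z"
    using fg(1) unfolding continues_along_def by blast
  obtain G where G0: "\<forall>\<^sub>F z in nhds (\<gamma> 0). G 0 z = f' z" and G1: "\<forall>\<^sub>F z in nhds (\<gamma> 1). G 1 z = g' z"
    and G: "\<And>t. t \<in> {0..1} \<Longrightarrow> G t analytic_on {\<gamma> t}"
      "\<And>t. t \<in> {0..1} \<Longrightarrow> \<forall>\<^sub>F s in at t within {0..1}. \<forall>\<^sub>F z in nhds (\<gamma> s). G s z = G t z"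
    using fg(2) unfolding continues_along_def by blast
  define P where "P t \<longleftrightarrow> (\<forall>\<^sub>F z in nhds (\<gamma> t). F t z = G t z)" for t
  have "P 1"
  proof (rule connected_induction_simple[of "{0..1::real}" 0 1 P])
    show "P 0" unfolding P_def using F0 G0 eq by eventually_elim auto
    fix t :: real assume t: "t \<in> {0..1}"
    obtain r1 where r1: "r1 > 0" "F t holomorphic_on ball (\<gamma> t) r1" using F(1)[OF t] by (auto simp: analytic_at_ball)
    obtain r2 where r2: "r2 > 0" "G t holomorphic_on ball (\<gamma> t) r2" using G(1)[OF t] by (auto simp: analytic_at_ball)
    define r where "r = min r1 r2"
    have r: "r > 0" "F t holomorphic_on ball (\<gamma> t) r" "G t holomorphic_on ball (\<gamma> t) r"
      using r1 r2 by (auto simp: r_def intro: holomorphic_on_subset)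
    have "(\<gamma> \<longlongrightarrow> \<gamma> t) (at t within {0..1})"
      using \<gamma> t unfolding path_def continuous_on_def by auto
    hence "\<forall>\<^sub>F s in at t within {0..1}. \<gamma> s \<in> ball (\<gamma> t) r"
      using r by (intro topological_tendstoD) auto
    hence "\<forall>\<^sub>F s in at t within {0..1}. P s \<longleftrightarrow> P t"
      using F(2)[OF t] G(2)[OF t]
    proof eventually_elim
      case (elim s)
      have ball: "(\<forall>\<^sub>F z in nhds x. F t z = G t z) \<longleftrightarrow> (\<forall>z\<in>ball (\<gamma> t) r. F t z = G t z)"
        if x: "x \<in> ball (\<gamma> t) r" for x
      proof
        assume "\<forall>\<^sub>F z in nhds x. F t z = G t z"
        thus "\<forall>z\<in>ball (\<gamma> t) r. F t z = G t z"
          using eventually_eq_imp_eq_on_ball[OF r(2,3) x] by blast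
      next
        assume "\<forall>z\<in>ball (\<gamma> t) r. F t z = G t z"
        thus "\<forall>\<^sub>F z in nhds x. F t z = G t z"
          using x unfolding eventually_nhds by (intro exI[of _ "ball (\<gamma> t) r"]) simp
      qed
      from elim(2,3) have "\<forall>\<^sub>F z in nhds (\<gamma> s). (F s z = G s z) = (F t z = G t z)"
        by eventually_elim simp
      hence "P s \<longleftrightarrow> (\<forall>\<^sub>F z in nhds (\<gamma> s). F t z = G t z)"
        unfolding P_def by (rule eventually_subst)
      also have "\<dots> \<longleftrightarrow> (\<forall>z\<in>ball (\<gamma> t) r. F t z = G t z)" using elim(1) by (rule ball)
      also have "\<dots> \<longleftrightarrow> P t" unfolding P_def using r(1) by (intro ball[symmetric]) simp
      finally show ?case .
    qed
    then obtain d where d: "d > 0" "\<And>s. s \<in> {0..1} \<Longrightarrow> s \<noteq> t \<Longrightarrow> dist s t < d \<Longrightarrow> P s \<longleftrightarrow> P t"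
      unfolding eventually_at by blast
    have "openin (top_of_set {0..1}) ({0..1} \<inter> ball t d)" by (intro openin_open_Int) auto
    moreover have "t \<in> {0..1} \<inter> ball t d" using t d(1) by simp
    moreover have Pt: "P s \<longleftrightarrow> P t" if "s \<in> {0..1} \<inter> ball t d" for s
      using d(2)[of s] that by (cases "s = t") (auto simp: dist_commute)
    have "\<forall>x\<in>{0..1} \<inter> ball t d. \<forall>y\<in>{0..1} \<inter> ball t d. P x \<longrightarrow> P y"
    proof (intro ballI)
      fix x y assume "x \<in> {0..1} \<inter> ball t d" "y \<in> {0..1} \<inter> ball t d"
      thus "P x \<longrightarrow> P y" using Pt[of x] Pt[of y] by metis
    qed
    ultimately show "\<exists>T. openin (top_of_set {0..1}) T \<and> t \<in> T \<and> (\<forall>x\<in>T. \<forall>y\<in>T. P x \<longrightarrow> P y)"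
      by blast
  qed auto
  with F1 G1 show ?thesis unfolding P_def by eventually_elim auto
qed

text \<open>The factor h is one function along the whole path. This carries the continuation of a
  branch of \<Psi> over to its products with single-valued functions.\<close>

lemma continues_along_mult:
  assumes "continues_along \<gamma> f g" "\<And>t. t \<in> {0..1} \<Longrightarrow> h analytic_on {\<gamma> t}"
  shows "continues_along \<gamma> (\<lambda>z. f z * h z) (\<lambda>z. g z * h z)"
proof -
  obtain F where F0: "\<forall>\<^sub>F z in nhds (\<gamma> 0). F 0 z = f z" and F1: "\<forall>\<^sub>F z in nhds (\<gamma> 1). F 1 z = g z"
    and F: "\<And>t. t \<in> {0..1} \<Longrightarrow> F t analytic_on {\<gamma> t}"
      "\<And>t. t \<in> {0..1} \<Longrightarrow> \<forall>\<^sub>F s in at t within {0..1}. \<forall>\<^sub>F z in nhds (\<gamma> s). F s z = F t z"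
    using assms(1) unfolding continues_along_def by blast
  show ?thesis unfolding continues_along_def
  proof (intro exI[of _ "\<lambda>t z. F t z * h z"] conjI ballI)
    show "\<forall>\<^sub>F z in nhds (\<gamma> 0). F 0 z * h z = f z * h z" using F0 by eventually_elim auto
    show "\<forall>\<^sub>F z in nhds (\<gamma> 1). F 1 z * h z = g z * h z" using F1 by eventually_elim auto
    fix t :: real assume t: "t \<in> {0..1}"
    show "(\<lambda>z. F t z * h z) analytic_on {\<gamma> t}" using F(1)[OF t] assms(2)[OF t] by (intro analytic_intros)
    show "\<forall>\<^sub>F s in at t within {0..1}. \<forall>\<^sub>F z in nhds (\<gamma> s). F s z * h z = F t z * h z"
      using F(2)[OF t] by eventually_elim (auto elim: eventually_mono)
  qed
qed

lemma continues_along_cong: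
  assumes "continues_along \<gamma> f g" "\<forall>\<^sub>F z in nhds (\<gamma> 0). f z = f' z" "\<forall>\<^sub>F z in nhds (\<gamma> 1). g z = g' z"
  shows "continues_along \<gamma> f' g'"
proof -
  obtain F where F0: "\<forall>\<^sub>F z in nhds (\<gamma> 0). F 0 z = f z" and F1: "\<forall>\<^sub>F z in nhds (\<gamma> 1). F 1 z = g z"
    and F: "\<forall>t\<in>{0..1}. F t analytic_on {\<gamma> t} \<and>
             (\<forall>\<^sub>F s in at t within {0..1}. \<forall>\<^sub>F z in nhds (\<gamma> s). F s z = F t z)"
    using assms(1) unfolding continues_along_def by blast
  have "\<forall>\<^sub>F z in nhds (\<gamma> 0). F 0 z = f' z" using F0 assms(2) by eventually_elim auto
  moreover have "\<forall>\<^sub>F z in nhds (\<gamma> 1). F 1 z = g' z" using F1 assms(3) by eventually_elim auto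
  ultimately show ?thesis unfolding continues_along_def using F by blast
qed

section \<open>Continuation of square roots\<close>

text \<open>The alternative u = - v is excluded because u + v tends to 2 L, which is
  nonzero.\<close>

lemma eventually_eq_of_square_eq:
  fixes u v :: "'a \<Rightarrow> complex"
  assumes "(u \<longlongrightarrow> L) F" "(v \<longlongrightarrow> L) F" "L \<noteq> 0" "\<forall>\<^sub>F x in F. u x ^ 2 = v x ^ 2"
  shows "\<forall>\<^sub>F x in F. u x = v x"
proof -
  have "((\<lambda>x. u x + v x) \<longlongrightarrow> L + L) F" by (intro tendsto_intros assms)
  moreover have "L + L \<noteq> 0" using assms(3) by simp
  ultimately have "\<forall>\<^sub>F x in F. u x + v x \<noteq> 0" by (rule tendsto_imp_eventually_ne)
  thus ?thesis using assms(4)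
  proof eventually_elim
    case (elim x)
    have "(u x - v x) * (u x + v x) = 0" using elim(2) by (simp add: algebra_simps power2_eq_square)
    thus ?case using elim(1) by simp
  qed
qed

lemma eventually_nhds_eq_of_square_eq:
  fixes u v :: "complex \<Rightarrow> complex"
  assumes "isCont u x" "isCont v x" "u x = v x" "u x \<noteq> 0" "\<forall>\<^sub>F z in nhds x. u z ^ 2 = v z ^ 2"
  shows "\<forall>\<^sub>F z in nhds x. u z = v z"
proof (rule eventually_eq_of_square_eq[OF _ _ assms(4,5)])
  show "(u \<longlongrightarrow> u x) (nhds x)" "(v \<longlongrightarrow> u x) (nhds x)"
    using assms(1,2,3) unfolding isCont_def tendsto_at_iff_tendsto_nhds by auto
qed

text \<open>Turns a continuous choice s of square roots of k along the path into a continuation of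
  germs; the initial and final germs are identified by their values \<open>s 0\<close> and
  \<open>s 1\<close> alone.\<close>

lemma continues_along_sqrt:
  assumes \<gamma>: "path \<gamma>" and k: "\<And>t. t \<in> {0..1} \<Longrightarrow> k analytic_on {\<gamma> t}" "\<And>t. t \<in> {0..1} \<Longrightarrow> k (\<gamma> t) \<noteq> 0"
    and s: "path s" "\<And>t. t \<in> {0..1} \<Longrightarrow> s t ^ 2 = k (\<gamma> t)"
    and f: "isCont f (\<gamma> 0)" "f (\<gamma> 0) = s 0" "\<forall>\<^sub>F z in nhds (\<gamma> 0). f z ^ 2 = k z"
    and g: "isCont g (\<gamma> 1)" "g (\<gamma> 1) = s 1" "\<forall>\<^sub>F z in nhds (\<gamma> 1). g z ^ 2 = k z"
  shows "continues_along \<gamma> f g"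
proof -
  \<comment> \<open>The quotient is 1 at \<gamma> t, away from the cut of \<open>csqrt\<close>, so
    the germ is analytic there; the factor \<open>s t\<close> gives it the prescribed value.\<close>
  define F where "F t z = s t * csqrt (k z / k (\<gamma> t))" for t z
  have sq: "F t z ^ 2 = k z" if "t \<in> {0..1}" for t z
    using s(2)[OF that] k(2)[OF that] by (simp add: F_def power_mult_distrib)
  have val: "F t (\<gamma> t) = s t" if "t \<in> {0..1}" for t using k(2)[OF that] by (simp add: F_def)
  have nz: "s t \<noteq> 0" if "t \<in> {0..1}" for t using s(2)[OF that] k(2)[OF that] by auto
  have an: "F t analytic_on {\<gamma> t}" if t: "t \<in> {0..1}" for t
    unfolding F_def[abs_def]
    by (intro analytic_intros k(1)[OF t]) (use k(2)[OF t] in auto)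
  have ct: "isCont (F t) (\<gamma> t)" if t: "t \<in> {0..1}" for t
    using an[OF t] by (rule analytic_at_imp_isCont)
  show ?thesis unfolding continues_along_def
  proof (intro exI[of _ F] conjI ballI)
    show "\<forall>\<^sub>F z in nhds (\<gamma> 0). F 0 z = f z"
    proof (rule eventually_nhds_eq_of_square_eq)
      show "\<forall>\<^sub>F z in nhds (\<gamma> 0). F 0 z ^ 2 = f z ^ 2"
        using f(3) by eventually_elim (simp add: sq)
    qed (use f ct val nz in auto)
    show "\<forall>\<^sub>F z in nhds (\<gamma> 1). F 1 z = g z"
    proof (rule eventually_nhds_eq_of_square_eq)
      show "\<forall>\<^sub>F z in nhds (\<gamma> 1). F 1 z ^ 2 = g z ^ 2"
        using g(3) by eventually_elim (simp add: sq)
    qed (use g ct val nz in auto)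
    fix t :: real assume t: "t \<in> {0..1}"
    show "F t analytic_on {\<gamma> t}" by (rule an[OF t])
    let ?A = "at t within {0..1}"
    have \<gamma>t: "(\<gamma> \<longlongrightarrow> \<gamma> t) ?A" using \<gamma> t unfolding path_def continuous_on_def by auto
    have "(s \<longlongrightarrow> s t) ?A" using s(1) t unfolding path_def continuous_on_def by auto
    moreover have "((\<lambda>u. F t (\<gamma> u)) \<longlongrightarrow> s t) ?A"
      using isCont_tendsto_compose[OF ct[OF t] \<gamma>t] val[OF t] by simp
    moreover have in1: "\<forall>\<^sub>F u in ?A. u \<in> {0..1}" by (auto simp: eventually_at_filter)
    hence "\<forall>\<^sub>F u in ?A. F t (\<gamma> u) ^ 2 = s u ^ 2"
      by eventually_elim (simp add: sq[OF t] s(2))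
    ultimately have "\<forall>\<^sub>F u in ?A. F t (\<gamma> u) = s u"
      using nz[OF t] eventually_eq_of_square_eq by blast
    moreover obtain r where r: "r > 0" "F t holomorphic_on ball (\<gamma> t) r" using an[OF t] by (auto simp: analytic_at_ball)
    have "\<forall>\<^sub>F u in ?A. \<gamma> u \<in> ball (\<gamma> t) r" using r by (intro topological_tendstoD[OF \<gamma>t]) auto
    ultimately show "\<forall>\<^sub>F u in ?A. \<forall>\<^sub>F z in nhds (\<gamma> u). F u z = F t z"
      using in1
    proof eventually_elim
      case (elim u)
      have "continuous_on (ball (\<gamma> t) r) (F t)" using r by (intro holomorphic_on_imp_continuous_on)
      hence "isCont (F t) (\<gamma> u)" using elim(2) continuous_on_eq_continuous_at open_ball by blast
      show ?case
        by (rule eventually_nhds_eq_of_square_eq)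
           (use elim ct[of u] val[of u] nz[of u] sq[OF t] sq[of u] \<open>isCont (F t) (\<gamma> u)\<close> in auto)
    qed
  qed
qed

text \<open>The interval is contractible, so k along \<gamma> has a continuous logarithm g. Then
  \<open>exp (g t / 2)\<close> is a square root, and \<open>s0 / exp (g 0 / 2)\<close> is the sign
  that corrects its initial value.\<close>

lemma square_root_along_path:
  assumes \<gamma>: "path \<gamma>" and k: "continuous_on (path_image \<gamma>) k" "\<And>z. z \<in> path_image \<gamma> \<Longrightarrow> k z \<noteq> (0::complex)"
    and s0: "s0 ^ 2 = k (pathstart \<gamma>)"
  obtains s where "path s" "\<And>t. t \<in> {0..1} \<Longrightarrow> s t ^ 2 = k (\<gamma> t)" "pathstart s = s0"
proof -
  have c: "continuous_on {0..1} (\<lambda>t. k (\<gamma> t))"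
    using continuous_on_compose[of "{0..1}" \<gamma> k] \<gamma> k(1) by (simp add: path_def path_image_def o_def)
  have nz: "k (\<gamma> t) \<noteq> 0" if "t \<in> {0..1}" for t using k(2) that by (auto simp: path_image_def)
  obtain g where g: "continuous_on {0..1::real} g" "\<And>t. t \<in> {0..1} \<Longrightarrow> k (\<gamma> t) = exp (g t)"
    by (rule continuous_logarithm_on_contractible[OF c convex_imp_contractible nz]) auto
  show ?thesis
  proof (rule that[of "\<lambda>t. s0 * exp (g t / 2) / exp (g 0 / 2)"])
    show "path (\<lambda>t. s0 * exp (g t / 2) / exp (g 0 / 2))"
      unfolding path_def by (intro continuous_intros g) auto
    have e: "exp (w / 2) ^ 2 = exp w" for w :: complex by (simp flip: exp_double)
    show "(s0 * exp (g t / 2) / exp (g 0 / 2)) ^ 2 = k (\<gamma> t)" if "t \<in> {0..1}" for t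
      using s0 g(2)[OF that] g(2)[of 0] by (simp add: power_mult_distrib power_divide e pathstart_def)
    show "pathstart (\<lambda>t. s0 * exp (g t / 2) / exp (g 0 / 2)) = s0" by (simp add: pathstart_def)
  qed
qed

text \<open>A circle around the simple pole \<open>p\<close> of \<open>k\<close> changes the sign of the square root.\<close>

lemma square_root_path_exists:
  fixes S :: "complex set"
  assumes S: "closed S" "countable S" and k: "k holomorphic_on - S" "\<And>z. z \<notin> S \<Longrightarrow> k z \<noteq> 0"
    and v: "v holomorphic_on ball p R" "\<And>z. z \<in> ball p R \<Longrightarrow> v z \<noteq> 0"
    and kv: "\<And>z. z \<in> ball p R - {p} \<Longrightarrow> z \<notin> S \<and> k z = v z / (z - p)"
    and e: "0 < e" "e < R" and z0: "z0 = p + of_real e" and z1: "z1 \<notin> S"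
    and s: "s0 ^ 2 = k z0" "s1 ^ 2 = k z1"
  obtains \<gamma> s where "path \<gamma>" "path_image \<gamma> \<inter> S = {}" "pathstart \<gamma> = z0" "pathfinish \<gamma> = z1"
    "path s" "\<And>t. t \<in> {0..1} \<Longrightarrow> s t ^ 2 = k (\<gamma> t)" "pathstart s = s0" "pathfinish s = s1"
proof -
  have z0S: "z0 \<notin> S" using kv[of z0] e by (auto simp: z0 dist_norm)
  have "path_connected (- S)" unfolding Compl_eq_Diff_UNIV
    by (rule path_connected_open_diff_countable) (use S in auto)
  then obtain \<gamma>' where \<gamma>': "path \<gamma>'" "path_image \<gamma>' \<subseteq> - S" "pathstart \<gamma>' = z0" "pathfinish \<gamma>' = z1"
    using z0S z1 unfolding path_connected_def by (metis ComplI)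
  have "continuous_on (path_image \<gamma>') k"
    using holomorphic_on_imp_continuous_on[OF k(1)] \<gamma>'(2) continuous_on_subset by blast
  then obtain s' where s': "path s'" "\<And>t. t \<in> {0..1} \<Longrightarrow> s' t ^ 2 = k (\<gamma>' t)" "pathstart s' = s0"
    using square_root_along_path[OF \<gamma>'(1), of k s0] k(2) \<gamma>' s(1) by (metis ComplD subsetD)
  have "pathfinish s' ^ 2 = s1 ^ 2" using s'(2)[of 1] \<gamma>'(4) s(2) by (simp add: pathfinish_def)
  hence "pathfinish s' = s1 \<or> pathfinish s' = - s1" by (simp add: power2_eq_iff)
  thus ?thesis
  proof
    assume "pathfinish s' = s1"
    thus ?thesis using that[OF \<gamma>'(1) _ \<gamma>'(3,4) s'(1,2,3)] \<gamma>'(2) by auto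
  next
    assume fin: "pathfinish s' = - s1"
    obtain m where m: "m holomorphic_on ball p R" "\<And>z. z \<in> ball p R \<Longrightarrow> v z = m z ^ 2"
      by (rule contractible_imp_holomorphic_sqrt[OF v(1) convex_imp_contractible v(2)]) auto
    define c where "c t = p + of_real e * exp (2 * of_real pi * \<i> * of_real t)" for t
    have nc: "norm (exp (2 * of_real pi * \<i> * of_real t)) = 1" for t by (simp add: norm_exp_eq_Re)
    have cR: "c t \<in> ball p R - {p}" for t using e by (auto simp: c_def dist_norm norm_mult nc)
    have c01: "pathstart c = z0" "pathfinish c = z0" by (auto simp: c_def pathstart_def pathfinish_def z0)
    have pc: "path c" unfolding path_def c_def by (intro continuous_intros)
    have z0R: "z0 \<in> ball p R - {p}" using cR[of 0] by (simp add: c_def z0)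
    have mz0: "m z0 \<noteq> 0" using m(2)[of z0] v(2)[of z0] z0R by auto
    have kz0: "k z0 = m z0 ^ 2 / of_real e" using kv[OF z0R] m(2)[of z0] z0R by (simp add: z0)
    \<comment> \<open>On the circle, z - p = e exp(2 pi i t), so the square root of 1 / (z - p)
      contributes exp(- pi i t), which is -1 at t = 1, whereas m returns to its value.\<close>
    define r where "r t = s0 / m z0 * m (c t) * exp (- (of_real pi * \<i> * of_real t))" for t
    have cm: "continuous_on {0..1} (\<lambda>t. m (c t))"
      by (rule continuous_on_compose2[OF holomorphic_on_imp_continuous_on[OF m(1)]])
         (use pc cR in \<open>auto simp: path_def\<close>)
    have pr: "path r" unfolding path_def r_def by (intro continuous_intros cm)
    have r2: "r t ^ 2 = k (c t)" for t
    proof -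
      have "exp (- (of_real pi * \<i> * of_real t)) ^ 2 = exp (- (2 * of_real pi * \<i> * of_real t))"
        by (simp flip: exp_double add: algebra_simps)
      hence "r t ^ 2 = k z0 / m z0 ^ 2 * v (c t) * exp (- (2 * of_real pi * \<i> * of_real t))"
        using cR[of t] m(2)[of "c t"] by (simp add: r_def power_mult_distrib power_divide s(1))
      also have "\<dots> = v (c t) / (of_real e * exp (2 * of_real pi * \<i> * of_real t))"
        using mz0 by (simp add: kz0 exp_minus field_simps)
      also have "\<dots> = k (c t)" using kv[OF cR[of t]] by (simp add: c_def)
      finally show ?thesis .
    qed
    have r01: "pathstart r = s0" "pathfinish r = - s0"
      using c01 mz0 by (auto simp: r_def pathstart_def pathfinish_def exp_minus)
    have ps: "path (\<lambda>t. - s' t)" using s'(1) unfolding path_def by (intro continuous_intros)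
    show ?thesis
    \<comment> \<open>After the circle the root is - s0, which is where - s' starts; since s' ends
      at - s1, the joined root ends at s1.\<close>
    proof (rule that[of "c +++ \<gamma>'" "r +++ (\<lambda>t. - s' t)"])
      show "path (c +++ \<gamma>')" using pc \<gamma>' c01 by (simp add: path_join)
      show "path_image (c +++ \<gamma>') \<inter> S = {}"
      proof -
        have "path_image c \<inter> S = {}" using cR kv by (auto simp: path_image_def)
        thus ?thesis using \<gamma>'(2) path_image_join_subset[of c \<gamma>'] by blast
      qed
      show "path (r +++ (\<lambda>t. - s' t))" using pr ps r01 s'(3) by (simp add: pathstart_def)
      show "(r +++ (\<lambda>t. - s' t)) t ^ 2 = k ((c +++ \<gamma>') t)" if "t \<in> {0..1}" for t
        using that r2 s'(2)[of "2 * t - 1"] by (auto simp: joinpaths_def)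
    qed (use c01 \<gamma>' r01 fin in \<open>auto simp: pathfinish_def joinpaths_def pathstart_def\<close>)
  qed
qed

section \<open>Weierstrass functions\<close>

text \<open>One factor of the double series in \<open>summable_lat\<close>: the cubed norm of a
  nonzero a + b \<tau> is bounded below by a multiple of ((1 + a^2) (1 + b^2)) ^ (3 / 4). Each
  factor decays like the power -3/2 of the integer.\<close>

lemma summable_on_one_plus_square_powr:
  "(\<lambda>a::int. (1 + of_int a ^ 2 :: real) powr (- 3 / 4)) summable_on UNIV"
proof -
  let ?f = "\<lambda>a::int. (1 + of_int a ^ 2 :: real) powr (- 3 / 4)"
  have "summable (\<lambda>n::nat. ?f (int n))"
  proof (rule summable_comparison_test)
    show "summable (\<lambda>n::nat. real n powr (- 3 / 2))" by (simp add: summable_real_powr_iff)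
    have "norm (?f (int n)) \<le> real n powr (- 3 / 2)" if "n \<ge> 1" for n
    proof -
      have "(1 + real n ^ 2) powr (- 3 / 4) \<le> (real n ^ 2) powr (- 3 / 4)"
        by (rule powr_mono2') (use that in auto)
      also have "real n ^ 2 = real n powr 2" using that by (simp add: powr_numeral)
      also have "(real n powr 2) powr (- 3 / 4) = real n powr (- 3 / 2)" by (simp only: powr_powr) simp
      finally show ?thesis by simp
    qed
    thus "\<exists>N. \<forall>n\<ge>N. norm (?f (int n)) \<le> real n powr (- 3 / 2)" by blast
  qed
  hence nat: "(\<lambda>n::nat. ?f (int n)) summable_on UNIV"
    by (subst summable_on_UNIV_nonneg_real_iff) auto
  hence "?f summable_on range int"
    by (subst summable_on_reindex) (auto simp: o_def)
  moreover have "?f summable_on range (\<lambda>n. - int n)"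
    using nat by (subst summable_on_reindex) (auto simp: o_def inj_on_def)
  ultimately have "?f summable_on (range int \<union> range (\<lambda>n. - int n))"
    by (rule summable_on_union)
  also have "range int \<union> range (\<lambda>n. - int n) = UNIV"
  proof (rule set_eqI)
    fix a :: int
    show "a \<in> range int \<union> range (\<lambda>n. - int n) \<longleftrightarrow> a \<in> UNIV"
      by (cases a rule: int_cases2) auto
  qed
  finally show ?thesis .
qed

section \<open>Estimates for the terms of the lattice series\<close>

definition wp_term :: "complex \<Rightarrow> complex \<Rightarrow> complex" where
  "wp_term w z = 1 / (z - w) ^ 2 - 1 / w ^ 2"

definition wz_term :: "complex \<Rightarrow> complex \<Rightarrow> complex" where
  "wz_term w z = 1 / (z - w) + 1 / w + z / w ^ 2"

text \<open>A logarithm of \<open>ws_factor w z\<close> for |z| < |w|, where 1 - z / w lies in the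
  right half-plane. It turns the far part of the sigma product into a sum.\<close>

definition ws_log_term :: "complex \<Rightarrow> complex \<Rightarrow> complex" where
  "ws_log_term w z = Ln (1 - z / w) + z / w + z ^ 2 / (2 * w ^ 2)"

definition ws_factor :: "complex \<Rightarrow> complex \<Rightarrow> complex" where
  "ws_factor w z = (1 - z / w) * exp (z / w + z ^ 2 / (2 * w ^ 2))"

lemma wz_term_DERIV: "w \<noteq> 0 \<Longrightarrow> z \<noteq> w \<Longrightarrow> (wz_term w has_field_derivative - wp_term w z) (at z)"
  unfolding wz_term_def[abs_def] wp_term_def
  by (auto intro!: derivative_eq_intros simp: field_simps power2_eq_square)

lemma ws_factor_DERIV:
  assumes "w \<noteq> 0" "z \<noteq> w"
  shows "(ws_factor w has_field_derivative ws_factor w z * wz_term w z) (at z)"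
proof -
  have "(ws_factor w has_field_derivative
      (- 1 / w) * exp (z / w + z ^ 2 / (2 * w ^ 2)) + (1 - z / w) * (exp (z / w + z ^ 2 / (2 * w ^ 2)) * (1 / w + z / w ^ 2))) (at z)"
    unfolding ws_factor_def[abs_def] using assms
    by (auto intro!: derivative_eq_intros simp: field_simps power2_eq_square)
  moreover have "- 1 / w = (1 - z / w) * (1 / (z - w))" using assms by (simp add: field_simps)
  hence "(- 1 / w) * e + (1 - z / w) * (e * (c + d)) = (1 - z / w) * e * (1 / (z - w) + c + d)" for c d e
    by (simp only: distrib_left mult.assoc mult.left_commute add.assoc mult.commute[of _ e])
  ultimately show ?thesis unfolding ws_factor_def wz_term_def by (simp only: add.assoc)
qed

lemma ws_log_term_DERIV:
  assumes "norm z < norm w"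
  shows "(ws_log_term w has_field_derivative wz_term w z) (at z)"
proof -
  have w: "w \<noteq> 0" "z \<noteq> w" using assms by auto
  have "norm (z / w) < 1" using assms w by (simp add: norm_divide)
  hence "Re (z / w) < 1" using complex_Re_le_cmod[of "z / w"] by linarith
  hence "1 - z / w \<notin> \<real>\<^sub>\<le>\<^sub>0" by (auto simp: complex_nonpos_Reals_iff)
  hence "(ws_log_term w has_field_derivative (- 1 / w) / (1 - z / w) + 1 / w + z / w ^ 2) (at z)"
    unfolding ws_log_term_def[abs_def] using w
    by (auto intro!: derivative_eq_intros simp: field_simps power2_eq_square)
  moreover have "(- 1 / w) / (1 - z / w) = 1 / (z - w)" using w by (simp add: field_simps)
  ultimately show ?thesis unfolding wz_term_def by metis
qed

lemma exp_ws_log_term: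
  assumes "norm z < norm w"
  shows "exp (ws_log_term w z) = ws_factor w z"
proof -
  have "1 - z / w \<noteq> 0" using assms by auto
  thus ?thesis unfolding ws_log_term_def ws_factor_def add.assoc by (simp add: exp_add)
qed

text \<open>The summands 1 / w and z / w^2 cancel the expansion of 1 / (z - w) through first order
  in z. What remains is z^2 / (w^2 (z - w)), of cubic decay in w because |z - w| is at least |w| /
  2.\<close>

lemma norm_wz_term_le:
  assumes "R > 0" "norm z \<le> R" "norm w \<ge> 2 * R"
  shows "norm (wz_term w z) \<le> 2 * R ^ 2 * (1 / norm w ^ 3)"
proof -
  have w: "w \<noteq> 0" "z \<noteq> w" using assms by auto
  have "norm (z - w) \<ge> norm w / 2" using norm_triangle_ineq2[of w z] assms by (simp add: norm_minus_commute)
  have "wz_term w z = z ^ 2 / (w ^ 2 * (z - w))"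
    unfolding wz_term_def using w by (simp add: divide_simps) (simp add: algebra_simps power2_eq_square)
  hence "norm (wz_term w z) = norm z ^ 2 / (norm w ^ 2 * norm (z - w))"
    by (simp add: norm_mult norm_divide norm_power)
  also have "\<dots> \<le> R ^ 2 / (norm w ^ 2 * (norm w / 2))"
    by (rule frac_le) (use assms w \<open>norm (z - w) \<ge> norm w / 2\<close> in \<open>auto intro!: power_mono mult_left_mono\<close>)
  also have "\<dots> = 2 * R ^ 2 * (1 / norm w ^ 3)" by (simp add: power2_eq_square power3_eq_cube field_simps)
  finally show ?thesis .
qed

text \<open>The logarithmic term vanishes at 0 and has derivative \<open>wz_term w\<close>, so the
  bound on the derivative integrates to a bound with one more factor R.\<close>

lemma norm_ws_log_term_le:
  assumes "R > 0" "norm z \<le> R" "norm w \<ge> 2 * R"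
  shows "norm (ws_log_term w z) \<le> 2 * R ^ 3 * (1 / norm w ^ 3)"
proof -
  have "norm (ws_log_term w z - ws_log_term w 0) \<le> 2 * R ^ 2 * (1 / norm w ^ 3) * norm (z - 0)"
  proof (rule field_differentiable_bound[of "cball 0 R"])
    fix x :: complex assume x: "x \<in> cball 0 R"
    show "(ws_log_term w has_field_derivative wz_term w x) (at x within cball 0 R)"
      by (rule has_field_derivative_at_within, rule ws_log_term_DERIV) (use x assms in auto)
    show "norm (wz_term w x) \<le> 2 * R ^ 2 * (1 / norm w ^ 3)"
      using norm_wz_term_le[OF assms(1) _ assms(3), of x] x by auto
  qed (use assms in auto)
  also have "\<dots> \<le> 2 * R ^ 2 * (1 / norm w ^ 3) * R" using assms by (intro mult_left_mono) auto
  finally show ?thesis by (simp add: ws_log_term_def power2_eq_square power3_eq_cube)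
qed

section \<open>The lattice and summation over it\<close>

locale tau_lattice =
  fixes \<tau> :: complex
  assumes Im_pos: "Im \<tau> > 0"
begin

abbreviation lat :: "complex set" where "lat \<equiv> period_lattice \<tau>"
abbreviation wp :: "complex \<Rightarrow> complex" where "wp \<equiv> weierstrass_p \<tau>"
abbreviation wz :: "complex \<Rightarrow> complex" where "wz \<equiv> weierstrass_zeta \<tau>"
abbreviation ws :: "complex \<Rightarrow> complex" where "ws \<equiv> weierstrass_sigma \<tau>"

lemma lat_altdef: "lat = {of_int a + of_int b * \<tau> |a b. True}"
  unfolding period_lattice_def by auto

lemma lat_0 [simp]: "0 \<in> lat" unfolding lat_altdef by (auto intro: exI[of _ 0])
lemma lat_1 [simp]: "1 \<in> lat" unfolding lat_altdef by (rule CollectI, rule exI[of _ 1], rule exI[of _ 0]) simp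
lemma lat_tau [simp]: "\<tau> \<in> lat" unfolding lat_altdef by (rule CollectI, rule exI[of _ 0], rule exI[of _ 1]) simp

lemma lat_add: "x \<in> lat \<Longrightarrow> y \<in> lat \<Longrightarrow> x + y \<in> lat"
proof -
  assume "x \<in> lat" "y \<in> lat"
  then obtain a b c d where "x = of_int a + of_int b * \<tau>" "y = of_int c + of_int d * \<tau>"
    unfolding lat_altdef by blast
  hence "x + y = of_int (a + c) + of_int (b + d) * \<tau>" by (simp add: algebra_simps)
  thus ?thesis unfolding lat_altdef by blast
qed

lemma lat_minus: "x \<in> lat \<Longrightarrow> - x \<in> lat"
proof -
  assume "x \<in> lat"
  then obtain a b where "x = of_int a + of_int b * \<tau>" unfolding lat_altdef by blast
  hence "- x = of_int (- a) + of_int (- b) * \<tau>" by (simp add: algebra_simps)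
  thus ?thesis unfolding lat_altdef by blast
qed

lemma lat_minus_iff [simp]: "- x \<in> lat \<longleftrightarrow> x \<in> lat" using lat_minus[of x] lat_minus[of "- x"] by auto
lemma lat_diff: "x \<in> lat \<Longrightarrow> y \<in> lat \<Longrightarrow> x - y \<in> lat" using lat_add[of x "- y"] by simp
lemma lat_add_iff: "y \<in> lat \<Longrightarrow> x + y \<in> lat \<longleftrightarrow> x \<in> lat"
  using lat_add[of x y] lat_diff[of "x + y" y] by auto

lemma lat_countable: "countable lat" unfolding period_lattice_def by auto

text \<open>As Im \<tau> > 0, the numbers 1 and \<tau> form a real basis of the plane: b is
  controlled by the imaginary part, and then a by the remainder.\<close>

lemma lat_norm_bound:
  obtains K where "K \<ge> 1" "\<And>a b. a ^ 2 + b ^ 2 \<le> K * norm (of_real a + of_real b * \<tau>) ^ 2"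
proof -
  define A where "A = 1 + norm \<tau> / Im \<tau>"
  define B where "B = 1 / Im \<tau>"
  have A: "A \<ge> 1" "B > 0" using Im_pos by (auto simp: A_def B_def)
  show ?thesis
  proof (rule that[of "A ^ 2 + B ^ 2"])
    show "A ^ 2 + B ^ 2 \<ge> 1" using one_le_power[OF A(1), of 2] by (simp add: add_increasing2)
    fix a b :: real
    let ?z = "of_real a + of_real b * \<tau>"
    have "\<bar>b\<bar> * Im \<tau> = \<bar>Im ?z\<bar>" using Im_pos by (simp add: abs_mult)
    also have "\<dots> \<le> norm ?z" by (rule abs_Im_le_cmod)
    finally have b: "\<bar>b\<bar> \<le> B * norm ?z" using Im_pos by (simp add: B_def field_simps)
    have "\<bar>a\<bar> = norm (?z - of_real b * \<tau>)" by simp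
    also have "\<dots> \<le> norm ?z + norm (of_real b * \<tau>)" by (rule norm_triangle_ineq4)
    also have "\<dots> = norm ?z + \<bar>b\<bar> * norm \<tau>" by (simp add: norm_mult)
    also have "\<dots> \<le> norm ?z + (B * norm ?z) * norm \<tau>" using b by (intro add_left_mono mult_right_mono) auto
    also have "\<dots> = A * norm ?z" by (simp add: A_def B_def algebra_simps)
    finally have a: "\<bar>a\<bar> \<le> A * norm ?z" .
    have "a ^ 2 + b ^ 2 = \<bar>a\<bar> ^ 2 + \<bar>b\<bar> ^ 2" by simp
    also have "\<dots> \<le> (A * norm ?z) ^ 2 + (B * norm ?z) ^ 2"
      using a b by (intro add_mono power_mono) auto
    also have "\<dots> = (A ^ 2 + B ^ 2) * norm ?z ^ 2" by (simp add: algebra_simps power_mult_distrib)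
    finally show "a ^ 2 + b ^ 2 \<le> (A ^ 2 + B ^ 2) * norm ?z ^ 2" .
  qed
qed

lemma summable_lat: "(\<lambda>w. 1 / norm w ^ 3) summable_on (lat - {0})"
proof -
  obtain K where K: "K \<ge> 1" "\<And>a b. a ^ 2 + b ^ 2 \<le> K * norm (of_real a + of_real b * \<tau>) ^ 2"
    using lat_norm_bound by blast
  define h where "h = (\<lambda>(a::int, b::int). of_int a + of_int b * \<tau>)"
  have n0: "h (a, b) \<noteq> 0" if "(a, b) \<noteq> (0, 0)" for a b
  proof
    assume "h (a, b) = 0"
    hence "Im (h (a, b)) = 0" "Re (h (a, b)) = 0" by auto
    thus False using that Im_pos by (auto simp: h_def)
  qed
  have inj: "inj h"
  proof (rule injI)
    fix x y assume "h x = h y"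
    hence "h (fst x - fst y, snd x - snd y) = 0" by (auto simp: h_def case_prod_unfold algebra_simps)
    thus "x = y" using n0[of "fst x - fst y" "snd x - snd y"] by (auto simp: prod_eq_iff)
  qed
  have im: "lat - {0} = h ` (UNIV - {(0, 0)})"
  proof -
    have "lat = range h" unfolding period_lattice_def h_def by simp
    moreover have "h (0, 0) = 0" by (simp add: h_def)
    ultimately show ?thesis using n0 by auto
  qed
  let ?f = "\<lambda>a::int. (1 + of_int a ^ 2 :: real) powr (- 3 / 4)"
  have fs: "?f summable_on UNIV" by (rule summable_on_one_plus_square_powr)
  have "(\<lambda>x. ?f (fst x) * ?f (snd x)) summable_on (UNIV \<times> UNIV)"
  proof (rule summable_on_SigmaI)
    show "((\<lambda>y. ?f (fst (x, y)) * ?f (snd (x, y))) has_sum ?f x * infsum ?f UNIV) UNIV" for x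
      unfolding fst_conv snd_conv by (intro has_sum_cmult_right has_sum_infsum fs)
    show "(\<lambda>x. ?f x * infsum ?f UNIV) summable_on UNIV" by (intro summable_on_cmult_left fs)
  qed auto
  hence "(\<lambda>x. (2 * K) powr (3 / 2) * (?f (fst x) * ?f (snd x))) summable_on (UNIV \<times> UNIV)"
    by (rule summable_on_cmult_right)
  hence "(\<lambda>x. (2 * K) powr (3 / 2) * (?f (fst x) * ?f (snd x))) summable_on (UNIV - {(0, 0)})"
    by (rule summable_on_subset) auto
  hence "(\<lambda>x. 1 / norm (h x) ^ 3) summable_on (UNIV - {(0, 0)})"
  proof (rule summable_on_comparison_test)
    fix x :: "int \<times> int" assume x: "x \<in> UNIV - {(0, 0)}"
    obtain a b where ab: "x = (a, b)" by (cases x)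
    let ?a = "real_of_int a" and ?b = "real_of_int b"
    have hx: "h x = of_real ?a + of_real ?b * \<tau>" by (simp add: h_def ab)
    have pos: "norm (h x) > 0" using n0[of a b] x ab by auto
    have ab1: "1 \<le> ?a ^ 2 + ?b ^ 2"
    proof -
      have "0 < a ^ 2 + b ^ 2" using x ab by (auto simp: sum_power2_gt_zero_iff)
      hence "1 \<le> a ^ 2 + b ^ 2" by linarith
      hence "real_of_int 1 \<le> real_of_int (a ^ 2 + b ^ 2)" by (simp only: of_int_le_iff)
      thus ?thesis by simp
    qed
    let ?P = "(1 + ?a ^ 2) * (1 + ?b ^ 2)"
    have P: "?P \<ge> 1" using mult_mono[of 1 "1 + ?a ^ 2" 1 "1 + ?b ^ 2"] by simp
    \<comment> \<open>This decouples a and b, so that the double series is dominated by a product of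
      two one-dimensional ones; \<open>ab1\<close> afterwards absorbs the summand 1.\<close>
    have "sqrt ?P \<le> 1 + ?a ^ 2 + ?b ^ 2"
    proof (rule real_le_lsqrt)
      have "(1 + ?a ^ 2 + ?b ^ 2) ^ 2 = ?P + (?a ^ 2 + ?b ^ 2 + (?a ^ 2) ^ 2 + (?b ^ 2) ^ 2 + ?a ^ 2 * ?b ^ 2)"
        by (simp add: algebra_simps power2_eq_square)
      thus "?P \<le> (1 + ?a ^ 2 + ?b ^ 2) ^ 2" by simp
    qed auto
    also have "\<dots> \<le> 2 * (?a ^ 2 + ?b ^ 2)" using ab1 by simp
    also have "\<dots> \<le> 2 * K * norm (h x) ^ 2" using K(2)[of ?a ?b] hx by simp
    finally have le: "sqrt ?P / (2 * K) \<le> norm (h x) ^ 2" using K by (simp add: field_simps)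
    have "1 / norm (h x) ^ 3 = (norm (h x) ^ 2) powr (- 3 / 2)"
    proof -
      have "(norm (h x) ^ 2) powr (- 3 / 2) = (norm (h x) powr 2) powr (- 3 / 2)" using pos by (simp add: powr_numeral)
      also have "\<dots> = norm (h x) powr (- 3)" by (simp only: powr_powr) simp
      also have "\<dots> = 1 / norm (h x) ^ 3" using pos by (simp add: powr_minus powr_numeral divide_inverse)
      finally show ?thesis ..
    qed
    also have "\<dots> \<le> (sqrt ?P / (2 * K)) powr (- 3 / 2)"
      by (rule powr_mono2') (use le K P in auto)
    also have "\<dots> = (2 * K) powr (3 / 2) * (?P powr (1 / 2)) powr (- 3 / 2)"
      using P K by (simp add: powr_divide powr_half_sqrt powr_minus field_simps)
    also have "(?P powr (1 / 2)) powr (- 3 / 2) = ?f (fst x) * ?f (snd x)"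
      by (simp add: powr_powr powr_mult ab)
    finally show "1 / norm (h x) ^ 3 \<le> (2 * K) powr (3 / 2) * (?f (fst x) * ?f (snd x))" .
  qed auto
  thus ?thesis unfolding im
    by (subst summable_on_reindex) (use inj in \<open>auto simp: o_def inj_on_def inj_def\<close>)
qed

text \<open>Each of infinitely many lattice points in the ball would contribute at least 1 / r^3 to
  a convergent series.\<close>

lemma finite_lat_ball: "finite {w \<in> lat - {0}. norm w < r}"
proof (rule ccontr)
  assume inf: "infinite {w \<in> lat - {0}. norm w < r}"
  let ?A = "{w \<in> lat - {0}. norm w < r}"
  obtain w where "w \<in> ?A" using inf by (metis all_not_in_conv finite.emptyI)
  hence r: "r > 0" by (auto intro: le_less_trans[OF norm_ge_zero])
  have "(\<lambda>w. 1 / norm w ^ 3) summable_on ?A" by (rule summable_on_subset[OF summable_lat]) auto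
  hence "(\<lambda>w. 1 / r ^ 3) summable_on ?A"
    by (rule summable_on_comparison_test) (use r in \<open>auto intro!: divide_left_mono power_mono\<close>)
  thus False using infsum_diverge_constant[OF inf, of "1 / r ^ 3"] r by simp
qed

lemma lat_not_islimpt: "\<not> x islimpt lat"
proof -
  have "lat \<inter> ball x 1 \<subseteq> insert 0 {w \<in> lat - {0}. norm w < norm x + 1}"
  proof
    fix w assume w: "w \<in> lat \<inter> ball x 1"
    have "norm w < norm x + 1" using w norm_triangle_ineq2[of w x] by (auto simp: dist_norm norm_minus_commute)
    thus "w \<in> insert 0 {w \<in> lat - {0}. norm w < norm x + 1}" using w by auto
  qed
  hence "finite (lat \<inter> ball x 1)" using finite_lat_ball finite_subset by blast
  thus ?thesis unfolding islimpt_eq_infinite_ball using zero_less_one by blast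
qed

lemma lat_closed: "closed lat" using lat_not_islimpt unfolding closed_limpt by blast

section \<open>Analyticity and derivatives of the Weierstrass functions\<close>

text \<open>The threshold 2 R is what the norm estimates require for |z| at most R. Only the
  finitely many near points can produce poles or zeros on the ball of radius R.\<close>

definition near :: "real \<Rightarrow> complex set" where "near R = {w \<in> lat - {0}. norm w < 2 * R}"
definition far :: "real \<Rightarrow> complex set" where "far R = {w \<in> lat - {0}. norm w \<ge> 2 * R}"

lemma near_far: "finite (near R)" "near R \<inter> far R = {}" "near R \<union> far R = lat - {0}"
  using finite_lat_ball[of "2 * R"] by (auto simp: near_def far_def)

text \<open>The \<open>_reg\<close> functions are what is left after splitting off the summand or
  factor of the lattice point 0; they are regular at 0.\<close>

definition wz_reg :: "complex \<Rightarrow> complex" where "wz_reg z = (\<Sum>\<^sub>\<infinity>w\<in>lat - {0}. wz_term w z)"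
definition wp_reg :: "complex \<Rightarrow> complex" where "wp_reg z = (\<Sum>\<^sub>\<infinity>w\<in>lat - {0}. wp_term w z)"
definition ws_reg :: "complex \<Rightarrow> complex" where
  "ws_reg z = Lim (finite_subsets_at_top (lat - {0})) (\<lambda>F. \<Prod>w\<in>F. ws_factor w z)"

lemma wz_eq: "wz z = 1 / z + wz_reg z"
  unfolding weierstrass_zeta_def wz_reg_def wz_term_def ..

lemma wp_eq: "wp z = 1 / z ^ 2 + wp_reg z"
  unfolding weierstrass_p_def wp_reg_def wp_term_def ..

lemma ws_eq: "ws z = z * ws_reg z"
  unfolding weierstrass_sigma_def ws_reg_def ws_factor_def ..

text \<open>The far series converge uniformly on the disc, so termwise differentiation leads from
  the logarithms S0 to S1 and then to - S2. The relations sigma' = sigma zeta and zeta' = - wp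
  thereby come from one representation, with a finite near part added.\<close>

lemma weierstrass_local:
  assumes R: "R > 0"
  obtains S0 S1 S2 where
    "\<And>z. z \<in> ball 0 R \<Longrightarrow> (S0 has_field_derivative S1 z) (at z)"
    "\<And>z. z \<in> ball 0 R \<Longrightarrow> (S1 has_field_derivative - S2 z) (at z)"
    "\<And>z. z \<in> ball 0 R \<Longrightarrow> ws_reg z = (\<Prod>w\<in>near R. ws_factor w z) * exp (S0 z)"
    "\<And>z. z \<in> ball 0 R \<Longrightarrow> ((\<lambda>w. wz_term w z) has_sum (\<Sum>w\<in>near R. wz_term w z) + S1 z) (lat - {0})"
    "\<And>z. z \<in> ball 0 R \<Longrightarrow> ((\<lambda>w. wp_term w z) has_sum (\<Sum>w\<in>near R. wp_term w z) + S2 z) (lat - {0})"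
proof -
  let ?F = "finite_subsets_at_top (far R)"
  have sm: "(\<lambda>w. c * (1 / norm w ^ 3)) summable_on far R" for c :: real
    by (intro summable_on_cmult_right summable_on_subset[OF summable_lat]) (auto simp: far_def)
  define S0 where "S0 z = (\<Sum>\<^sub>\<infinity>w\<in>far R. ws_log_term w z)" for z
  define S1 where "S1 z = (\<Sum>\<^sub>\<infinity>w\<in>far R. wz_term w z)" for z
  have lim0: "uniform_limit (cball 0 R) (\<lambda>X z. \<Sum>w\<in>X. ws_log_term w z) S0 ?F"
    unfolding S0_def[abs_def]
    by (rule Weierstrass_m_test_general[OF _ sm[of "2 * R ^ 3"]])
       (rule norm_ws_log_term_le[OF R]; auto simp: far_def)
  have lim1: "uniform_limit (cball 0 R) (\<lambda>X z. \<Sum>w\<in>X. wz_term w z) S1 ?F"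
    unfolding S1_def[abs_def]
    by (rule Weierstrass_m_test_general[OF _ sm[of "2 * R ^ 2"]])
       (rule norm_wz_term_le[OF R]; auto simp: far_def)
  have pt: "((\<lambda>w. f w z) has_sum S z) (far R)"
    if "uniform_limit (cball 0 R) (\<lambda>X z. \<Sum>w\<in>X. f w z) S ?F" "z \<in> ball 0 R" for f S and z :: complex
    unfolding has_sum_def by (rule tendsto_uniform_limitI[OF that(1)]) (use that in auto)
  have wR: "norm z < norm w" "z \<noteq> w" "w \<noteq> 0" if "z \<in> cball 0 R" "w \<in> far R" for w z :: complex
    using that R by (auto simp: far_def)
  have ev: "\<forall>\<^sub>F X in ?F. X \<subseteq> far R \<and> finite X"
    by (rule eventually_finite_subsets_at_top_weakI) auto
  have nt: "?F \<noteq> bot" by (rule finite_subsets_at_top_neq_bot)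
  have "\<forall>\<^sub>F X in ?F. continuous_on (cball 0 R) (\<lambda>z. \<Sum>w\<in>X. ws_log_term w z) \<and>
      (\<forall>z\<in>ball 0 R. ((\<lambda>z. \<Sum>w\<in>X. ws_log_term w z) has_field_derivative (\<Sum>w\<in>X. wz_term w z)) (at z))"
    using ev
  proof eventually_elim
    case (elim X)
    have d: "((\<lambda>z. \<Sum>w\<in>X. ws_log_term w z) has_field_derivative (\<Sum>w\<in>X. wz_term w z)) (at z)" if "z \<in> cball 0 R" for z
      by (intro DERIV_sum ws_log_term_DERIV wR that) (use elim in auto)
    thus ?case by (auto intro!: continuous_at_imp_continuous_on DERIV_isCont)
  qed
  from has_complex_derivative_uniform_limit[OF this lim0 nt R]
  obtain g0 where g0: "\<And>z. z \<in> ball 0 R \<Longrightarrow> (S0 has_field_derivative g0 z) (at z) \<and> ((\<lambda>X. \<Sum>w\<in>X. wz_term w z) \<longlongrightarrow> g0 z) ?F"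
    by blast
  have "\<forall>\<^sub>F X in ?F. continuous_on (cball 0 R) (\<lambda>z. \<Sum>w\<in>X. wz_term w z) \<and>
      (\<forall>z\<in>ball 0 R. ((\<lambda>z. \<Sum>w\<in>X. wz_term w z) has_field_derivative (\<Sum>w\<in>X. - wp_term w z)) (at z))"
    using ev
  proof eventually_elim
    case (elim X)
    have d: "((\<lambda>z. \<Sum>w\<in>X. wz_term w z) has_field_derivative (\<Sum>w\<in>X. - wp_term w z)) (at z)" if "z \<in> cball 0 R" for z
      by (intro DERIV_sum wz_term_DERIV) (use elim wR[OF that] in auto)
    thus ?case by (auto intro!: continuous_at_imp_continuous_on DERIV_isCont)
  qed
  from has_complex_derivative_uniform_limit[OF this lim1 nt R]
  obtain g1 where g1: "\<And>z. z \<in> ball 0 R \<Longrightarrow> (S1 has_field_derivative g1 z) (at z) \<and> ((\<lambda>X. \<Sum>w\<in>X. - wp_term w z) \<longlongrightarrow> g1 z) ?F"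
    by blast
  define S2 where "S2 z = - g1 z" for z
  have S: "((\<lambda>w. ws_log_term w z) has_sum S0 z) (far R)" "((\<lambda>w. wz_term w z) has_sum S1 z) (far R)"
    "((\<lambda>w. wp_term w z) has_sum S2 z) (far R)" if "z \<in> ball 0 R" for z
    using pt[OF lim0 that] pt[OF lim1 that] g1[OF that] unfolding has_sum_def[symmetric]
    by (simp_all add: has_sum_uminus S2_def)
  show ?thesis
  proof (rule that[of S0 S1 S2])
    fix z :: complex assume z: "z \<in> ball 0 R"
    show "((\<lambda>w. wz_term w z) has_sum (\<Sum>w\<in>near R. wz_term w z) + S1 z) (lat - {0})"
      using has_sum_Un_disjoint[OF has_sum_finite[OF near_far(1)] S(2)[OF z] near_far(2)] near_far(3) by simp
    show "((\<lambda>w. wp_term w z) has_sum (\<Sum>w\<in>near R. wp_term w z) + S2 z) (lat - {0})"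
      using has_sum_Un_disjoint[OF has_sum_finite[OF near_far(1)] S(3)[OF z] near_far(2)] near_far(3) by simp
    \<comment> \<open>Near factors may vanish and have no logarithm, so they stay outside the
      exponential. Every finite X that contains \<open>near R\<close> splits into this fixed product
      and the exponential of a far sum.\<close>
    define l where "l w = (if w \<in> near R then 0 else ws_log_term w z)" for w
    have "(l has_sum S0 z) (lat - {0})"
      by (rule iffD1[OF has_sum_cong_neutral S(1)[OF z]])
         (use near_far[of R] in \<open>auto simp: l_def\<close>)
    hence "(sum l \<longlongrightarrow> S0 z) (finite_subsets_at_top (lat - {0}))" unfolding has_sum_def .
    hence "((\<lambda>X. (\<Prod>w\<in>near R. ws_factor w z) * exp (sum l X)) \<longlongrightarrow> (\<Prod>w\<in>near R. ws_factor w z) * exp (S0 z))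
        (finite_subsets_at_top (lat - {0}))" by (intro tendsto_intros)
    moreover have "\<forall>\<^sub>F X in finite_subsets_at_top (lat - {0}).
        (\<Prod>w\<in>near R. ws_factor w z) * exp (sum l X) = (\<Prod>w\<in>X. ws_factor w z)"
      unfolding eventually_finite_subsets_at_top
    proof (intro exI[of _ "near R"] conjI allI impI)
      show "finite (near R)" by (rule near_far)
      show "near R \<subseteq> lat - {0}" by (auto simp: near_def)
      fix X assume "finite X \<and> near R \<subseteq> X \<and> X \<subseteq> lat - {0}"
      hence X: "finite X" "near R \<subseteq> X" "X \<subseteq> lat - {0}" by auto
      have "sum l X = sum l (X - near R)"
        by (rule sum.mono_neutral_right) (use X in \<open>auto simp: l_def\<close>)
      hence "exp (sum l X) = (\<Prod>w\<in>X - near R. exp (l w))" using X by (simp add: exp_sum)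
      also have "\<dots> = (\<Prod>w\<in>X - near R. ws_factor w z)"
      proof (rule prod.cong)
        fix w assume "w \<in> X - near R"
        hence "w \<notin> near R" "norm w \<ge> 2 * R" using X(3) by (auto simp: near_def not_less)
        thus "exp (l w) = ws_factor w z"
          using z R exp_ws_log_term[of z w] by (auto simp: l_def)
      qed auto
      finally show "(\<Prod>w\<in>near R. ws_factor w z) * exp (sum l X) = (\<Prod>w\<in>X. ws_factor w z)"
        using prod.subset_diff[OF X(2,1), of "\<lambda>w. ws_factor w z"] by (simp add: mult.commute)
    qed
    ultimately have "((\<lambda>X. \<Prod>w\<in>X. ws_factor w z) \<longlongrightarrow> (\<Prod>w\<in>near R. ws_factor w z) * exp (S0 z))
        (finite_subsets_at_top (lat - {0}))" by (rule Lim_transform_eventually)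
    thus "ws_reg z = (\<Prod>w\<in>near R. ws_factor w z) * exp (S0 z)"
      unfolding ws_reg_def by (intro tendsto_Lim finite_subsets_at_top_neq_bot)
    have "((\<lambda>w. wz_term w z) has_sum g0 z) (far R)" using g0[OF z] unfolding has_sum_def by blast
    hence "g0 z = S1 z" using S(2)[OF z] infsumI by metis
    thus "(S0 has_field_derivative S1 z) (at z)" using g0[OF z] by simp
    show "(S1 has_field_derivative - S2 z) (at z)" using g1[OF z] by (simp add: S2_def)
  qed
qed

lemma wp_term_has_sum: "((\<lambda>w. wp_term w z) has_sum wp_reg z) (lat - {0})"
proof -
  have "norm z + 1 > 0" "z \<in> ball 0 (norm z + 1)" by (auto simp: add_nonneg_pos)
  then obtain S where "((\<lambda>w. wp_term w z) has_sum S) (lat - {0})"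
    using weierstrass_local[of "norm z + 1"] by metis
  thus ?thesis unfolding wp_reg_def by (metis infsumI)
qed

lemma lat0_closed: "closed (lat - {0})"
proof -
  have "\<not> x islimpt (lat - {0})" for x using lat_not_islimpt islimpt_subset[of x "lat - {0}" lat] by blast
  thus ?thesis unfolding closed_limpt by blast
qed

lemma open_Compl_lat0: "open (- (lat - {0}))"
  by (rule open_Compl[OF lat0_closed])

text \<open>All four facts are read off one local representation on a ball that contains z. The near
  factors of \<open>ws_reg\<close> are entire, whereas zeros and logarithmic derivatives require z
  to avoid the nonzero lattice points.\<close>

lemma ws_reg_holomorphic: "ws_reg holomorphic_on UNIV"
  and wz_reg_DERIV: "z \<notin> lat - {0} \<Longrightarrow> (wz_reg has_field_derivative - wp_reg z) (at z)"
  and ws_reg_nonzero: "z \<notin> lat - {0} \<Longrightarrow> ws_reg z \<noteq> 0"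
  and ws_reg_DERIV: "z \<notin> lat - {0} \<Longrightarrow> (ws_reg has_field_derivative ws_reg z * wz_reg z) (at z)"
proof -
  have *: "ws_reg field_differentiable at z \<and>
     (z \<notin> lat - {0} \<longrightarrow> (wz_reg has_field_derivative - wp_reg z) (at z) \<and> ws_reg z \<noteq> 0 \<and>
        (ws_reg has_field_derivative ws_reg z * wz_reg z) (at z))" for z
  proof -
    define R where "R = norm z + 1"
    have R: "R > 0" "z \<in> ball 0 R" by (auto simp: R_def add_nonneg_pos)
    obtain S0 S1 S2 where S:
      "\<And>z. z \<in> ball 0 R \<Longrightarrow> (S0 has_field_derivative S1 z) (at z)"
      "\<And>z. z \<in> ball 0 R \<Longrightarrow> (S1 has_field_derivative - S2 z) (at z)"
      "\<And>z. z \<in> ball 0 R \<Longrightarrow> ws_reg z = (\<Prod>w\<in>near R. ws_factor w z) * exp (S0 z)"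
      "\<And>z. z \<in> ball 0 R \<Longrightarrow> ((\<lambda>w. wz_term w z) has_sum (\<Sum>w\<in>near R. wz_term w z) + S1 z) (lat - {0})"
      "\<And>z. z \<in> ball 0 R \<Longrightarrow> ((\<lambda>w. wp_term w z) has_sum (\<Sum>w\<in>near R. wp_term w z) + S2 z) (lat - {0})"
      using weierstrass_local[OF R(1)] by metis
    have wzr: "wz_reg y = (\<Sum>w\<in>near R. wz_term w y) + S1 y" if "y \<in> ball 0 R" for y
      unfolding wz_reg_def using S(4)[OF that] by (rule infsumI)
    have wpr: "wp_reg y = (\<Sum>w\<in>near R. wp_term w y) + S2 y" if "y \<in> ball 0 R" for y
      unfolding wp_reg_def using S(5)[OF that] by (rule infsumI)
    have n0: "w \<noteq> 0" if "w \<in> near R" for w using that by (auto simp: near_def)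
    have "(\<lambda>y. (\<Prod>w\<in>near R. ws_factor w y) * exp (S0 y)) holomorphic_on ball 0 R"
    proof (intro holomorphic_intros)
      show "ws_factor w holomorphic_on ball 0 R" if "w \<in> near R" for w
        unfolding ws_factor_def[abs_def] using n0[OF that] by (intro holomorphic_intros) auto
      show "S0 holomorphic_on ball 0 R" unfolding holomorphic_on_open[OF open_ball] using S(1) by blast
    qed
    hence "ws_reg holomorphic_on ball 0 R" using S(3) by (subst holomorphic_cong[OF refl]) auto
    hence 1: "ws_reg field_differentiable at z"
      using R holomorphic_on_imp_differentiable_at open_ball by blast
    have 2: "(wz_reg has_field_derivative - wp_reg z) (at z) \<and> ws_reg z \<noteq> 0 \<and>
        (ws_reg has_field_derivative ws_reg z * wz_reg z) (at z)" if z: "z \<notin> lat - {0}"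
    proof -
      have nz: "z \<noteq> w" "w \<noteq> 0" if "w \<in> near R" for w using that z by (auto simp: near_def)
      have "((\<lambda>y. (\<Sum>w\<in>near R. wz_term w y) + S1 y) has_field_derivative (\<Sum>w\<in>near R. - wp_term w z) + - S2 z) (at z)"
        by (intro DERIV_add DERIV_sum wz_term_DERIV nz S(2) R)
      hence a: "(wz_reg has_field_derivative - wp_reg z) (at z)"
        by (subst wpr[OF R(2)], rule_tac has_field_derivative_transform_within_open[OF _ open_ball R(2)])
           (auto simp: wzr sum_negf)
      have f0: "ws_factor w z \<noteq> 0" if "w \<in> near R" for w
        using nz[OF that] by (auto simp: ws_factor_def)
      have b: "ws_reg z \<noteq> 0" using S(3)[OF R(2)] f0 near_far(1) by simp
      have "((\<lambda>y. \<Prod>w\<in>near R. ws_factor w y) has_field_derivative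
          (\<Prod>w\<in>near R. ws_factor w z) * (\<Sum>w\<in>near R. ws_factor w z * wz_term w z / ws_factor w z)) (at z)"
        by (rule has_field_derivative_prod'[OF f0 ws_factor_DERIV]) (use nz in auto)
      also have "(\<Sum>w\<in>near R. ws_factor w z * wz_term w z / ws_factor w z) = (\<Sum>w\<in>near R. wz_term w z)"
        by (rule sum.cong) (use f0 in auto)
      finally have "((\<lambda>y. (\<Prod>w\<in>near R. ws_factor w y) * exp (S0 y)) has_field_derivative
          (\<Prod>w\<in>near R. ws_factor w z) * (\<Sum>w\<in>near R. wz_term w z) * exp (S0 z) +
          exp (S0 z) * S1 z * (\<Prod>w\<in>near R. ws_factor w z)) (at z)"
        by (intro DERIV_mult DERIV_fun_exp S(1) R)
      also have "(\<Prod>w\<in>near R. ws_factor w z) * (\<Sum>w\<in>near R. wz_term w z) * exp (S0 z) +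
          exp (S0 z) * S1 z * (\<Prod>w\<in>near R. ws_factor w z) = ws_reg z * wz_reg z"
        unfolding S(3)[OF R(2)] wzr[OF R(2)] by (simp add: algebra_simps)
      finally have "(ws_reg has_field_derivative ws_reg z * wz_reg z) (at z)"
        by (rule has_field_derivative_transform_within_open[OF _ open_ball R(2)]) (simp add: S(3))
      with a b show ?thesis by blast
    qed
    show ?thesis using 1 2 by blast
  qed
  show "ws_reg holomorphic_on UNIV"
    using * by (simp add: holomorphic_on_def)
  show "z \<notin> lat - {0} \<Longrightarrow> (wz_reg has_field_derivative - wp_reg z) (at z)"
    "z \<notin> lat - {0} \<Longrightarrow> ws_reg z \<noteq> 0"
    "z \<notin> lat - {0} \<Longrightarrow> (ws_reg has_field_derivative ws_reg z * wz_reg z) (at z)"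
    using * by blast+
qed

lemma wz_reg_holomorphic: "wz_reg holomorphic_on - (lat - {0})"
  unfolding holomorphic_on_open[OF open_Compl_lat0] using wz_reg_DERIV by blast

lemma wp_reg_holomorphic: "wp_reg holomorphic_on - (lat - {0})"
proof -
  have "(\<lambda>z. - deriv wz_reg z) holomorphic_on - (lat - {0})"
    by (intro holomorphic_intros holomorphic_deriv wz_reg_holomorphic open_Compl_lat0)
  thus ?thesis
    by (rule holomorphic_transform) (use DERIV_imp_deriv[OF wz_reg_DERIV] in auto)
qed

lemma wz_reg_analytic [analytic_intros]:
  "f analytic_on A \<Longrightarrow> (\<And>z. z \<in> A \<Longrightarrow> f z \<notin> lat - {0}) \<Longrightarrow> (\<lambda>z. wz_reg (f z)) analytic_on A"
  using analytic_on_compose_gen[of f A wz_reg, OF _ wz_reg_holomorphic[folded analytic_on_open[OF open_Compl_lat0]]]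
  unfolding o_def by blast

lemma wp_reg_analytic [analytic_intros]:
  "f analytic_on A \<Longrightarrow> (\<And>z. z \<in> A \<Longrightarrow> f z \<notin> lat - {0}) \<Longrightarrow> (\<lambda>z. wp_reg (f z)) analytic_on A"
  using analytic_on_compose_gen[of f A wp_reg, OF _ wp_reg_holomorphic[folded analytic_on_open[OF open_Compl_lat0]]]
  unfolding o_def by blast

lemma ws_reg_analytic [analytic_intros]:
  "f analytic_on A \<Longrightarrow> (\<lambda>z. ws_reg (f z)) analytic_on A"
  using analytic_on_compose_gen[of f A ws_reg UNIV] ws_reg_holomorphic
  by (auto simp: analytic_on_open o_def)

lemma ws_analytic [analytic_intros]: "f analytic_on A \<Longrightarrow> (\<lambda>z. ws (f z)) analytic_on A"
  unfolding ws_eq by (intro analytic_intros)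

lemma wz_analytic [analytic_intros]:
  assumes "f analytic_on A" "\<And>z. z \<in> A \<Longrightarrow> f z \<notin> lat"
  shows "(\<lambda>z. wz (f z)) analytic_on A"
proof -
  have "f z \<noteq> 0" if "z \<in> A" for z using assms(2)[OF that] lat_0 by metis
  thus ?thesis unfolding wz_eq by (intro analytic_intros) (use assms in auto)
qed

lemma wp_analytic [analytic_intros]:
  assumes "f analytic_on A" "\<And>z. z \<in> A \<Longrightarrow> f z \<notin> lat"
  shows "(\<lambda>z. wp (f z)) analytic_on A"
proof -
  have "f z \<noteq> 0" if "z \<in> A" for z using assms(2)[OF that] lat_0 by metis
  thus ?thesis unfolding wp_eq by (intro analytic_intros) (use assms in auto)
qed

lemma deriv_wp_analytic [analytic_intros]:
  assumes "f analytic_on A" "\<And>z. z \<in> A \<Longrightarrow> f z \<notin> lat"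
  shows "(\<lambda>z. deriv wp (f z)) analytic_on A"
proof -
  have "deriv wp analytic_on - lat" by (intro analytic_deriv wp_analytic analytic_on_ident) auto
  from analytic_on_compose_gen[OF assms(1) this] assms(2) show ?thesis by (auto simp: o_def)
qed

lemma wz_DERIV:
  assumes "z \<notin> lat"
  shows "(wz has_field_derivative - wp z) (at z)"
proof -
  have "z \<noteq> 0" using assms by auto
  hence "((\<lambda>z. 1 / z + wz_reg z) has_field_derivative - 1 / z ^ 2 + - wp_reg z) (at z)"
    by (intro DERIV_add wz_reg_DERIV) (use assms in \<open>auto intro!: derivative_eq_intros simp: power2_eq_square\<close>)
  thus ?thesis unfolding wz_eq[abs_def] wp_eq by simp
qed

lemma wp_DERIV: "z \<notin> lat \<Longrightarrow> (wp has_field_derivative deriv wp z) (at z)"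
  using wp_analytic[OF analytic_on_ident, of "{z}"] analytic_on_imp_differentiable_at DERIV_deriv_iff_field_differentiable
  by (metis (no_types, lifting) singletonD singletonI)

lemma ws_nonzero: "z \<notin> lat \<Longrightarrow> ws z \<noteq> 0"
  unfolding ws_eq using ws_reg_nonzero[of z] lat_0 by auto

lemma ws_DERIV:
  assumes "z \<notin> lat"
  shows "(ws has_field_derivative ws z * wz z) (at z)"
proof -
  have z: "z \<noteq> 0" using assms by auto
  have "((\<lambda>z. z * ws_reg z) has_field_derivative 1 * ws_reg z + ws_reg z * wz_reg z * z) (at z)"
    by (intro DERIV_mult DERIV_ident ws_reg_DERIV) (use assms in auto)
  moreover have "1 * ws_reg z + ws_reg z * wz_reg z * z = ws z * wz z"
    unfolding ws_eq wz_eq using z by (simp add: field_simps)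
  ultimately show ?thesis unfolding ws_eq[abs_def] by (simp add: ws_eq wz_eq)
qed

section \<open>Parity and periodicity\<close>

lemma bij_betw_uminus_lat: "bij_betw uminus (lat - {0}) (lat - {0})"
  by (rule bij_betwI[of _ _ _ uminus]) auto

lemma wz_reg_minus: "wz_reg (- z) = - wz_reg z"
proof -
  have "wz_reg (- z) = (\<Sum>\<^sub>\<infinity>w\<in>lat - {0}. wz_term (- w) (- z))"
    unfolding wz_reg_def by (rule infsum_reindex_bij_betw[OF bij_betw_uminus_lat, symmetric])
  also have "\<dots> = (\<Sum>\<^sub>\<infinity>w\<in>lat - {0}. - wz_term w z)"
  proof (rule infsum_cong)
    fix w
    have "- z + w = - (z - w)" by simp
    hence "1 / (- z + w) = - (1 / (z - w))" by (simp only: minus_divide_right)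
    thus "wz_term (- w) (- z) = - wz_term w z" by (simp add: wz_term_def)
  qed
  also have "\<dots> = - wz_reg z" unfolding wz_reg_def by (rule infsum_uminus)
  finally show ?thesis .
qed

lemma wp_reg_minus: "wp_reg (- z) = wp_reg z"
proof -
  have "wp_reg (- z) = (\<Sum>\<^sub>\<infinity>w\<in>lat - {0}. wp_term (- w) (- z))"
    unfolding wp_reg_def by (rule infsum_reindex_bij_betw[OF bij_betw_uminus_lat, symmetric])
  also have "\<dots> = (\<Sum>\<^sub>\<infinity>w\<in>lat - {0}. wp_term w z)"
  proof (rule infsum_cong)
    fix w
    have "(- z + w) ^ 2 = (z - w) ^ 2" by (simp add: power2_eq_square algebra_simps)
    thus "wp_term (- w) (- z) = wp_term w z" by (simp add: wp_term_def)
  qed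
  finally show ?thesis unfolding wp_reg_def .
qed

lemma wz_minus: "wz (- z) = - wz z" unfolding wz_eq wz_reg_minus by simp
lemma wp_minus: "wp (- z) = wp z" unfolding wp_eq wp_reg_minus by simp

lemma wz_reg_0: "wz_reg 0 = 0"
  unfolding wz_reg_def wz_term_def by simp

lemma wp_reg_0: "wp_reg 0 = 0"
  unfolding wp_reg_def wp_term_def by simp

text \<open>With \<open>1 / 0 = 0\<close>, \<open>\<wp>(z)\<close> is the sum of \<open>1 / (z - w)\<^sup>2 - 1 / w\<^sup>2\<close> over the full lattice. Hence
  \<open>\<wp>(z + \<omega>) - \<wp>(z)\<close> is a constant series, and its value is 0 by the symmetry \<open>z \<mapsto> - \<omega> - z\<close>.\<close>

lemma wp_periodic:
  assumes \<omega>: "\<omega> \<in> lat"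
  shows "wp (z + \<omega>) = wp z"
proof -
  have full: "((\<lambda>w. wp_term w z) has_sum wp z) lat" for z
  proof -
    have "((\<lambda>w. wp_term w z) has_sum wp_term 0 z + wp_reg z) ({0} \<union> (lat - {0}))"
      by (rule has_sum_Un_disjoint[OF _ wp_term_has_sum]) (auto intro: has_sum_finiteI)
    also have "{0} \<union> (lat - {0}) = lat" by auto
    finally show ?thesis by (simp add: wp_term_def wp_eq)
  qed
  define c where "c = (\<Sum>\<^sub>\<infinity>w\<in>lat. 1 / w ^ 2 - 1 / (w + \<omega>) ^ 2)"
  have c: "wp (z + \<omega>) - wp z = c" for z
  proof -
    have "bij_betw (\<lambda>w. w + \<omega>) lat lat"
      by (rule bij_betwI[of _ _ _ "\<lambda>w. w - \<omega>"]) (auto intro: lat_add lat_diff \<omega>)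
    hence 1: "((\<lambda>w. wp_term (w + \<omega>) (z + \<omega>)) has_sum wp (z + \<omega>)) lat"
      using iffD2[OF has_sum_reindex_bij_betw full[of "z + \<omega>"]] by blast
    have 2: "((\<lambda>w. - wp_term w z) has_sum - wp z) lat" using full[of z] by (simp add: has_sum_uminus)
    from has_sum_add[OF 1 2] have "((\<lambda>w. 1 / w ^ 2 - 1 / (w + \<omega>) ^ 2) has_sum wp (z + \<omega>) - wp z) lat"
      by (simp add: wp_term_def)
    thus ?thesis unfolding c_def by (metis infsumI)
  qed
  have "wp (- z - \<omega> + \<omega>) - wp (- z - \<omega>) = wp z - wp (z + \<omega>)"
    using wp_minus[of z] wp_minus[of "z + \<omega>"] by simp
  hence "c = wp z - wp (z + \<omega>)" unfolding c[of "- z - \<omega>"] .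
  moreover have "c = wp (z + \<omega>) - wp z" using c[of z] by simp
  ultimately have "2 * (wp (z + \<omega>) - wp z) = 0" by simp
  thus ?thesis by simp
qed

lemma lat_compl_connected: "connected (- lat)"
  unfolding Compl_eq_Diff_UNIV by (rule connected_Diff_countable_complex) (auto simp: lat_countable)

lemma wz_quasiperiodic:
  assumes \<omega>: "\<omega> \<in> lat"
  obtains \<eta> where "\<And>z. z \<notin> lat \<Longrightarrow> wz (z + \<omega>) = wz z + \<eta>"
proof -
  have "((\<lambda>z. wz (z + \<omega>) - wz z) has_field_derivative 0) (at z)" if "z \<in> - lat" for z
  proof -
    have "z + \<omega> \<notin> lat" using that \<omega> lat_add_iff by simp
    hence "((\<lambda>z. wz (z + \<omega>)) has_field_derivative - wp (z + \<omega>)) (at z)"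
      by (intro DERIV_shift[THEN iffD1] wz_DERIV)
    from DERIV_diff[OF this wz_DERIV] show ?thesis using that by (simp add: wp_periodic[OF \<omega>])
  qed
  from has_field_derivative_0_imp_constant_on[OF this lat_compl_connected open_Compl[OF lat_closed]]
  obtain \<eta> where "\<And>z. z \<in> - lat \<Longrightarrow> wz (z + \<omega>) - wz z = \<eta>"
    unfolding constant_on_def by blast
  hence "wz (z + \<omega>) = wz z + \<eta>" if "z \<notin> lat" for z using that by (auto simp: diff_eq_eq)
  thus ?thesis using that by blast
qed

lemma deriv_wp_periodic: "\<omega> \<in> lat \<Longrightarrow> z \<notin> lat \<Longrightarrow> deriv wp (z + \<omega>) = deriv wp z"
proof -
  assume \<omega>: "\<omega> \<in> lat" and z: "z \<notin> lat"
  have "z + \<omega> \<notin> lat" using z \<omega> lat_add_iff by simp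
  hence "((\<lambda>z. wp (z + \<omega>)) has_field_derivative deriv wp (z + \<omega>)) (at z)"
    by (intro DERIV_shift[THEN iffD1] wp_DERIV)
  hence "(wp has_field_derivative deriv wp (z + \<omega>)) (at z)" by (simp add: wp_periodic[OF \<omega>])
  thus ?thesis using DERIV_imp_deriv by metis
qed

lemma deriv_wp_minus: "z \<notin> lat \<Longrightarrow> deriv wp (- z) = - deriv wp z"
proof -
  assume z: "z \<notin> lat"
  hence "(wp has_field_derivative deriv wp (- z)) (at (- z))" by (intro wp_DERIV) simp
  hence "((\<lambda>z. wp (- z)) has_field_derivative deriv wp (- z) * - 1) (at z)"
    by (rule DERIV_chain2) (auto intro!: derivative_eq_intros)
  hence "(wp has_field_derivative - deriv wp (- z)) (at z)" by (simp add: wp_minus)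
  hence "deriv wp z = - deriv wp (- z)" by (rule DERIV_imp_deriv)
  thus ?thesis by simp
qed

lemma deriv_wp_eq:
  assumes "z \<notin> lat"
  shows "deriv wp z = - 2 / z ^ 3 + deriv wp_reg z"
proof -
  have z: "z \<noteq> 0" using assms by auto
  have "wp_reg field_differentiable at z"
    by (rule holomorphic_on_imp_differentiable_at[OF wp_reg_holomorphic open_Compl_lat0]) (use assms in auto)
  hence "(wp_reg has_field_derivative deriv wp_reg z) (at z)" by (simp add: DERIV_deriv_iff_field_differentiable)
  hence "((\<lambda>z. 1 / z ^ 2 + wp_reg z) has_field_derivative - 2 / z ^ 3 + deriv wp_reg z) (at z)"
    by (rule DERIV_add[rotated]) (use z in \<open>auto intro!: derivative_eq_intros simp: field_simps eval_nat_numeral\<close>)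
  thus ?thesis unfolding wp_eq[abs_def] by (rule DERIV_imp_deriv)
qed

end

section \<open>Elliptic function identities\<close>

context tau_lattice
begin

section \<open>Elliptic functions without poles\<close>

lemma reduce_mod_lat:
  obtains \<omega> where "\<omega> \<in> lat" "z - \<omega> \<in> (\<lambda>(a, b). of_real a + of_real b * \<tau>) ` ({0..1} \<times> {0..1})"
proof -
  define b where "b = Im z / Im \<tau>"
  define a where "a = Re z - b * Re \<tau>"
  have z: "z = of_real a + of_real b * \<tau>" using Im_pos by (simp add: complex_eq_iff a_def b_def)
  let ?w = "of_int \<lfloor>a\<rfloor> + of_int \<lfloor>b\<rfloor> * \<tau>"
  show ?thesis
  proof (rule that[of ?w])
    show "?w \<in> lat" unfolding lat_altdef by blast
    have "z - ?w = of_real (frac a) + of_real (frac b) * \<tau>" by (simp add: z frac_def algebra_simps)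
    moreover have "(frac a, frac b) \<in> {0..1} \<times> {0..1}" using frac_lt_1[of a] frac_lt_1[of b] by (simp add: less_imp_le)
    ultimately show "z - ?w \<in> (\<lambda>(a, b). of_real a + of_real b * \<tau>) ` ({0..1} \<times> {0..1})"
      by (intro image_eqI[of _ _ "(frac a, frac b)"]) auto
  qed
qed

text \<open>Periodicity reduces all values to those on a compact period parallelogram, so
  Liouville's theorem applies.\<close>

lemma entire_elliptic_constant:
  assumes f: "f holomorphic_on UNIV" and per: "\<And>z \<omega>. \<omega> \<in> lat \<Longrightarrow> f (z + \<omega>) = f z"
  obtains c where "\<And>z. f z = c"
proof -
  let ?K = "(\<lambda>(a, b). of_real a + of_real b * \<tau>) ` ({0..1::real} \<times> {0..1::real})"
  have K: "compact ?K"
    by (intro compact_continuous_image compact_Times compact_Icc)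
       (auto simp: case_prod_unfold intro!: continuous_intros)
  have "compact (f ` ?K)"
    by (rule compact_continuous_image[OF continuous_on_subset[OF holomorphic_on_imp_continuous_on[OF f]] K]) auto
  hence "bounded (f ` ?K)" by (rule compact_imp_bounded)
  moreover have "range f \<subseteq> f ` ?K"
  proof
    fix y assume "y \<in> range f"
    then obtain z where y: "y = f z" by blast
    obtain \<omega> where \<omega>: "\<omega> \<in> lat" "z - \<omega> \<in> ?K" by (rule reduce_mod_lat)
    have "f z = f (z - \<omega>)" using per[OF \<omega>(1), of "z - \<omega>"] by simp
    thus "y \<in> f ` ?K" using y \<omega> by blast
  qed
  ultimately have "bounded (range f)" by (rule bounded_subset)
  from Liouville_theorem[OF f this] show ?thesis using that unfolding constant_on_def by blast
qed

end

locale tau_lattice_point = tau_lattice +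
  fixes p :: complex
  assumes two_p: "2 * p \<notin> period_lattice \<tau>"
begin

abbreviation sing :: "complex set" where "sing \<equiv> GLE_singularities \<tau> p"

lemma p_notin_lat: "p \<notin> lat" using lat_add[of p p] two_p by auto

lemma sing_iff: "z \<in> sing \<longleftrightarrow> z \<in> lat \<or> z - p \<in> lat \<or> z + p \<in> lat"
  unfolding GLE_singularities_def by simp

lemma sing_eq: "sing = lat \<union> (+) p ` lat \<union> (+) (- p) ` lat"
proof -
  have im: "z \<in> (+) c ` lat \<longleftrightarrow> z - c \<in> lat" for z c
    by (auto intro!: image_eqI[where x = "z - c"])
  show ?thesis by (rule set_eqI) (simp only: sing_iff Un_iff im diff_minus_eq_add disj_assoc)
qed

lemma sing_add: "\<omega> \<in> lat \<Longrightarrow> z + \<omega> \<in> sing \<longleftrightarrow> z \<in> sing"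
  using lat_add_iff[of \<omega> z] lat_add_iff[of \<omega> "z - p"] lat_add_iff[of \<omega> "z + p"]
  by (simp add: sing_iff algebra_simps)

lemma sing_minus: "- z \<in> sing \<longleftrightarrow> z \<in> sing"
  using lat_minus_iff[of "z - p"] lat_minus_iff[of "z + p"] by (auto simp: sing_iff)

lemma sing_countable: "countable sing" unfolding sing_eq using lat_countable by auto

lemma sing_not_islimpt: "\<not> x islimpt sing"
proof -
  have "\<not> x islimpt ((+) c ` lat)" for c
  proof
    assume "x islimpt ((+) c ` lat)"
    hence "(x - c) islimpt ((+) (- c) ` (+) c ` lat)"
      using islimpt_isCont_image[of x "(+) c ` lat" "(+) (- c)"]
      by (auto simp: eventually_at_filter)
    hence "(x - c) islimpt lat" by (simp add: image_image)
    thus False using lat_not_islimpt by blast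
  qed
  thus ?thesis unfolding sing_eq islimpt_Un using lat_not_islimpt by blast
qed

lemma sing_closed: "closed sing" using sing_not_islimpt unfolding closed_limpt by blast

lemma eventually_notin_sing: "\<forall>\<^sub>F z in at x. z \<notin> sing"
  using sing_not_islimpt islimpt_iff_eventually by blast

lemma sing_compl_connected: "connected (- sing)"
  unfolding Compl_eq_Diff_UNIV by (rule connected_Diff_countable_complex) (auto simp: sing_countable)

lemma sing_compl_nonempty: "- sing \<noteq> {}"
  using open_Diff_countable_nonempty[of UNIV sing] sing_countable by (auto simp: Compl_eq_Diff_UNIV)

text \<open>The device for proving identities of elliptic functions. Every point of
  \<open>sing\<close> is congruent to 0, p or -p, and the parity factor s carries p to -p, so
  removability has to be checked only at 0 and p.\<close>

lemma elliptic_constant: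
  assumes G: "G holomorphic_on - sing"
    and per: "\<And>z \<omega>. \<omega> \<in> lat \<Longrightarrow> z \<notin> sing \<Longrightarrow> G (z + \<omega>) = G z"
    and par: "\<And>z. z \<notin> sing \<Longrightarrow> G (- z) = s * G z"
    and lim0: "((\<lambda>z. z * G z) \<longlongrightarrow> 0) (at 0)" and limp: "((\<lambda>z. (z - p) * G z) \<longlongrightarrow> 0) (at p)"
  obtains c where "\<And>z. z \<notin> sing \<Longrightarrow> G z = c"
proof -
  have "((\<lambda>z. (- z - p) * G (- z)) \<longlongrightarrow> 0) (at (- p))"
  proof (rule filterlim_compose[OF limp])
    have "\<forall>\<^sub>F z in at (- p). - z \<noteq> p"
      unfolding eventually_at_filter by (rule always_eventually) (metis minus_minus)
    thus "filterlim (\<lambda>z. - z) (at p) (at (- p))"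
      by (intro filterlim_atI) (auto intro!: tendsto_eq_intros)
  qed
  hence "((\<lambda>z. - s * ((- z - p) * G (- z))) \<longlongrightarrow> - s * 0) (at (- p))" by (intro tendsto_intros)
  moreover have "\<forall>\<^sub>F z in at (- p). - s * ((- z - p) * G (- z)) = (z - (- p)) * G z"
    using eventually_notin_sing[of "- p"]
  proof eventually_elim
    case (elim z)
    have "G z = s * G (- z)" using par[of "- z"] elim sing_minus by simp
    thus ?case by (simp add: algebra_simps)
  qed
  ultimately have limm: "((\<lambda>z. (z - (- p)) * G z) \<longlongrightarrow> 0) (at (- p))"
    using Lim_transform_eventually by force
  have lim: "((\<lambda>z. (z - x) * G z) \<longlongrightarrow> 0) (at x)" if "x \<in> sing" for x
  proof -
    obtain x0 where x0: "x - x0 \<in> lat" "((\<lambda>z. (z - x0) * G z) \<longlongrightarrow> 0) (at x0)"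
    proof -
      have "x \<in> lat \<or> x - p \<in> lat \<or> x + p \<in> lat" using \<open>x \<in> sing\<close> by (simp only: sing_iff)
      thus ?thesis using that[of 0] that[of p] that[of "- p"] lim0 limp limm by auto
    qed
    define \<omega> where "\<omega> = x - x0"
    have "((\<lambda>z. (z + - \<omega> - x0) * G (z + - \<omega>)) \<longlongrightarrow> 0) (at (x0 - - \<omega>))"
      by (rule LIM_offset[OF x0(2)])
    hence "((\<lambda>z. (z + - \<omega> - x0) * G (z + - \<omega>)) \<longlongrightarrow> 0) (at x)" by (simp add: \<omega>_def)
    moreover have "\<forall>\<^sub>F z in at x. (z + - \<omega> - x0) * G (z + - \<omega>) = (z - x) * G z"
      using eventually_notin_sing[of x]
    proof eventually_elim
      case (elim z)
      have "G (z + - \<omega>) = G z" by (rule per) (use x0 elim in \<open>auto simp: \<omega>_def simp flip: lat_minus_iff[of "x - x0"]\<close>)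
      thus ?case by (simp add: \<omega>_def)
    qed
    ultimately show ?thesis by (rule Lim_transform_eventually)
  qed
  have "\<exists>e g. e > 0 \<and> ball x e \<inter> sing \<subseteq> {x} \<and> g holomorphic_on ball x e \<and> (\<forall>z\<in>ball x e - {x}. g z = G z)"
    if x: "x \<in> sing" for x
  proof -
    obtain e where e: "e > 0" "\<And>z. z \<noteq> x \<Longrightarrow> dist z x < e \<Longrightarrow> z \<notin> sing"
      using eventually_notin_sing[of x] unfolding eventually_at by auto
    have sub: "ball x e - {x} \<subseteq> - sing" using e(2) by (auto simp: dist_commute)
    have "G holomorphic_on ball x e - {x}" by (rule holomorphic_on_subset[OF G sub])
    moreover have "x \<in> interior (ball x e)" using e by simp
    ultimately obtain g where "g holomorphic_on ball x e" "\<forall>z\<in>ball x e - {x}. g z = G z"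
      using holomorphic_on_extend_lim[of G "ball x e" x] lim[OF x] by blast
    thus ?thesis using e(1) sub by blast
  qed
  then obtain e g where eg: "\<And>x. x \<in> sing \<Longrightarrow> e x > 0" "\<And>x. x \<in> sing \<Longrightarrow> ball x (e x) \<inter> sing \<subseteq> {x}"
    "\<And>x. x \<in> sing \<Longrightarrow> g x holomorphic_on ball x (e x)" "\<And>x z. x \<in> sing \<Longrightarrow> z \<in> ball x (e x) - {x} \<Longrightarrow> g x z = G z"
    by metis
  \<comment> \<open>A singular point takes its value from its own local extension; its ball contains
    no other singular point, so H agrees with that extension on the whole ball.\<close>
  define H where "H z = (if z \<in> sing then g z z else G z)" for z
  have HG: "H z = G z" if "z \<notin> sing" for z using that by (simp add: H_def)
  have o: "open (- sing)" using sing_closed by auto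
  have "\<exists>U. open U \<and> x \<in> U \<and> H holomorphic_on U" for x
  proof (cases "x \<in> sing")
    case True
    have "H z = g x z" if "z \<in> ball x (e x)" for z
      using eg(2)[OF True] eg(4)[OF True, of z] that by (cases "z = x") (auto simp: H_def True)
    hence "H holomorphic_on ball x (e x)" using eg(3)[OF True] by (subst holomorphic_cong[OF refl]) auto
    thus ?thesis using eg(1)[OF True] by (intro exI[of _ "ball x (e x)"]) auto
  next
    case False
    have "H holomorphic_on - sing" using G HG by (subst holomorphic_cong[OF refl]) auto
    thus ?thesis using False o by blast
  qed
  hence H: "H holomorphic_on UNIV"
    by (metis UNIV_I at_within_open field_differentiable_within_subset holomorphic_on_def subset_UNIV)
  have Hper: "H (z + \<omega>) = H z" if \<omega>: "\<omega> \<in> lat" for z \<omega>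
  proof (rule analytic_continuation_open[where f = "\<lambda>z. H (z + \<omega>)" and g = H, OF o open_UNIV sing_compl_nonempty connected_UNIV])
    have "(\<lambda>z. z + \<omega>) holomorphic_on UNIV" by (intro holomorphic_intros)
    thus "(\<lambda>z. H (z + \<omega>)) holomorphic_on UNIV"
      using holomorphic_on_compose_gen[OF _ H, of "\<lambda>z. z + \<omega>" UNIV] by (simp add: o_def)
    show "H (w + \<omega>) = H w" if "w \<in> - sing" for w
      using that per[OF \<omega>, of w] sing_add[OF \<omega>, of w] by (simp add: HG)
  qed (use H in auto)
  obtain c where "\<And>z. H z = c" using entire_elliptic_constant[OF H Hper] by blast
  thus ?thesis using that[of c] HG by metis
qed

section \<open>The logarithmic derivative of wp - wp(p)\<close>

text \<open>\<open>wp_diff\<close> and \<open>dlog\<close> are h and a of the overview.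
  \<open>dlog_reg\<close> is a without its pole at p; \<open>zeta_pair\<close> is the part of a that
  is regular at 0.\<close>

definition wp_diff :: "complex \<Rightarrow> complex" where "wp_diff z = wp z - wp p"
definition dlog :: "complex \<Rightarrow> complex" where "dlog z = wz (z - p) + wz (z + p) - 2 * wz z"
definition dlog_reg :: "complex \<Rightarrow> complex" where "dlog_reg z = wz_reg (z - p) + wz (z + p) - 2 * wz z"
definition zeta_pair :: "complex \<Rightarrow> complex" where "zeta_pair z = wz (z - p) + wz (z + p)"

lemma dlog_eq_p: "dlog z = 1 / (z - p) + dlog_reg z" by (simp add: dlog_def dlog_reg_def wz_eq[of "z - p"])
lemma dlog_eq_0: "dlog z = zeta_pair z - 2 / z - 2 * wz_reg z" by (simp add: dlog_def zeta_pair_def wz_eq[of z])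

lemma notin_sing: "z \<notin> sing \<Longrightarrow> z \<notin> lat" "z \<notin> sing \<Longrightarrow> z - p \<notin> lat" "z \<notin> sing \<Longrightarrow> z + p \<notin> lat"
  by (auto simp: sing_iff)

lemma wp_diff_analytic: "z \<notin> lat \<Longrightarrow> wp_diff analytic_on {z}"
  unfolding wp_diff_def[abs_def] by (intro analytic_intros) auto

lemma dlog_analytic: "z \<notin> sing \<Longrightarrow> dlog analytic_on {z}"
  unfolding dlog_def[abs_def] by (intro analytic_intros) (auto simp: sing_iff)

lemma dlog_reg_analytic: "dlog_reg analytic_on {p}"
  unfolding dlog_reg_def[abs_def] using two_p p_notin_lat by (intro analytic_intros) auto

lemma holomorphic_on_sing_compl: "(\<And>z. z \<notin> sing \<Longrightarrow> f analytic_on {z}) \<Longrightarrow> f holomorphic_on - sing"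
  using analytic_imp_holomorphic[of f "- sing"] analytic_on_analytic_at by blast

lemma dlog_periodic: "\<omega> \<in> lat \<Longrightarrow> z \<notin> sing \<Longrightarrow> dlog (z + \<omega>) = dlog z"
proof -
  assume \<omega>: "\<omega> \<in> lat" and z: "z \<notin> sing"
  obtain \<eta> where \<eta>: "\<And>z. z \<notin> lat \<Longrightarrow> wz (z + \<omega>) = wz z + \<eta>" using wz_quasiperiodic[OF \<omega>] by blast
  have "wz (z - p + \<omega>) = wz (z - p) + \<eta>" "wz (z + p + \<omega>) = wz (z + p) + \<eta>" "wz (z + \<omega>) = wz z + \<eta>"
    using notin_sing[OF z] by (auto intro!: \<eta>)
  thus ?thesis by (simp add: dlog_def algebra_simps)
qed

lemma wz_diff_periodic: "\<omega> \<in> lat \<Longrightarrow> z \<notin> sing \<Longrightarrow> wz (z + \<omega> + p) - wz (z + \<omega> - p) = wz (z + p) - wz (z - p)"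
proof -
  assume \<omega>: "\<omega> \<in> lat" and z: "z \<notin> sing"
  obtain \<eta> where \<eta>: "\<And>z. z \<notin> lat \<Longrightarrow> wz (z + \<omega>) = wz z + \<eta>" using wz_quasiperiodic[OF \<omega>] by blast
  have "wz (z - p + \<omega>) = wz (z - p) + \<eta>" "wz (z + p + \<omega>) = wz (z + p) + \<eta>"
    using notin_sing[OF z] by (auto intro!: \<eta>)
  thus ?thesis by (simp add: algebra_simps)
qed

lemma wz_minus_shift: "wz (- z - p) = - wz (z + p)" "wz (- z + p) = - wz (z - p)" "wz (p - z) = - wz (z - p)"
proof -
  have "- z - p = - (z + p)" "- z + p = - (z - p)" "p - z = - (z - p)" by simp_all
  thus "wz (- z - p) = - wz (z + p)" "wz (- z + p) = - wz (z - p)" "wz (p - z) = - wz (z - p)"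
    by (simp_all only: wz_minus)
qed

lemma wp_minus_shift: "wp (- z - p) = wp (z + p)" "wp (- z + p) = wp (z - p)" "wp (p - z) = wp (z - p)"
proof -
  have "- z - p = - (z + p)" "- z + p = - (z - p)" "p - z = - (z - p)" by simp_all
  thus "wp (- z - p) = wp (z + p)" "wp (- z + p) = wp (z - p)" "wp (p - z) = wp (z - p)"
    by (simp_all only: wp_minus)
qed

lemma dlog_minus: "dlog (- z) = - dlog z"
  by (simp add: dlog_def wz_minus_shift wz_minus)

text \<open>By oddness of zeta, \<open>zeta_pair\<close> vanishes at 0, so the limit is its
  derivative there.\<close>

lemma zeta_pair_over_z: "((\<lambda>z. zeta_pair z / z) \<longlongrightarrow> - 2 * wp p) (at 0)"
proof -
  have p: "0 + p \<notin> lat" "0 - p \<notin> lat" using p_notin_lat by auto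
  have "(zeta_pair has_field_derivative (- wp (0 - p) * 1 + - wp (0 + p) * 1)) (at 0)"
    unfolding zeta_pair_def[abs_def]
    by (intro DERIV_add DERIV_chain2[OF wz_DERIV] p) (auto intro!: derivative_eq_intros)
  moreover have "zeta_pair 0 = 0" using wz_minus[of p] by (simp add: zeta_pair_def)
  ultimately show ?thesis unfolding DERIV_def by (simp add: wp_minus)
qed

lemma wz_reg_over_z: "((\<lambda>z. wz_reg z / z) \<longlongrightarrow> 0) (at 0)"
  using wz_reg_DERIV[of 0] unfolding DERIV_def by (simp add: wz_reg_0 wp_reg_0)

lemma tendsto_of_analytic: "f analytic_on {x} \<Longrightarrow> (f \<longlongrightarrow> f x) (at x)"
  for f :: "complex \<Rightarrow> complex"
  using analytic_at_imp_isCont isCont_def by blast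

lemma zeta_pair_tendsto_0: "(zeta_pair \<longlongrightarrow> 0) (at 0)"
proof -
  have "zeta_pair analytic_on {0}" unfolding zeta_pair_def[abs_def] using p_notin_lat by (intro analytic_intros) auto
  moreover have "zeta_pair 0 = 0" using wz_minus[of p] by (simp add: zeta_pair_def)
  ultimately show ?thesis using tendsto_of_analytic by metis
qed

lemma wz_reg_tendsto_0: "(wz_reg \<longlongrightarrow> 0) (at 0)"
  using tendsto_of_analytic[OF wz_reg_analytic[OF analytic_on_ident, of "{0}"]] wz_reg_0 by auto

lemma wp_reg_tendsto_0: "(wp_reg \<longlongrightarrow> 0) (at 0)"
  using tendsto_of_analytic[OF wp_reg_analytic[OF analytic_on_ident, of "{0}"]] wp_reg_0 by auto

text \<open>The difference h a - h' is elliptic and its poles at 0 and p cancel, so it is constant;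
  being odd, it is 0. This identifies a with h' / h, and the sigma formula for h is derived from it
  afterwards.\<close>

lemma wp_diff_dlog: "z \<notin> sing \<Longrightarrow> wp_diff z * dlog z = deriv wp z"
proof -
  assume z: "z \<notin> sing"
  define G where "G z = wp_diff z * dlog z - deriv wp z" for z
  have G: "G holomorphic_on - sing"
  proof (rule holomorphic_on_sing_compl)
    fix z assume "z \<notin> sing"
    thus "G analytic_on {z}" unfolding G_def[abs_def]
      by (intro analytic_intros wp_diff_analytic dlog_analytic) (auto simp: sing_iff)
  qed
  have par: "G (- z) = (- 1) * G z" if "z \<notin> sing" for z
    using that by (simp add: G_def dlog_minus wp_diff_def wp_minus deriv_wp_minus notin_sing)
  have lim0: "((\<lambda>z. z * G z) \<longlongrightarrow> 0) (at 0)"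
  proof -
    have d: "(deriv wp_reg \<longlongrightarrow> deriv wp_reg 0) (at 0)"
      by (intro tendsto_of_analytic analytic_deriv wp_reg_analytic analytic_on_ident) auto
    \<comment> \<open>This is z G after the negative powers have cancelled. In the limit, - 2 wp(p)
      from \<open>zeta_pair\<close> meets + 2 wp(p) from the constant term of h.\<close>
    let ?E = "\<lambda>z. zeta_pair z / z - 2 * (wz_reg z / z) + z * (wp_reg z - wp p) * zeta_pair z - 2 * (wp_reg z - wp p)
        - 2 * z * (wp_reg z - wp p) * wz_reg z - z * deriv wp_reg z"
    have "(?E \<longlongrightarrow>
       - 2 * wp p - 2 * 0 + 0 * (0 - wp p) * 0 - 2 * (0 - wp p) - 2 * 0 * (0 - wp p) * 0 - 0 * deriv wp_reg 0) (at 0)"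
      by (intro tendsto_intros zeta_pair_over_z wz_reg_over_z zeta_pair_tendsto_0 wz_reg_tendsto_0 wp_reg_tendsto_0 d)
    moreover have "\<forall>\<^sub>F z in at 0. ?E z = z * G z"
      using eventually_notin_sing[of 0]
    proof eventually_elim
      case (elim z)
      have z: "z \<noteq> 0" using elim lat_0 notin_sing by metis
      have "G z = (1 / z ^ 2 + wp_reg z - wp p) * (zeta_pair z - 2 / z - 2 * wz_reg z) - (- 2 / z ^ 3 + deriv wp_reg z)"
        by (simp add: G_def wp_diff_def wp_eq[of z] dlog_eq_0 deriv_wp_eq notin_sing elim)
      \<comment> \<open>Writing u for 1 / z makes the claim a polynomial identity modulo z u =
        1.\<close>
      moreover have "z * ((u ^ 2 + P - w) * (b - 2 * u - 2 * Z) - (- 2 * u ^ 3 + D)) =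
          u * b - 2 * (u * Z) + z * (P - w) * b - 2 * (P - w) - 2 * z * (P - w) * Z - z * D"
        if "z * u = 1" for u P w b Z D :: complex using that by algebra
      from this[of "1 / z" "wp_reg z" "wp p" "zeta_pair z" "wz_reg z" "deriv wp_reg z"]
      have "z * ((1 / z ^ 2 + wp_reg z - wp p) * (zeta_pair z - 2 / z - 2 * wz_reg z) - (- 2 / z ^ 3 + deriv wp_reg z)) =
          ?E z"
        using z by (simp add: power_one_over)
      ultimately show ?case by simp
    qed
    ultimately show ?thesis by (simp add: Lim_transform_eventually)
  qed
  have limp: "((\<lambda>z. (z - p) * G z) \<longlongrightarrow> 0) (at p)"
  proof -
    have d: "(deriv wp \<longlongrightarrow> deriv wp p) (at p)"
      by (intro tendsto_of_analytic deriv_wp_analytic analytic_on_ident) (use p_notin_lat in auto)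
    have "((\<lambda>z. wp_diff z * (1 + (z - p) * dlog_reg z) - (z - p) * deriv wp z) \<longlongrightarrow> wp_diff p * (1 + (p - p) * dlog_reg p) - (p - p) * deriv wp p) (at p)"
      by (intro tendsto_intros d tendsto_of_analytic dlog_reg_analytic wp_diff_analytic p_notin_lat)
    moreover have "\<forall>\<^sub>F z in at p. wp_diff z * (1 + (z - p) * dlog_reg z) - (z - p) * deriv wp z = (z - p) * G z"
      unfolding eventually_at_filter by (rule always_eventually) (auto simp: G_def dlog_eq_p field_simps)
    ultimately show ?thesis by (simp add: Lim_transform_eventually wp_diff_def)
  qed
  have per: "G (z + \<omega>) = G z" if "\<omega> \<in> lat" "z \<notin> sing" for z \<omega>
    using that by (simp add: G_def wp_diff_def wp_periodic dlog_periodic deriv_wp_periodic notin_sing)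
  obtain c where c: "\<And>z. z \<notin> sing \<Longrightarrow> G z = c"
    using elliptic_constant[OF G per par lim0 limp] by metis
  have "c = - c" using c[OF z] c[of "- z"] par[OF z] z sing_minus by simp
  hence "G z = 0" using c[OF z] by simp
  thus ?thesis by (simp add: G_def)
qed

lemma wp_diff_DERIV: "z \<notin> lat \<Longrightarrow> (wp_diff has_field_derivative deriv wp z) (at z)"
  unfolding wp_diff_def[abs_def] using wp_DERIV[of z] by (auto intro!: derivative_eq_intros)

lemma dlog_DERIV: "z \<notin> sing \<Longrightarrow> (dlog has_field_derivative - wp (z - p) - wp (z + p) + 2 * wp z) (at z)"
proof -
  assume z: "z \<notin> sing"
  have "(dlog has_field_derivative (- wp (z - p) * 1 + - wp (z + p) * 1 - 2 * - wp z)) (at z)"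
    unfolding dlog_def[abs_def]
    by (intro DERIV_add DERIV_diff DERIV_cmult DERIV_chain2[OF wz_DERIV] wz_DERIV notin_sing[OF z]) (auto intro!: derivative_eq_intros)
  thus ?thesis by simp
qed

text \<open>The square of \<Psi>. It is single-valued, so branches of \<Psi> can be treated as
  square roots of one fixed function.\<close>

definition psi_sq :: "complex \<Rightarrow> complex" where "psi_sq z = ws z ^ 2 / (ws (z - p) * ws (z + p))"

lemma psi_sq_nonzero: "z \<notin> sing \<Longrightarrow> psi_sq z \<noteq> 0"
  unfolding psi_sq_def using ws_nonzero notin_sing by simp

lemma psi_sq_DERIV: "z \<notin> sing \<Longrightarrow> (psi_sq has_field_derivative - dlog z * psi_sq z) (at z)"
proof -
  assume z: "z \<notin> sing"
  note n = notin_sing[OF z]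
  have sh: "((\<lambda>z. ws (z + c)) has_field_derivative ws (z + c) * wz (z + c)) (at z)" if "z + c \<notin> lat" for c
    by (rule DERIV_shift[THEN iffD1, OF ws_DERIV[OF that]])
  have d1: "((\<lambda>z. ws (z - p)) has_field_derivative ws (z - p) * wz (z - p)) (at z)"
    and d2: "((\<lambda>z. ws (z + p)) has_field_derivative ws (z + p) * wz (z + p)) (at z)"
    using sh[of "- p"] sh[of p] n by simp_all
  show ?thesis unfolding psi_sq_def[abs_def] dlog_def
    using ws_nonzero[OF n(1)] ws_nonzero[OF n(2)] ws_nonzero[OF n(3)] ws_DERIV[OF n(1)] d1 d2
    by (auto intro!: derivative_eq_intros simp: field_simps power2_eq_square)
qed

text \<open>The logarithmic derivatives a of h and - a of \<open>psi_sq\<close> cancel. The constant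
  is not 0, since z^2 h tends to 1 at 0. It follows that h has no zeros off \<open>sing\<close> and
  that \<open>psi_sq\<close> is elliptic.\<close>

lemma wp_diff_psi_sq: obtains c where "c \<noteq> 0" "\<And>z. z \<notin> sing \<Longrightarrow> wp_diff z * psi_sq z = c"
proof -
  have "((\<lambda>z. wp_diff z * psi_sq z) has_field_derivative 0) (at z)" if "z \<in> - sing" for z
  proof -
    have z: "z \<notin> sing" using that by simp
    have "((\<lambda>z. wp_diff z * psi_sq z) has_field_derivative deriv wp z * psi_sq z + (- dlog z * psi_sq z) * wp_diff z) (at z)"
      by (intro DERIV_mult wp_diff_DERIV psi_sq_DERIV notin_sing z)
    thus ?thesis using wp_diff_dlog[OF z] by (simp add: algebra_simps flip: wp_diff_dlog[OF z])
  qed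
  from has_field_derivative_0_imp_constant_on[OF this sing_compl_connected open_Compl[OF sing_closed]]
  obtain c where c: "\<And>z. z \<in> - sing \<Longrightarrow> wp_diff z * psi_sq z = c" unfolding constant_on_def by blast
  have "c \<noteq> 0"
  proof
    assume "c = 0"
    have ev: "\<forall>\<^sub>F z in at 0. 1 + z ^ 2 * (wp_reg z - wp p) = 0"
      using eventually_notin_sing[of 0]
    proof eventually_elim
      case (elim z)
      have "z \<noteq> 0" using elim lat_0 notin_sing by metis
      have "wp_diff z = 0" using c[of z] psi_sq_nonzero[OF elim] \<open>c = 0\<close> elim by simp
      hence "z ^ 2 * wp_diff z = 0" by simp
      moreover have "z ^ 2 * wp_diff z = 1 + z ^ 2 * (wp_reg z - wp p)"
        using \<open>z \<noteq> 0\<close> by (simp add: wp_diff_def wp_eq[of z] field_simps)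
      ultimately show ?case by simp
    qed
    have "((\<lambda>z. 1 + z ^ 2 * (wp_reg z - wp p)) \<longlongrightarrow> 1 + 0 ^ 2 * (0 - wp p)) (at 0)"
      by (intro tendsto_intros wp_reg_tendsto_0)
    hence "((\<lambda>z. 1 + z ^ 2 * (wp_reg z - wp p)) \<longlongrightarrow> 1) (at 0)" by simp
    moreover have "((\<lambda>z. 1 + z ^ 2 * (wp_reg z - wp p)) \<longlongrightarrow> 0) (at 0)"
      by (rule Lim_transform_eventually[OF tendsto_const]) (use ev in \<open>auto elim: eventually_mono\<close>)
    ultimately show False using tendsto_unique[OF at_neq_bot] by (metis zero_neq_one)
  qed
  thus ?thesis using c that by (metis ComplI)
qed

lemma wp_diff_nonzero: "z \<notin> sing \<Longrightarrow> wp_diff z \<noteq> 0"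
  using wp_diff_psi_sq by (metis mult_zero_left)

lemma wp_diff_over: "((\<lambda>z. wp_diff z / (z - p)) \<longlongrightarrow> deriv wp p) (at p)"
proof -
  have "(wp_diff has_field_derivative deriv wp p) (at p)" by (rule wp_diff_DERIV[OF p_notin_lat])
  thus ?thesis by (simp add: has_field_derivative_iff wp_diff_def)
qed

text \<open>By the sigma formula, h has the zero of sigma(z - p) at p with a cofactor containing
  sigma(2 p), which is nonzero since 2 p is not a lattice point; so the zero is simple.\<close>

lemma deriv_wp_p_nonzero: "deriv wp p \<noteq> 0"
proof
  assume 0: "deriv wp p = 0"
  obtain c where c: "c \<noteq> 0" "\<And>z. z \<notin> sing \<Longrightarrow> wp_diff z * psi_sq z = c" by (rule wp_diff_psi_sq) blast
  have l1: "((\<lambda>z. wp_diff z / (z - p) * ws z ^ 2) \<longlongrightarrow> deriv wp p * ws p ^ 2) (at p)"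
    by (intro tendsto_intros wp_diff_over tendsto_of_analytic ws_analytic analytic_on_ident)
  have l2: "((\<lambda>z. c * (ws_reg (z - p) * ws (z + p))) \<longlongrightarrow> c * (ws_reg (p - p) * ws (p + p))) (at p)"
    by (intro tendsto_intros tendsto_of_analytic analytic_intros)
  have "\<forall>\<^sub>F z in at p. wp_diff z / (z - p) * ws z ^ 2 = c * (ws_reg (z - p) * ws (z + p))"
    using eventually_notin_sing[of p]
  proof eventually_elim
    case (elim z)
    have n: "ws (z - p) \<noteq> 0" "ws (z + p) \<noteq> 0" "z \<noteq> p" "ws_reg (z - p) \<noteq> 0"
      using ws_nonzero notin_sing[OF elim] ws_eq[of "z - p"] by auto
    have "wp_diff z * ws z ^ 2 = c * (ws (z - p) * ws (z + p))"
      using c(2)[OF elim] n by (simp add: psi_sq_def field_simps)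
    thus ?case using n by (simp add: ws_eq[of "z - p"] field_simps)
  qed
  hence "deriv wp p * ws p ^ 2 = c * (ws_reg (p - p) * ws (p + p))"
    by (rule tendsto_unique[OF at_neq_bot Lim_transform_eventually[OF l1] l2])
  moreover have "ws_reg 0 \<noteq> 0" by (rule ws_reg_nonzero) simp
  moreover have "ws (p + p) \<noteq> 0" using ws_nonzero[of "2 * p"] two_p by simp
  ultimately show False using 0 c(1) by simp
qed

text \<open>Taylor expansion of h at p gives h' / h = 1 / (z - p) + h''(p) / (2 h'(p)) + .... The
  proof differentiates (z - p) h' = h (1 + (z - p) \<open>dlog_reg\<close>), divides by z - p and
  lets z tend to p.\<close>

lemma two_dlog_reg_p: "2 * dlog_reg p = deriv (deriv wp) p / deriv wp p"
proof -
  let ?D = "deriv wp"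
  have anD: "?D analytic_on {p}" by (intro deriv_wp_analytic analytic_on_ident) (use p_notin_lat in auto)
  have l1: "((\<lambda>z. ?D z * dlog_reg z + wp_diff z / (z - p) * (dlog_reg z + (z - p) * deriv dlog_reg z)) \<longlongrightarrow> ?D p * dlog_reg p + ?D p * (dlog_reg p + (p - p) * deriv dlog_reg p)) (at p)"
    by (intro tendsto_intros wp_diff_over tendsto_of_analytic dlog_reg_analytic anD analytic_deriv)
  have l2: "(deriv ?D \<longlongrightarrow> deriv ?D p) (at p)"
    by (intro tendsto_of_analytic analytic_deriv anD)
  have "\<forall>\<^sub>F z in at p. ?D z * dlog_reg z + wp_diff z / (z - p) * (dlog_reg z + (z - p) * deriv dlog_reg z) = deriv ?D z"
    using eventually_notin_sing[of p]
  proof eventually_elim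
    case (elim z)
    note n = notin_sing[OF elim]
    have zp: "z \<noteq> p" using n(2) by auto
    have "dlog_reg analytic_on {z}" unfolding dlog_reg_def[abs_def] using n by (intro analytic_intros) auto
    hence dee: "(dlog_reg has_field_derivative deriv dlog_reg z) (at z)"
      using analytic_on_imp_differentiable_at DERIV_deriv_iff_field_differentiable by blast
    have "?D analytic_on {z}" by (intro deriv_wp_analytic analytic_on_ident) (use n in auto)
    hence dD: "(?D has_field_derivative deriv ?D z) (at z)"
      using analytic_on_imp_differentiable_at DERIV_deriv_iff_field_differentiable by blast
    have "((\<lambda>z. wp_diff z * (1 + (z - p) * dlog_reg z)) has_field_derivative
        ?D z * (1 + (z - p) * dlog_reg z) + (0 + (1 * dlog_reg z + deriv dlog_reg z * (z - p))) * wp_diff z) (at z)"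
      by (intro DERIV_mult DERIV_add DERIV_const dee wp_diff_DERIV n) (auto intro!: derivative_eq_intros)
    moreover have "((\<lambda>z. (z - p) * ?D z) has_field_derivative 1 * ?D z + deriv ?D z * (z - p)) (at z)"
      by (intro DERIV_mult dD) (auto intro!: derivative_eq_intros)
    hence "((\<lambda>z. wp_diff z * (1 + (z - p) * dlog_reg z)) has_field_derivative 1 * ?D z + deriv ?D z * (z - p)) (at z)"
    proof (rule has_field_derivative_transform_within_open[OF _ open_Compl[OF sing_closed]])
      show "z \<in> - sing" using elim by simp
      fix w assume "w \<in> - sing"
      hence w: "w \<notin> sing" "w \<noteq> p" using notin_sing(2)[of w] by auto
      thus "(w - p) * ?D w = wp_diff w * (1 + (w - p) * dlog_reg w)"
        using wp_diff_dlog[OF w(1)] by (auto simp: dlog_eq_p field_simps)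
    qed
    ultimately have "?D z * (1 + (z - p) * dlog_reg z) + (0 + (1 * dlog_reg z + deriv dlog_reg z * (z - p))) * wp_diff z = 1 * ?D z + deriv ?D z * (z - p)"
      by (rule DERIV_unique)
    hence "(z - p) * (?D z * dlog_reg z) + wp_diff z * (dlog_reg z + (z - p) * deriv dlog_reg z) = (z - p) * deriv ?D z"
      by (simp add: algebra_simps)
    thus ?case using zp by (simp add: field_simps)
  qed
  hence "?D p * dlog_reg p + ?D p * (dlog_reg p + (p - p) * deriv dlog_reg p) = deriv ?D p"
    by (rule tendsto_unique[OF at_neq_bot Lim_transform_eventually[OF l1] l2])
  thus ?thesis using deriv_wp_p_nonzero by (simp add: field_simps)
qed

text \<open>Partial fractions of a^2. The residue at p is \<open>2 * dlog_reg p\<close>, the one at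
  -p is its negative because a^2 is even, and there is none at 0 because a is odd. The difference of
  both sides is thus constant, and its limit at 0 is 0.\<close>

lemma dlog_square:
  assumes z: "z \<notin> sing"
  shows "dlog z ^ 2 = wp (z + p) + wp (z - p) + 4 * wp z + 6 * wp p
      - deriv (deriv wp) p / deriv wp p * (wz (z + p) - wz (z - p) - 2 * wz p)"
proof -
  define A where "A = deriv (deriv wp) p / deriv wp p"
  define G where "G z = dlog z ^ 2 - (wp (z + p) + wp (z - p) + 4 * wp z + 6 * wp p - A * (wz (z + p) - wz (z - p) - 2 * wz p))" for z
  have G: "G holomorphic_on - sing"
  proof (rule holomorphic_on_sing_compl)
    fix z assume "z \<notin> sing"
    thus "G analytic_on {z}" unfolding G_def[abs_def]
      by (intro analytic_intros dlog_analytic) (auto simp: sing_iff)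
  qed
  have par: "G (- z) = 1 * G z" if "z \<notin> sing" for z
    by (simp add: G_def dlog_minus wp_minus wz_minus_shift wp_minus_shift algebra_simps)
  have G0: "(G \<longlongrightarrow> 0) (at 0)"
  proof -
    have q: "((\<lambda>z. wp (z + p) + wp (z - p) - A * (wz (z + p) - wz (z - p) - 2 * wz p)) \<longlongrightarrow>
        wp (0 + p) + wp (0 - p) - A * (wz (0 + p) - wz (0 - p) - 2 * wz p)) (at 0)"
      by (rule tendsto_of_analytic) (use p_notin_lat in \<open>auto intro!: analytic_intros\<close>)
    let ?E = "\<lambda>z. - 4 * (zeta_pair z / z) + 8 * (wz_reg z / z) + (zeta_pair z - 2 * wz_reg z) ^ 2
        - (wp (z + p) + wp (z - p) - A * (wz (z + p) - wz (z - p) - 2 * wz p)) - 4 * wp_reg z - 6 * wp p"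
    \<comment> \<open>The constants balance here: 8 wp(p) from the cross term of - 2 / z with
      \<open>zeta_pair\<close>, against 2 wp(p) from the shifted functions and the explicit 6
      wp(p).\<close>
    let ?L = "- 4 * (- 2 * wp p) + 8 * 0 + (0 - 2 * 0) ^ 2
        - (wp (0 + p) + wp (0 - p) - A * (wz (0 + p) - wz (0 - p) - 2 * wz p)) - 4 * 0 - 6 * wp p"
    have L: "(?E \<longlongrightarrow>
       ?L) (at 0)"
      by (intro tendsto_intros zeta_pair_over_z wz_reg_over_z zeta_pair_tendsto_0 wz_reg_tendsto_0 wp_reg_tendsto_0 q)
    have Z: "?L = 0"
      by (simp add: wp_minus wz_minus)
    have E: "\<forall>\<^sub>F z in at 0. ?E z = G z"
    proof -
      have "dlog z ^ 2 - 4 * wp z = - 4 * (zeta_pair z / z) + 8 * (wz_reg z / z) + (zeta_pair z - 2 * wz_reg z) ^ 2 - 4 * wp_reg z" if "z \<noteq> 0" for z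
        unfolding dlog_eq_0 wp_eq by (simp add: power2_eq_square divide_inverse algebra_simps)
      thus ?thesis unfolding eventually_at_filter by (intro always_eventually) (auto simp: G_def algebra_simps)
    qed
    show ?thesis using Lim_transform_eventually[OF L E] unfolding Z .
  qed
  hence "((\<lambda>z. z * G z) \<longlongrightarrow> 0 * 0) (at 0)" by (intro tendsto_intros)
  hence lim0: "((\<lambda>z. z * G z) \<longlongrightarrow> 0) (at 0)" by simp
  have limp: "((\<lambda>z. (z - p) * G z) \<longlongrightarrow> 0) (at p)"
  proof -
    define r where "r z = 2 * dlog_reg z + (z - p) * dlog_reg z ^ 2 - (z - p) * wp_reg (z - p) - (z - p) * wp (z + p)
       - 4 * (z - p) * wp z + A * ((z - p) * wz (z + p) - 1 - (z - p) * wz_reg (z - p) - 2 * (z - p) * wz p) - 6 * (z - p) * wp p" for z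
    have "r analytic_on {p}" unfolding r_def[abs_def]
      by (intro analytic_intros dlog_reg_analytic) (use two_p p_notin_lat in auto)
    hence L: "(r \<longlongrightarrow> r p) (at p)" by (rule tendsto_of_analytic)
    \<comment> \<open>The value r p is the residue of G at p, namely
      \<open>2 * dlog_reg p - A\<close>.\<close>
    have Z: "r p = 0" using two_dlog_reg_p by (simp add: r_def A_def)
    have E: "\<forall>\<^sub>F z in at p. r z = (z - p) * G z"
      unfolding eventually_at_filter
    proof (rule always_eventually, intro allI impI)
      fix z assume "z \<noteq> p"
      define d where "d = z - p"
      have d: "d \<noteq> 0" using \<open>z \<noteq> p\<close> by (simp add: d_def)
      have "G z = (1 / d + dlog_reg z) ^ 2 - (wp (z + p) + (1 / d ^ 2 + wp_reg d) + 4 * wp z + 6 * wp p - A * (wz (z + p) - (1 / d + wz_reg d) - 2 * wz p))"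
        by (simp add: G_def dlog_eq_p wp_eq[of "z - p"] wz_eq[of "z - p"] d_def)
      moreover have "2 * e + d * e ^ 2 - d * P - d * w1 - 4 * d * w2 + A * (d * z1 - 1 - d * Z - 2 * d * z2) - 6 * d * w3 =
          d * ((u + e) ^ 2 - (w1 + (u ^ 2 + P) + 4 * w2 + 6 * w3 - A * (z1 - (u + Z) - 2 * z2)))"
        if "d * u = 1" for u e P w1 w2 w3 z1 z2 Z :: complex using that by algebra
      from this[of "1 / d" "dlog_reg z" "wp_reg d" "wp (z + p)" "wp z" "wz (z + p)" "wz_reg d" "wz p" "wp p"]
      have "r z = d * ((1 / d + dlog_reg z) ^ 2 - (wp (z + p) + (1 / d ^ 2 + wp_reg d) + 4 * wp z + 6 * wp p - A * (wz (z + p) - (1 / d + wz_reg d) - 2 * wz p)))"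
        unfolding r_def d_def[symmetric] using d by (simp add: power_one_over)
      ultimately show "r z = (z - p) * G z" by (simp add: d_def)
    qed
    show ?thesis using Lim_transform_eventually[OF L E] unfolding Z .
  qed
  have per: "G (z + \<omega>) = G z" if \<omega>: "\<omega> \<in> lat" and z: "z \<notin> sing" for z \<omega>
  proof -
    have "wp (z + \<omega> + p) = wp (z + p)" "wp (z + \<omega> - p) = wp (z - p)"
      using wp_periodic[OF \<omega>, of "z + p"] wp_periodic[OF \<omega>, of "z - p"] by (simp_all add: algebra_simps)
    thus ?thesis unfolding G_def using \<omega> z
      by (simp add: wp_periodic dlog_periodic wz_diff_periodic)
  qed
  obtain c where c: "\<And>z. z \<notin> sing \<Longrightarrow> G z = c"
    using elliptic_constant[OF G per par lim0 limp] by metis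
  have "\<forall>\<^sub>F z in at 0. c = G z" using eventually_notin_sing[of 0] by eventually_elim (simp add: c)
  hence "(G \<longlongrightarrow> c) (at 0)" by (rule Lim_transform_eventually[OF tendsto_const])
  hence "c = 0" using G0 tendsto_unique[OF at_neq_bot] by blast
  hence "G z = 0" using c[OF z] by simp
  thus ?thesis by (simp add: G_def A_def)
qed

end

section \<open>From the Lame equation to the generalized Lame equation\<close>

unbundle no fps_syntax

section \<open>Rows of solutions and constant matrices\<close>

lemma matrix_inv_eqs:
  fixes C :: "'a::semiring_1 ^ 'n ^ 'n"
  assumes "invertible C"
  shows "C ** matrix_inv C = mat 1" "matrix_inv C ** C = mat 1"
proof -
  have "C ** matrix_inv C = mat 1 \<and> matrix_inv C ** C = mat 1"
    unfolding matrix_inv_def using assms unfolding invertible_def by (rule someI_ex)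
  thus "C ** matrix_inv C = mat 1" "matrix_inv C ** C = mat 1" by auto
qed

lemma smult_vector_matrix_mult: "(c *s x) v* A = c *s (x v* (A :: 'a::comm_semiring_1 ^ 'm ^ 'n))"
  by (simp add: vec_eq_iff vector_matrix_mult_def sum_distrib_left mult.assoc)

text \<open>The independence clause of \<open>GLE_solution_row\<close>, isolated so that it applies
  to any row of germs.\<close>

definition independent_row :: "complex \<Rightarrow> (complex \<Rightarrow> complex ^ 2) \<Rightarrow> bool" where
  "independent_row x0 w \<longleftrightarrow>
     (\<forall>c :: complex ^ 2. (\<forall>\<^sub>F z in nhds x0. (\<Sum>i\<in>UNIV. c $ i * w z $ i) = 0) \<longrightarrow> c = 0)"

text \<open>Moves a matrix from the row to the coefficients, by which independence of x A is reduced
  to independence of x.\<close>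

lemma sum_vector_matrix_mult:
  fixes c x :: "complex ^ 2"
  shows "(\<Sum>i\<in>UNIV. c $ i * (x v* A) $ i) = (\<Sum>k\<in>UNIV. (A *v c) $ k * x $ k)"
  by (simp add: vector_matrix_mult_def matrix_vector_mult_def sum_2 algebra_simps)

text \<open>Allows monodromy matrices to be compared through the germs they produce.\<close>

lemma independent_row_eqD:
  fixes A B :: "complex ^ 2 ^ 2"
  assumes w: "independent_row x0 w" and eq: "\<forall>\<^sub>F z in nhds x0. w z v* A = w z v* B"
  shows "A = B"
proof -
  have "(A - B) *v c = 0" for c
  proof -
    have "\<forall>\<^sub>F z in nhds x0. (\<Sum>i\<in>UNIV. ((A - B) *v c) $ i * w z $ i) = 0"
      using eq
    proof eventually_elim
      case (elim z)
      have "w z v* (A - B) = w z v* A - w z v* B"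
        by (simp add: vec_eq_iff vector_matrix_mult_def algebra_simps sum_subtractf)
      hence "w z v* (A - B) = 0" using elim by simp
      hence "(\<Sum>i\<in>UNIV. c $ i * (w z v* (A - B)) $ i) = 0" by simp
      thus ?case unfolding sum_vector_matrix_mult .
    qed
    thus ?thesis using w unfolding independent_row_def by blast
  qed
  hence "A - B = 0" by (metis matrix_eq matrix_vector_mult_0)
  thus ?thesis by simp
qed

lemma independent_row_mult:
  assumes w: "independent_row x0 w" and C: "invertible C"
  shows "independent_row x0 (\<lambda>z. w z v* C)"
  unfolding independent_row_def
proof (intro allI impI)
  fix c :: "complex ^ 2"
  assume "\<forall>\<^sub>F z in nhds x0. (\<Sum>i\<in>UNIV. c $ i * (w z v* C) $ i) = 0"
  hence "C *v c = 0" using w unfolding sum_vector_matrix_mult independent_row_def by blast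
  hence "matrix_inv C *v (C *v c) = 0" by simp
  thus "c = 0" by (simp add: matrix_vector_mul_assoc matrix_inv_eqs[OF C])
qed

lemma invertible_of_independent_row:
  fixes C :: "complex ^ 2 ^ 2"
  assumes Y: "independent_row x0 Y" and eq: "\<forall>\<^sub>F z in nhds x0. Y z = w z v* C"
  shows "invertible C"
proof -
  have "c = 0" if "C *v c = 0" for c
  proof -
    have "\<forall>\<^sub>F z in nhds x0. (\<Sum>i\<in>UNIV. c $ i * Y z $ i) = 0"
      using eq
    proof eventually_elim
      case (elim z)
      show ?case unfolding elim sum_vector_matrix_mult that by simp
    qed
    thus ?thesis using Y unfolding independent_row_def by blast
  qed
  thus ?thesis unfolding invertible_left_inverse matrix_left_invertible_ker by blast
qed

text \<open>A linear relation between germs may be differentiated, and the resulting two equations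
  have the Wronskian as determinant.\<close>

lemma fund_pair_independent:
  assumes U: "open U" "x0 \<in> U" and fg: "fund_pair q U f g"
  shows "independent_row x0 (\<lambda>z. vector [f z, g z])"
  unfolding independent_row_def
proof (intro allI impI)
  fix c :: "complex ^ 2"
  assume "\<forall>\<^sub>F z in nhds x0. (\<Sum>i\<in>UNIV. c $ i * (vector [f z, g z] :: complex ^ 2) $ i) = 0"
  hence ev: "\<forall>\<^sub>F z in nhds x0. c $ 1 * f z + c $ 2 * g z = 0" by (simp add: sum_2)
  hence "deriv (\<lambda>z. c $ 1 * f z + c $ 2 * g z) x0 = deriv (\<lambda>z. 0) x0" by (intro deriv_cong_ev) auto
  moreover have "ode_sol q U f" "ode_sol q U g" using fg by (auto simp: fund_pair_def)
  ultimately have 1: "c $ 1 * deriv f x0 + c $ 2 * deriv g x0 = 0" using ode_sol_lincomb(2)[OF U(1)] U(2) by simp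
  have 2: "c $ 1 * f x0 + c $ 2 * g x0 = 0" using ev by (rule eventually_nhds_x_imp_x)
  have "c $ 1 * wronskian f g x0 = (c $ 1 * f x0 + c $ 2 * g x0) * deriv g x0 - (c $ 1 * deriv f x0 + c $ 2 * deriv g x0) * g x0"
    "c $ 2 * wronskian f g x0 = (c $ 1 * deriv f x0 + c $ 2 * deriv g x0) * f x0 - (c $ 1 * f x0 + c $ 2 * g x0) * deriv f x0"
    by (simp_all add: wronskian_def algebra_simps)
  hence "c $ 1 * wronskian f g x0 = 0" "c $ 2 * wronskian f g x0 = 0" unfolding 1 2 by simp_all
  moreover have "wronskian f g x0 \<noteq> 0" using fg U(2) by (simp add: fund_pair_def)
  ultimately show "c = 0" by (simp add: vec_eq_iff forall_2)
qed

section \<open>Monodromy of the Lame equation\<close>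

context tau_lattice
begin

definition lame_q :: "nat \<Rightarrow> complex \<Rightarrow> complex \<Rightarrow> complex" where
  "lame_q n B z = of_nat n * (of_nat n + 1) * wp z + B"

lemma lame_q_periodic: "\<omega> \<in> lat \<Longrightarrow> lame_q n B (z + \<omega>) = lame_q n B z"
  by (simp add: lame_q_def wp_periodic)

text \<open>Periodicity moves a lattice point to 0, where the regular part of wp is even, as the
  log-free Frobenius argument requires.\<close>

lemma lame_pair_local: "\<exists>e>0. \<exists>f g. fund_pair (lame_q n B) (ball x e - lat) f g"
proof (cases "x \<in> lat")
  case True
  define G where "G z = of_nat n * (of_nat n + 1) * wp_reg z + B" for z
  have "G analytic_on {0}" unfolding G_def[abs_def] by (intro analytic_intros) auto
  moreover have "G (- z) = G z" for z by (simp add: G_def wp_reg_minus)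
  moreover have "lame_q n B z = of_nat n * (of_nat n + 1) / z ^ 2 + G z" for z
    by (simp add: lame_q_def G_def wp_eq distrib_left add_divide_distrib algebra_simps)
  ultimately obtain e f g where e: "e > 0" and fg: "fund_pair (lame_q n B) (ball 0 e - {0}) f g"
    by (rule fund_pair_double_pole)
  have "fund_pair (lame_q n B) (ball x e - lat) (\<lambda>z. f (z + - x)) (\<lambda>z. g (z + - x))"
  proof (rule fund_pair_shift[OF _ _ fg])
    show "open (ball x e - lat)" using lat_closed by auto
    show "z + - x \<in> ball 0 e - {0}" if "z \<in> ball x e - lat" for z
      using that True by (auto simp: dist_norm norm_minus_commute)
    show "lame_q n B z = lame_q n B (z + - x)" for z
      using lame_q_periodic[of "- x" n B z] True by simp
  qed auto
  thus ?thesis using e by blast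
next
  case False
  have "(\<lambda>z. lame_q n B (z + x)) analytic_on {0}"
    unfolding lame_q_def by (intro analytic_intros) (use False in auto)
  then obtain e f g where e: "e > 0" and fg: "fund_pair (\<lambda>z. lame_q n B (z + x)) (ball 0 e) f g"
    by (rule fund_pair_ordinary)
  have "fund_pair (lame_q n B) (ball x e) (\<lambda>z. f (z + - x)) (\<lambda>z. g (z + - x))"
    by (rule fund_pair_shift[OF _ _ fg]) (auto simp: dist_norm norm_minus_commute)
  hence "fund_pair (lame_q n B) (ball x e - lat) (\<lambda>z. f (z + - x)) (\<lambda>z. g (z + - x))"
    by (rule fund_pair_subset) auto
  thus ?thesis using e by blast
qed

lemma lame_pair_global: obtains f g where "fund_pair (lame_q n B) (- lat) f g"
  by (rule fund_pair_global[OF lat_closed lat_countable lame_pair_local]) blast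

text \<open>The potential is periodic, so translation acts linearly on the two-dimensional space of
  global solutions. The derivatives are recorded with the same matrix because the transformed row
  combines y' and y.\<close>

lemma lame_monodromy:
  assumes fg: "fund_pair (lame_q n B) (- lat) f g" and \<omega>: "\<omega> \<in> lat"
  obtains M :: "complex ^ 2 ^ 2" where
    "\<And>z. z \<notin> lat \<Longrightarrow> vector [f (z + \<omega>), g (z + \<omega>)] = (vector [f z, g z] :: complex ^ 2) v* M"
    "\<And>z. z \<notin> lat \<Longrightarrow> vector [deriv f (z + \<omega>), deriv g (z + \<omega>)] = (vector [deriv f z, deriv g z] :: complex ^ 2) v* M"
proof -
  have f: "ode_sol (lame_q n B) (- lat) f" and g: "ode_sol (lame_q n B) (- lat) g"
    using fg by (auto simp: fund_pair_def)
  have o: "open (- lat)" using lat_closed by auto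
  have ne: "- lat \<noteq> {}"
    using open_Diff_countable_nonempty[of UNIV lat] lat_countable by (simp add: Compl_eq_Diff_UNIV)
  have span: "\<exists>a b. \<forall>z\<in>- lat. y (z + \<omega>) = a * f z + b * g z \<and> deriv y (z + \<omega>) = a * deriv f z + b * deriv g z"
    if y: "ode_sol (lame_q n B) (- lat) y" for y
  proof -
    have sh: "z + \<omega> \<in> - lat" "lame_q n B z = lame_q n B (z + \<omega>)" if "z \<in> - lat" for z
      using that \<omega> lat_add_iff lame_q_periodic by auto
    have s: "ode_sol (lame_q n B) (- lat) (\<lambda>z. y (z + \<omega>))"
      by (rule ode_sol_shift(1)[OF o o y]) (use sh in auto)
    have ds: "deriv (\<lambda>z. y (z + \<omega>)) z = deriv y (z + \<omega>)" if "z \<in> - lat" for z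
      by (rule ode_sol_shift(2)[OF o o y _ _ that]) (use sh in auto)
    obtain a b where ab: "\<And>z. z \<in> - lat \<Longrightarrow> y (z + \<omega>) = a * f z + b * g z"
      using ode_sol_span[OF o lat_compl_connected ne fg s] by metis
    have "deriv y (z + \<omega>) = a * deriv f z + b * deriv g z" if z: "z \<in> - lat" for z
    proof -
      have "deriv y (z + \<omega>) = deriv (\<lambda>z. y (z + \<omega>)) z" using ds[OF z] ..
      also have "\<dots> = deriv (\<lambda>z. a * f z + b * g z) z" by (rule deriv_eq_open[OF o z ab])
      also have "\<dots> = a * deriv f z + b * deriv g z" by (rule ode_sol_lincomb(2)[OF o f g z])
      finally show ?thesis .
    qed
    thus ?thesis using ab by blast
  qed
  obtain a b where ab: "\<And>z. z \<notin> lat \<Longrightarrow> f (z + \<omega>) = a * f z + b * g z"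
    "\<And>z. z \<notin> lat \<Longrightarrow> deriv f (z + \<omega>) = a * deriv f z + b * deriv g z" using span[OF f] by (metis ComplI)
  obtain c d where cd: "\<And>z. z \<notin> lat \<Longrightarrow> g (z + \<omega>) = c * f z + d * g z"
    "\<And>z. z \<notin> lat \<Longrightarrow> deriv g (z + \<omega>) = c * deriv f z + d * deriv g z" using span[OF g] by (metis ComplI)
  show ?thesis
    \<comment> \<open>Rows are multiplied from the right, so the coefficients of the translated f
      and g form the columns.\<close>
    by (rule that[of "vector [vector [a, c], vector [b, d]]"])
       (simp_all add: vec_eq_iff forall_2 vector_matrix_mult_def sum_2 ab cd mult.commute)
qed

end

section \<open>The transformation to the generalized Lame equation\<close>

context tau_lattice_point
begin

text \<open>This is the normal form of u'' = a u' + (n (n + 1) h + T^2 + T a) u: removing the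
  first-order term by u = sqrt h w adds a^2 / 4 - a' / 2. Expanding a^2 by
  \<open>dlog_square\<close> recovers the given potential.\<close>

lemma GLE_q_eq:
  assumes z: "z \<notin> sing"
  shows "GLE_q n \<tau> p T z = of_nat n * (of_nat n + 1) * wp_diff z + T ^ 2 + T * dlog z + dlog z ^ 2 / 4
     - (- wp (z - p) - wp (z + p) + 2 * wp z) / 2"
proof -
  define A where "A = deriv (deriv wp) p / deriv wp p"
  have A: "deriv (deriv wp) p / (2 * deriv wp p) = A / 2" "deriv (deriv wp) p / (4 * deriv wp p) = A / 4"
    by (simp_all add: A_def)
  show ?thesis
    unfolding dlog_square[OF z] A_def[symmetric] unfolding GLE_q_def GLE_B_def A wp_diff_def dlog_def
    by (simp add: field_simps power2_eq_square)
qed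

text \<open>The logarithmic derivative of \<open>\<Psi>\<close> is such that multiplication by \<open>\<Psi>\<close> removes the first-order
  term from the equation of \<open>y' - T y\<close>.\<close>

lemma gauge_solution:
  assumes U: "open U" "U \<subseteq> - sing"
    and \<Psi>: "\<And>z. z \<in> U \<Longrightarrow> (\<Psi> has_field_derivative - (dlog z / 2) * \<Psi> z) (at z)"
    and T: "T ^ 2 = of_nat n * (of_nat n + 1) * wp p + B"
    and y: "ode_sol (lame_q n B) U y"
  shows "ode_sol (GLE_q n \<tau> p T) U (\<lambda>z. \<Psi> z * (deriv y z - T * y z))"
    and "\<And>z. z \<in> U \<Longrightarrow> deriv (\<lambda>z. \<Psi> z * (deriv y z - T * y z)) z =
        \<Psi> z * (of_nat n * (of_nat n + 1) * wp_diff z * y z - T * (deriv y z - T * y z) - dlog z / 2 * (deriv y z - T * y z))"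
proof -
  let ?N = "of_nat n * (of_nat n + 1) :: complex"
  let ?w = "\<lambda>z. \<Psi> z * (deriv y z - T * y z)"
  let ?w' = "\<lambda>z. \<Psi> z * (?N * wp_diff z * y z - T * (deriv y z - T * y z) - dlog z / 2 * (deriv y z - T * y z))"
  have lame: "lame_q n B z = ?N * wp_diff z + T ^ 2" for z by (simp add: lame_q_def wp_diff_def T algebra_simps)
  have 1: "(?w has_field_derivative ?w' z) (at z)" if z: "z \<in> U" for z
  proof -
    note d = ode_sol_DERIV[OF U(1) y z]
    have "(?w has_field_derivative - (dlog z / 2) * \<Psi> z * (deriv y z - T * y z) + (lame_q n B z * y z - T * deriv y z) * \<Psi> z) (at z)"
      by (intro DERIV_mult \<Psi>[OF z] DERIV_diff DERIV_cmult d)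
    also have "- (dlog z / 2) * \<Psi> z * (deriv y z - T * y z) + (lame_q n B z * y z - T * deriv y z) * \<Psi> z = ?w' z"
      unfolding lame by (simp add: algebra_simps power2_eq_square)
    finally show ?thesis .
  qed
  have 2: "(?w' has_field_derivative GLE_q n \<tau> p T z * ?w z) (at z)" if z: "z \<in> U" for z
  proof -
    note d = ode_sol_DERIV[OF U(1) y z]
    have zs: "z \<notin> sing" using z U by auto
    let ?a' = "- wp (z - p) - wp (z + p) + 2 * wp z"
    let ?Y = "deriv y z" and ?y = "y z" and ?h = "wp_diff z" and ?a = "dlog z"
    let ?L = "- (?a / 2) * \<Psi> z * (?N * ?h * ?y - T * (?Y - T * ?y) - ?a / 2 * (?Y - T * ?y)) +
       (((?N * deriv wp z) * ?y + ?Y * (?N * ?h)) - T * (lame_q n B z * ?y - T * ?Y) -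
        (?a' / 2 * (?Y - T * ?y) + (lame_q n B z * ?y - T * ?Y) * (?a / 2))) * \<Psi> z"
    have "(?w' has_field_derivative ?L) (at z)"
      by (intro DERIV_mult \<Psi>[OF z] DERIV_diff DERIV_cmult d wp_diff_DERIV notin_sing zs DERIV_cdivide dlog_DERIV)
    \<comment> \<open>With h' written as h a and the Lame potential as N h + T^2, the claim is an
      algebraic identity in the values of all functions at z.\<close>
    moreover have "- (a / 2) * s * (N * h * v - T * (Y - T * v) - a / 2 * (Y - T * v)) +
       (((N * (h * a)) * v + Y * (N * h)) - T * ((N * h + T ^ 2) * v - T * Y) -
        (a' / 2 * (Y - T * v) + ((N * h + T ^ 2) * v - T * Y) * (a / 2))) * s =
        (N * h + T ^ 2 + T * a + a ^ 2 / 4 - a' / 2) * (s * (Y - T * v))" for a a' s N h v Y :: complex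
      by (simp add: field_simps power2_eq_square)
    hence "?L = GLE_q n \<tau> p T z * ?w z" unfolding GLE_q_eq[OF zs] lame wp_diff_dlog[OF zs, symmetric] .
    ultimately show ?thesis by simp
  qed
  show "ode_sol (GLE_q n \<tau> p T) U ?w" "\<And>z. z \<in> U \<Longrightarrow> deriv ?w z = ?w' z"
    using ode_solI[OF U(1) 1 2] by auto
qed

text \<open>The transformed Wronskian is - n (n + 1) \<Psi>^2 h times the original one. The
  condition n > 0 makes the first factor nonzero, and h has no zeros off
  \<open>sing\<close>.\<close>

lemma gauge_pair:
  assumes n: "n > 0" and U: "open U" "U \<subseteq> - sing"
    and \<Psi>: "\<And>z. z \<in> U \<Longrightarrow> (\<Psi> has_field_derivative - (dlog z / 2) * \<Psi> z) (at z)" "\<And>z. z \<in> U \<Longrightarrow> \<Psi> z \<noteq> 0"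
    and T: "T ^ 2 = of_nat n * (of_nat n + 1) * wp p + B"
    and fg: "fund_pair (lame_q n B) U f g"
  shows "fund_pair (GLE_q n \<tau> p T) U (\<lambda>z. \<Psi> z * (deriv f z - T * f z)) (\<lambda>z. \<Psi> z * (deriv g z - T * g z))"
proof -
  have sol: "ode_sol (lame_q n B) U f" "ode_sol (lame_q n B) U g" using fg by (auto simp: fund_pair_def)
  have FG: "ode_sol (GLE_q n \<tau> p T) U (\<lambda>z. \<Psi> z * (deriv f z - T * f z))"
    "ode_sol (GLE_q n \<tau> p T) U (\<lambda>z. \<Psi> z * (deriv g z - T * g z))"
    by (rule gauge_solution(1)[OF U \<Psi>(1) T sol(1)], assumption, rule gauge_solution(1)[OF U \<Psi>(1) T sol(2)], assumption)
  have dFG: "deriv (\<lambda>z. \<Psi> z * (deriv y z - T * y z)) z =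
      \<Psi> z * (of_nat n * (of_nat n + 1) * wp_diff z * y z - T * (deriv y z - T * y z) - dlog z / 2 * (deriv y z - T * y z))"
    if "ode_sol (lame_q n B) U y" "z \<in> U" for y z
    by (rule gauge_solution(2)[OF U _ T that]) (rule \<Psi>(1))
  have "wronskian (\<lambda>z. \<Psi> z * (deriv f z - T * f z)) (\<lambda>z. \<Psi> z * (deriv g z - T * g z)) z \<noteq> 0" if z: "z \<in> U" for z
  proof -
    let ?N = "of_nat n * (of_nat n + 1) :: complex"
    have "wronskian (\<lambda>z. \<Psi> z * (deriv f z - T * f z)) (\<lambda>z. \<Psi> z * (deriv g z - T * g z)) z =
       - (\<Psi> z ^ 2 * ?N * wp_diff z * wronskian f g z)"
      unfolding wronskian_def dFG[OF sol(1) z] dFG[OF sol(2) z]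
      by (simp add: field_simps power2_eq_square)
    moreover have "?N \<noteq> 0"
    proof -
      have "?N = of_nat (n * (n + 1))" by (simp add: distrib_left)
      thus ?thesis using n by (metis add_gr_0 less_numeral_extra(3) nat_0_less_mult_iff of_nat_eq_0_iff zero_less_one)
    qed
    ultimately show ?thesis using \<Psi>(2)[OF z] wp_diff_nonzero[of z] fg z U by (auto simp: fund_pair_def)
  qed
  thus ?thesis using FG by (simp add: fund_pair_def)
qed

section \<open>Monodromy of the transformed rows\<close>

text \<open>The single-valued factor of the transformed row; \<Psi>, the factor that can branch, is
  kept apart.\<close>

definition gauge_row :: "(complex \<Rightarrow> complex) \<Rightarrow> (complex \<Rightarrow> complex) \<Rightarrow> complex \<Rightarrow> complex \<Rightarrow> complex ^ 2" where
  "gauge_row f g T z = vector [deriv f z - T * f z, deriv g z - T * g z]"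

text \<open>Differentiating \<Psi>^2 = \<open>psi_sq\<close> halves the logarithmic derivative,
  whichever branch is taken.\<close>

lemma gauge_branch_nbhd:
  assumes z0: "x0 \<notin> sing" and \<Psi>: "\<Psi> analytic_on {x0}" "\<forall>\<^sub>F z in nhds x0. \<Psi> z ^ 2 = psi_sq z"
  obtains r where "r > 0" "ball x0 r \<subseteq> - sing" "\<And>z. z \<in> ball x0 r \<Longrightarrow> \<Psi> z \<noteq> 0"
    "\<And>z. z \<in> ball x0 r \<Longrightarrow> (\<Psi> has_field_derivative - (dlog z / 2) * \<Psi> z) (at z)"
proof -
  obtain r1 where r1: "r1 > 0" "\<Psi> holomorphic_on ball x0 r1" using \<Psi>(1) by (auto simp: analytic_at_ball)
  obtain r2 where r2: "r2 > 0" "\<And>z. dist z x0 < r2 \<Longrightarrow> \<Psi> z ^ 2 = psi_sq z" using \<Psi>(2) unfolding eventually_nhds_metric by blast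
  obtain r3 where r3: "r3 > 0" "ball x0 r3 \<subseteq> - sing" using sing_closed z0 open_contains_ball[of "- sing"] by auto
  define r where "r = Min {r1, r2, r3}"
  have r: "r > 0" "r \<le> r1" "r \<le> r2" "r \<le> r3" using r1 r2 r3 by (auto simp: r_def)
  have sub: "ball x0 r \<subseteq> - sing" using r3(2) subset_ball[OF r(4)] by blast
  have sq: "\<Psi> z ^ 2 = psi_sq z" if "z \<in> ball x0 r" for z using r2(2)[of z] that r by (auto simp: dist_commute)
  have nz: "\<Psi> z \<noteq> 0" if "z \<in> ball x0 r" for z using sq[OF that] psi_sq_nonzero[of z] sub that by auto
  have d: "(\<Psi> has_field_derivative - (dlog z / 2) * \<Psi> z) (at z)" if z: "z \<in> ball x0 r" for z
  proof -
    have "z \<in> ball x0 r1" using z r by auto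
    hence \<Psi>': "(\<Psi> has_field_derivative deriv \<Psi> z) (at z)" using r1(2) holomorphic_derivI open_ball by blast
    hence "((\<lambda>z. \<Psi> z ^ 2) has_field_derivative 2 * \<Psi> z * deriv \<Psi> z) (at z)" by (auto intro!: derivative_eq_intros)
    moreover have "((\<lambda>z. \<Psi> z ^ 2) has_field_derivative - dlog z * psi_sq z) (at z)"
      by (rule has_field_derivative_transform_within_open[OF psi_sq_DERIV open_ball z]) (use sub z sq in auto)
    ultimately have "2 * \<Psi> z * deriv \<Psi> z = - dlog z * psi_sq z" by (rule DERIV_unique)
    hence "2 * \<Psi> z * (deriv \<Psi> z + dlog z / 2 * \<Psi> z) = 0"
      unfolding sq[OF z, symmetric] by (simp add: algebra_simps power2_eq_square)
    hence "deriv \<Psi> z = - (dlog z / 2) * \<Psi> z" using nz[OF z] by (simp add: eq_neg_iff_add_eq_0)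
    thus ?thesis using \<Psi>' by simp
  qed
  show ?thesis using that[OF r(1) sub nz d] .
qed

lemma cycle_branch:
  assumes z0: "x0 \<notin> sing" and r: "r analytic_on {x0}" "\<forall>\<^sub>F z in nhds x0. r z ^ 2 = ws (z - p) * ws (z + p)"
  shows "(\<lambda>z. ws z / r z) analytic_on {x0}" "\<forall>\<^sub>F z in nhds x0. (ws z / r z) ^ 2 = psi_sq z"
proof -
  have "r x0 ^ 2 = ws (x0 - p) * ws (x0 + p)" using r(2) by (rule eventually_nhds_x_imp_x)
  hence "r x0 \<noteq> 0" using ws_nonzero notin_sing[OF z0] by auto
  thus "(\<lambda>z. ws z / r z) analytic_on {x0}" by (intro analytic_intros r(1)) auto
  show "\<forall>\<^sub>F z in nhds x0. (ws z / r z) ^ 2 = psi_sq z"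
    using r(2) by eventually_elim (simp add: psi_sq_def power_divide)
qed

text \<open>Admissibility is witnessed by one branch of \<Psi>. Any other branch at x0 differs from
  it by a constant sign \<epsilon>, which passes through the continuation unchanged.\<close>

lemma cycle_continuation:
  assumes z0: "x0 \<notin> sing" and cyc: "GLE_cycle \<tau> p x0 \<omega> \<gamma>"
    and \<Psi>: "\<Psi> analytic_on {x0}" "\<forall>\<^sub>F z in nhds x0. \<Psi> z ^ 2 = psi_sq z"
  obtains \<Psi>' where "continues_along \<gamma> \<Psi> \<Psi>'" "\<forall>\<^sub>F z in nhds x0. \<Psi>' (z + \<omega>) = \<Psi> z"
proof -
  obtain r \<Phi>' where r: "r analytic_on {x0}" "\<forall>\<^sub>F z in nhds x0. r z ^ 2 = ws (z - p) * ws (z + p)"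
    and cont: "continues_along \<gamma> (\<lambda>z. ws z / r z) \<Phi>'" and fin: "\<forall>\<^sub>F z in nhds x0. \<Phi>' (z + \<omega>) = ws z / r z"
    and \<gamma>0: "\<gamma> 0 = x0"
    using cyc unfolding GLE_cycle_def pathstart_def by blast
  note br = cycle_branch[OF z0 r]
  have "\<Psi> x0 ^ 2 = psi_sq x0" using \<Psi>(2) by (rule eventually_nhds_x_imp_x)
  moreover have sq: "(ws x0 / r x0) ^ 2 = psi_sq x0" using br(2) by (rule eventually_nhds_x_imp_x)
  ultimately have "\<Psi> x0 = ws x0 / r x0 \<or> \<Psi> x0 = - (ws x0 / r x0)" by (metis power2_eq_iff)
  then obtain \<epsilon> :: complex where \<epsilon>: "\<epsilon> ^ 2 = 1" "ws x0 / r x0 * \<epsilon> = \<Psi> x0"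
    by (metis mult.right_neutral mult_minus_right one_power2 power2_minus)
  have ev: "\<forall>\<^sub>F z in nhds x0. ws z / r z * \<epsilon> = \<Psi> z"
  proof (rule eventually_nhds_eq_of_square_eq)
    show "isCont (\<lambda>z. ws z / r z * \<epsilon>) x0"
      by (rule continuous_mult[OF analytic_at_imp_isCont[OF br(1)] continuous_const])
    show "isCont \<Psi> x0" using \<Psi>(1) by (rule analytic_at_imp_isCont)
    show "ws x0 / r x0 * \<epsilon> = \<Psi> x0" by fact
    have "ws x0 / r x0 \<noteq> 0" using sq psi_sq_nonzero[OF z0] by (metis power_zero_numeral)
    moreover have "\<epsilon> \<noteq> 0" using \<epsilon>(1) by auto
    ultimately show "ws x0 / r x0 * \<epsilon> \<noteq> 0" by simp
    show "\<forall>\<^sub>F z in nhds x0. (ws z / r z * \<epsilon>) ^ 2 = \<Psi> z ^ 2"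
      using br(2) \<Psi>(2)
    proof eventually_elim
      case (elim z)
      have "(ws z / r z * \<epsilon>) ^ 2 = (ws z / r z) ^ 2 * \<epsilon> ^ 2" by (rule power_mult_distrib)
      thus ?case using elim \<epsilon>(1) by simp
    qed
  qed
  have "continues_along \<gamma> (\<lambda>z. ws z / r z * \<epsilon>) (\<lambda>z. \<Phi>' z * \<epsilon>)"
    by (rule continues_along_mult[OF cont]) auto
  hence "continues_along \<gamma> \<Psi> (\<lambda>z. \<Phi>' z * \<epsilon>)"
    by (rule continues_along_cong) (use ev \<gamma>0 in auto)
  moreover have "\<forall>\<^sub>F z in nhds x0. \<Phi>' (z + \<omega>) * \<epsilon> = \<Psi> z"
    using fin ev by eventually_elim auto
  ultimately show ?thesis using that by blast
qed

lemma eventually_nhds_shift: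
  "(\<forall>\<^sub>F z in nhds (x0 + \<omega>). P z) \<longleftrightarrow> (\<forall>\<^sub>F z in nhds x0. P (z + \<omega>))" for x0 \<omega> :: complex
proof -
  have "nhds (x0 + \<omega>) = filtermap (\<lambda>z. z + \<omega>) (nhds x0)"
    using filtermap_nhds_shift[of "- \<omega>" "x0"] by simp
  thus ?thesis by (simp add: eventually_filtermap)
qed

context
  fixes n :: nat and B T x0 :: complex and f g \<Psi> :: "complex \<Rightarrow> complex"
  assumes n: "n > 0" and T: "T ^ 2 = of_nat n * (of_nat n + 1) * wp p + B"
    and fg: "fund_pair (lame_q n B) (- lat) f g"
    and z0: "x0 \<notin> sing" and \<Psi>: "\<Psi> analytic_on {x0}" "\<forall>\<^sub>F z in nhds x0. \<Psi> z ^ 2 = psi_sq z"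
begin

lemma gauge_row_pair:
  obtains r where "r > 0"
    "fund_pair (GLE_q n \<tau> p T) (ball x0 r) (\<lambda>z. \<Psi> z * (deriv f z - T * f z)) (\<lambda>z. \<Psi> z * (deriv g z - T * g z))"
    "independent_row x0 (\<lambda>z. \<Psi> z *s gauge_row f g T z)"
proof -
  obtain r where r: "r > 0" "ball x0 r \<subseteq> - sing" "\<And>z. z \<in> ball x0 r \<Longrightarrow> \<Psi> z \<noteq> 0"
    "\<And>z. z \<in> ball x0 r \<Longrightarrow> (\<Psi> has_field_derivative - (dlog z / 2) * \<Psi> z) (at z)"
    using gauge_branch_nbhd[OF z0 \<Psi>] by blast
  have "ball x0 r \<subseteq> - lat" using r(2) by (auto simp: sing_iff)
  note pair = gauge_pair[OF n open_ball r(2,4,3) T fund_pair_subset[OF fg this]]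
  have "(\<lambda>z. \<Psi> z *s gauge_row f g T z) = (\<lambda>z. vector [\<Psi> z * (deriv f z - T * f z), \<Psi> z * (deriv g z - T * g z)])"
    by (simp add: gauge_row_def fun_eq_iff vec_eq_iff forall_2)
  hence "independent_row x0 (\<lambda>z. \<Psi> z *s gauge_row f g T z)"
    using fund_pair_independent[OF open_ball _ pair] r(1) by simp
  thus ?thesis using that r(1) pair by blast
qed

lemma gauge_row_solution_row:
  assumes C: "invertible C"
  shows "GLE_solution_row n \<tau> p T x0 (\<lambda>z. (\<Psi> z *s gauge_row f g T z) v* C)"
proof -
  let ?F = "\<lambda>z. \<Psi> z * (deriv f z - T * f z)" and ?G = "\<lambda>z. \<Psi> z * (deriv g z - T * g z)"
  let ?Y = "\<lambda>z. (\<Psi> z *s gauge_row f g T z) v* C"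
  obtain r where r: "r > 0" and pair: "fund_pair (GLE_q n \<tau> p T) (ball x0 r) ?F ?G"
    and ind: "independent_row x0 (\<lambda>z. \<Psi> z *s gauge_row f g T z)"
    by (rule gauge_row_pair)
  have Yi: "(\<lambda>z. ?Y z $ i) = (\<lambda>z. C $ 1 $ i * ?F z + C $ 2 $ i * ?G z)" for i
    by (simp add: gauge_row_def fun_eq_iff vector_matrix_mult_def sum_2 algebra_simps)
  have "ode_sol (GLE_q n \<tau> p T) (ball x0 r) (\<lambda>z. ?Y z $ i)" for i
    unfolding Yi using pair by (intro ode_sol_lincomb) (auto simp: fund_pair_def)
  hence "(\<lambda>z. ?Y z $ i) holomorphic_on ball x0 r"
    "\<forall>z\<in>ball x0 r. deriv (deriv (\<lambda>z. ?Y z $ i)) z = GLE_q n \<tau> p T z * ?Y z $ i" for i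
    by (auto simp: ode_sol_def)
  hence "(\<lambda>z. ?Y z $ i) analytic_on {x0}"
    "\<forall>\<^sub>F z in nhds x0. deriv (deriv (\<lambda>z. ?Y z $ i)) z = GLE_q n \<tau> p T z * ?Y z $ i" for i
    using r unfolding analytic_at_ball eventually_nhds by (blast, intro exI[of _ "ball x0 r"], auto)
  moreover have "independent_row x0 ?Y" by (rule independent_row_mult[OF ind C])
  ultimately show ?thesis unfolding GLE_solution_row_def independent_row_def by blast
qed

lemma solution_row_gauge_row:
  assumes Y: "GLE_solution_row n \<tau> p T x0 Y"
  obtains C where "invertible C" "\<forall>\<^sub>F z in nhds x0. Y z = (\<Psi> z *s gauge_row f g T z) v* C"
proof -
  let ?F = "\<lambda>z. \<Psi> z * (deriv f z - T * f z)" and ?G = "\<lambda>z. \<Psi> z * (deriv g z - T * g z)"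
  obtain r where r: "r > 0" and pair: "fund_pair (GLE_q n \<tau> p T) (ball x0 r) ?F ?G"
    by (rule gauge_row_pair)
  have ex: "\<exists>a b. \<forall>\<^sub>F z in nhds x0. Y z $ i = a * ?F z + b * ?G z" for i
  proof -
    have an: "(\<lambda>z. Y z $ i) analytic_on {x0}"
      and eq: "\<forall>\<^sub>F z in nhds x0. deriv (deriv (\<lambda>z. Y z $ i)) z = GLE_q n \<tau> p T z * Y z $ i"
      using Y by (auto simp: GLE_solution_row_def)
    obtain r1 where r1: "r1 > 0" "(\<lambda>z. Y z $ i) holomorphic_on ball x0 r1" using an by (auto simp: analytic_at_ball)
    obtain r2 where r2: "r2 > 0" "\<And>z. dist z x0 < r2 \<Longrightarrow> deriv (deriv (\<lambda>z. Y z $ i)) z = GLE_q n \<tau> p T z * Y z $ i"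
      using eq unfolding eventually_nhds_metric by blast
    define s where "s = Min {r, r1, r2}"
    have s: "s > 0" "s \<le> r" "s \<le> r1" "s \<le> r2" using r r1 r2 by (auto simp: s_def)
    have sol: "ode_sol (GLE_q n \<tau> p T) (ball x0 s) (\<lambda>z. Y z $ i)"
      unfolding ode_sol_def
    proof (intro conjI ballI)
      show "(\<lambda>z. Y z $ i) holomorphic_on ball x0 s" by (rule holomorphic_on_subset[OF r1(2) subset_ball[OF s(3)]])
      show "deriv (deriv (\<lambda>z. Y z $ i)) z = GLE_q n \<tau> p T z * Y z $ i" if "z \<in> ball x0 s" for z
        by (rule r2(2)) (use that s in \<open>auto simp: dist_commute\<close>)
    qed
    have ne: "ball x0 s \<noteq> {}" using s(1) by auto
    show ?thesis
    proof (rule ode_sol_span[OF open_ball connected_ball ne fund_pair_subset[OF pair subset_ball[OF s(2)]] sol])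
      fix a b assume ab: "\<And>z. z \<in> ball x0 s \<Longrightarrow> Y z $ i = a * ?F z + b * ?G z"
      have "\<forall>\<^sub>F z in nhds x0. z \<in> ball x0 s"
        by (rule eventually_nhds_in_open) (use s(1) in auto)
      hence "\<forall>\<^sub>F z in nhds x0. Y z $ i = a * ?F z + b * ?G z"
        by eventually_elim (rule ab)
      thus ?thesis by (intro exI)
    qed
  qed
  from ex[of 1] obtain a1 b1 where ab1: "\<forall>\<^sub>F z in nhds x0. Y z $ 1 = a1 * ?F z + b1 * ?G z"
    by (elim exE)
  from ex[of 2] obtain a2 b2 where ab2: "\<forall>\<^sub>F z in nhds x0. Y z $ 2 = a2 * ?F z + b2 * ?G z"
    by (elim exE)
  define C :: "complex ^ 2 ^ 2" where "C = vector [vector [a1, a2], vector [b1, b2]]"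
  have YC: "\<forall>\<^sub>F z in nhds x0. Y z = (\<Psi> z *s gauge_row f g T z) v* C"
    using ab1 ab2
    by eventually_elim (simp add: vec_eq_iff forall_2 vector_matrix_mult_def sum_2 gauge_row_def C_def algebra_simps)
  have "independent_row x0 Y" using Y unfolding GLE_solution_row_def independent_row_def by blast
  hence "invertible C" using YC by (rule invertible_of_independent_row)
  thus ?thesis using YC that by blast
qed

text \<open>On an admissible cycle \<Psi> returns to itself, and \<open>gauge_row\<close> depends on
  the end point alone, so their product is multiplied by M whatever the path; the basis change C
  conjugates it. Uniqueness of continuation and independence of the row exclude every other
  X.\<close>

lemma monodromy_along_iff:
  assumes Y: "\<forall>\<^sub>F z in nhds x0. Y z = (\<Psi> z *s gauge_row f g T z) v* C" and C: "invertible C"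
    and M: "\<And>z. z \<notin> lat \<Longrightarrow> gauge_row f g T (z + \<omega>) = gauge_row f g T z v* M"
    and cyc: "GLE_cycle \<tau> p x0 \<omega> \<gamma>"
  shows "monodromy_along \<gamma> \<omega> Y X \<longleftrightarrow> X = matrix_inv C ** M ** C"
proof -
  let ?D = "gauge_row f g T"
  have \<gamma>: "path \<gamma>" "path_image \<gamma> \<inter> sing = {}" "\<gamma> 0 = x0" "\<gamma> 1 = x0 + \<omega>"
    using cyc by (auto simp: GLE_cycle_def pathstart_def pathfinish_def)
  obtain \<Psi>' where cont: "continues_along \<gamma> \<Psi> \<Psi>'" and fin: "\<forall>\<^sub>F z in nhds x0. \<Psi>' (z + \<omega>) = \<Psi> z"
    by (rule cycle_continuation[OF z0 cyc \<Psi>])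
  obtain r where ind: "independent_row x0 (\<lambda>z. \<Psi> z *s ?D z)" by (rule gauge_row_pair)
  have hol: "f holomorphic_on - lat" "g holomorphic_on - lat" and o: "open (- lat)"
    using fg lat_closed by (auto simp: fund_pair_def ode_sol_def)
  have an: "(\<lambda>z. (?D z v* C) $ i) analytic_on {z}" if "z \<notin> sing" for i z
  proof -
    have "(\<lambda>z. C $ 1 $ i * (deriv f z - T * f z) + C $ 2 $ i * (deriv g z - T * g z)) holomorphic_on - lat"
      by (intro holomorphic_intros holomorphic_deriv hol o)
    moreover have "(\<lambda>z. (?D z v* C) $ i) = (\<lambda>z. C $ 1 $ i * (deriv f z - T * f z) + C $ 2 $ i * (deriv g z - T * g z))"
      by (simp add: fun_eq_iff gauge_row_def vector_matrix_mult_def sum_2 mult.commute)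
    ultimately have "(\<lambda>z. (?D z v* C) $ i) analytic_on - lat" using o by (simp add: analytic_on_open)
    thus ?thesis using notin_sing(1)[OF that] by (auto intro: analytic_on_subset)
  qed
  have contY: "continues_along \<gamma> (\<lambda>z. Y z $ i) (\<lambda>z. \<Psi>' z * (?D z v* C) $ i)" for i
  proof (rule continues_along_cong[OF continues_along_mult[OF cont an]])
    show "\<gamma> t \<notin> sing" if "t \<in> {0..1}" for t using \<gamma>(2) that unfolding path_image_def by blast
    show "\<forall>\<^sub>F z in nhds (\<gamma> 0). \<Psi> z * (?D z v* C) $ i = Y z $ i"
      using Y unfolding \<gamma>(3) by eventually_elim (simp add: smult_vector_matrix_mult)
  qed auto
  have evlat: "\<forall>\<^sub>F z in nhds x0. z \<notin> lat"
    using eventually_nhds_in_open[OF o, of x0] notin_sing(1)[OF z0] by simp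
  have DM: "\<forall>\<^sub>F z in nhds x0. \<Psi>' (z + \<omega>) *s (?D (z + \<omega>) v* C) = (\<Psi> z *s ?D z) v* (M ** C)"
    using fin evlat
    by eventually_elim (simp add: M smult_vector_matrix_mult vector_matrix_mul_assoc)
  have YX: "\<forall>\<^sub>F z in nhds x0. Y z v* X = (\<Psi> z *s ?D z) v* (C ** X)" for X
    using Y by eventually_elim (simp add: vector_matrix_mul_assoc)
  show ?thesis
  proof
    assume "monodromy_along \<gamma> \<omega> Y X"
    then obtain Z where Z: "\<And>i. continues_along \<gamma> (\<lambda>z. Y z $ i) (\<lambda>z. Z z $ i)" "\<forall>\<^sub>F z in nhds x0. Z (z + \<omega>) = Y z v* X"
      using \<gamma>(3) by (auto simp: monodromy_along_def pathstart_def)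
    have "\<forall>\<^sub>F z in nhds (\<gamma> 1). Z z $ i = \<Psi>' z * (?D z v* C) $ i" for i
      by (rule continues_along_unique[OF \<gamma>(1) Z(1) contY]) auto
    hence Zi: "\<forall>\<^sub>F z in nhds x0. Z (z + \<omega>) $ i = \<Psi>' (z + \<omega>) * (?D (z + \<omega>) v* C) $ i" for i
      unfolding \<gamma>(4) eventually_nhds_shift by blast
    have "\<forall>\<^sub>F z in nhds x0. (\<Psi> z *s ?D z) v* (C ** X) = (\<Psi> z *s ?D z) v* (M ** C)"
      using Zi[of 1] Zi[of 2] Z(2) DM YX[of X]
    proof eventually_elim
      case (elim z)
      have "Z (z + \<omega>) = \<Psi>' (z + \<omega>) *s (?D (z + \<omega>) v* C)" using elim(1,2) by (simp add: vec_eq_iff forall_2)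
      thus ?case using elim(3,4,5) by simp
    qed
    hence "C ** X = M ** C" by (rule independent_row_eqD[OF ind])
    hence "matrix_inv C ** (C ** X) = matrix_inv C ** (M ** C)" by simp
    thus "X = matrix_inv C ** M ** C" by (simp add: matrix_mul_assoc matrix_inv_eqs[OF C])
  next
    assume X: "X = matrix_inv C ** M ** C"
    have CX: "C ** X = M ** C" unfolding X by (simp add: matrix_mul_assoc matrix_inv_eqs[OF C])
    show "monodromy_along \<gamma> \<omega> Y X"
      unfolding monodromy_along_def
    proof (intro exI[of _ "\<lambda>z. \<Psi>' z *s (?D z v* C)"] conjI allI)
      show "continues_along \<gamma> (\<lambda>z. Y z $ i) (\<lambda>z. (\<Psi>' z *s (?D z v* C)) $ i)" for i using contY[of i] by simp
      have "\<forall>\<^sub>F z in nhds x0. \<Psi>' (z + \<omega>) *s (?D (z + \<omega>) v* C) = Y z v* X"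
        using DM YX[of X] unfolding CX by eventually_elim simp
      thus "\<forall>\<^sub>F z in nhds (pathstart \<gamma>). \<Psi>' (z + \<omega>) *s (?D (z + \<omega>) v* C) = Y z v* X"
        using \<gamma>(3) by (simp add: pathstart_def)
    qed
  qed
qed

end

section \<open>Existence of admissible cycles\<close>

lemma psi_sq_analytic: "z \<notin> sing \<Longrightarrow> psi_sq analytic_on {z}"
  unfolding psi_sq_def[abs_def] by (intro analytic_intros) (use ws_nonzero in \<open>auto simp: sing_iff\<close>)

lemma psi_sq_periodic: "\<omega> \<in> lat \<Longrightarrow> z \<notin> sing \<Longrightarrow> psi_sq (z + \<omega>) = psi_sq z"
proof -
  assume \<omega>: "\<omega> \<in> lat" and z: "z \<notin> sing"
  obtain c where c: "c \<noteq> 0" "\<And>z. z \<notin> sing \<Longrightarrow> wp_diff z * psi_sq z = c" using wp_diff_psi_sq by blast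
  have "z + \<omega> \<notin> sing" using z sing_add[OF \<omega>] by simp
  hence "wp_diff (z + \<omega>) * psi_sq (z + \<omega>) = wp_diff z * psi_sq z" using c(2) z by simp
  moreover have "wp_diff (z + \<omega>) = wp_diff z" by (simp add: wp_diff_def wp_periodic \<omega>)
  ultimately show ?thesis using wp_diff_nonzero[OF z] by simp
qed

text \<open>Guarantees that the set of monodromy pairs is not empty. The base point lies close to p,
  so that a path with the wrong sign can be preceded by a circle around the simple pole of
  \<open>psi_sq\<close> at p.\<close>

lemma GLE_cycles_exist:
  obtains x0 \<Psi> where "x0 \<notin> sing" "\<Psi> analytic_on {x0}" "\<forall>\<^sub>F z in nhds x0. \<Psi> z ^ 2 = psi_sq z"
    "\<And>\<omega>. \<omega> \<in> lat \<Longrightarrow> \<exists>\<gamma>. GLE_cycle \<tau> p x0 \<omega> \<gamma>"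
proof -
  obtain R where R: "R > 0" "\<And>z. z \<noteq> p \<Longrightarrow> dist z p < R \<Longrightarrow> z \<notin> sing"
    using eventually_notin_sing[of p] unfolding eventually_at by auto
  \<comment> \<open>Cofactor of the pole: \<open>ws_reg\<close> replaces \<open>ws\<close> at z - p,
    which splits off the simple zero and leaves v without zeros near p.\<close>
  define v where "v z = ws z ^ 2 / (ws_reg (z - p) * ws (z + p))" for z
  have vnz: "ws z \<noteq> 0 \<and> ws_reg (z - p) \<noteq> 0 \<and> ws (z + p) \<noteq> 0" if "z \<in> ball p R" for z
  proof (cases "z = p")
    case True
    thus ?thesis using ws_nonzero[OF p_notin_lat] ws_nonzero[of "2 * p"] two_p ws_reg_nonzero[of 0] by simp
  next
    case False
    hence "z \<notin> sing" using R(2)[of z] that by (simp add: dist_commute)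
    thus ?thesis using ws_nonzero[of z] ws_nonzero[of "z - p"] ws_nonzero[of "z + p"] ws_eq[of "z - p"] notin_sing[of z] by auto
  qed
  have "v analytic_on ball p R" unfolding v_def[abs_def]
    by (intro analytic_intros) (use vnz in auto)
  hence v: "v holomorphic_on ball p R" by (rule analytic_imp_holomorphic)
  have v0: "v z \<noteq> 0" if "z \<in> ball p R" for z using vnz[OF that] by (simp add: v_def)
  have kv: "z \<notin> sing \<and> psi_sq z = v z / (z - p)" if "z \<in> ball p R - {p}" for z
    using R(2)[of z] that by (simp add: dist_commute psi_sq_def v_def ws_eq[of "z - p"])
  define x0 where "x0 = p + of_real (R / 2)"
  have z0: "x0 \<notin> sing" using R(1) by (intro R(2)) (auto simp: x0_def dist_norm)
  define s\<^sub>0 where "s\<^sub>0 = csqrt (psi_sq x0)"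
  have s0: "s\<^sub>0 ^ 2 = psi_sq x0" "s\<^sub>0 \<noteq> 0" using psi_sq_nonzero[OF z0] by (auto simp: s\<^sub>0_def)
  define \<Psi> where "\<Psi> z = s\<^sub>0 * csqrt (psi_sq z / psi_sq x0)" for z
  have \<Psi>an: "\<Psi> analytic_on {x0}" unfolding \<Psi>_def[abs_def]
    by (intro analytic_intros psi_sq_analytic z0) (use psi_sq_nonzero[OF z0] in auto)
  have \<Psi>sq: "\<Psi> z ^ 2 = psi_sq z" for z using psi_sq_nonzero[OF z0] s0 by (simp add: \<Psi>_def power_mult_distrib)
  have \<Psi>0: "\<Psi> x0 = s\<^sub>0" using psi_sq_nonzero[OF z0] by (simp add: \<Psi>_def)
  define r where "r z = ws z / \<Psi> z" for z
  have ran: "r analytic_on {x0}" unfolding r_def[abs_def]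
    by (intro analytic_intros \<Psi>an) (use \<Psi>0 s0 in auto)
  have evs: "\<forall>\<^sub>F z in nhds x0. z \<notin> sing"
    using eventually_nhds_in_open[OF open_Compl[OF sing_closed], of x0] z0 by simp
  have rsq: "\<forall>\<^sub>F z in nhds x0. r z ^ 2 = ws (z - p) * ws (z + p)"
    using evs
  proof eventually_elim
    case (elim z)
    have "ws z \<noteq> 0" "ws (z - p) \<noteq> 0" "ws (z + p) \<noteq> 0" using ws_nonzero notin_sing[OF elim] by auto
    thus ?case unfolding r_def power_divide \<Psi>sq psi_sq_def by simp
  qed
  have wsr: "\<forall>\<^sub>F z in nhds x0. \<Psi> z = ws z / r z"
    using evs
  proof eventually_elim
    case (elim z)
    thus ?case using ws_nonzero notin_sing(1)[OF elim] by (simp add: r_def)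
  qed
  have "\<exists>\<gamma>. GLE_cycle \<tau> p x0 \<omega> \<gamma>" if \<omega>: "\<omega> \<in> lat" for \<omega>
  proof -
    have z1: "x0 + \<omega> \<notin> sing" using z0 sing_add[OF \<omega>] by simp
    have hk: "psi_sq holomorphic_on - sing" by (rule holomorphic_on_sing_compl[OF psi_sq_analytic])
    have R2: "0 < R / 2" "R / 2 < R" using R(1) by auto
    have s1: "s\<^sub>0 ^ 2 = psi_sq (x0 + \<omega>)" using s0(1) psi_sq_periodic[OF \<omega> z0] by simp
    obtain \<gamma> s where \<gamma>: "path \<gamma>" "path_image \<gamma> \<inter> sing = {}" "pathstart \<gamma> = x0" "pathfinish \<gamma> = x0 + \<omega>"
      and s: "path s" "\<And>t. t \<in> {0..1} \<Longrightarrow> s t ^ 2 = psi_sq (\<gamma> t)" "pathstart s = s\<^sub>0" "pathfinish s = s\<^sub>0"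
      by (rule square_root_path_exists[OF sing_closed sing_countable hk psi_sq_nonzero v v0 kv R2 x0_def z1 s0(1) s1]) auto
    have \<gamma>01: "\<gamma> 0 = x0" "\<gamma> 1 = x0 + \<omega>" "s 0 = s\<^sub>0" "s 1 = s\<^sub>0" using \<gamma>(3,4) s(3,4) by (auto simp: pathstart_def pathfinish_def)
    have ns: "\<gamma> t \<notin> sing" if "t \<in> {0..1}" for t using \<gamma>(2) that unfolding path_image_def by blast
    \<comment> \<open>By periodicity the translate of \<Psi> is a square root of
      \<open>psi_sq\<close> near x0 + \<omega>, with value \<open>s\<^sub>0\<close> there; since s
      also ends at \<open>s\<^sub>0\<close>, it is the final germ.\<close>
    have "continues_along \<gamma> \<Psi> (\<lambda>z. \<Psi> (z - \<omega>))"
    proof (rule continues_along_sqrt[OF \<gamma>(1) psi_sq_analytic psi_sq_nonzero s(1,2)])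
      show "isCont \<Psi> (\<gamma> 0)" using analytic_at_imp_isCont[OF \<Psi>an] \<gamma>01 by simp
      have "isCont \<Psi> (x0 + \<omega> - \<omega>)" using analytic_at_imp_isCont[OF \<Psi>an] by simp
      thus "isCont (\<lambda>z. \<Psi> (z - \<omega>)) (\<gamma> 1)" 
        unfolding \<gamma>01 by (rule isCont_o2[where f = "\<lambda>z. z - \<omega>", rotated]) (intro continuous_intros)
      have "\<forall>\<^sub>F z in nhds x0. \<Psi> (z + \<omega> - \<omega>) ^ 2 = psi_sq (z + \<omega>)"
        using evs by eventually_elim (simp add: \<Psi>sq psi_sq_periodic[OF \<omega>])
      thus "\<forall>\<^sub>F z in nhds (\<gamma> 1). \<Psi> (z - \<omega>) ^ 2 = psi_sq z" unfolding \<gamma>01 eventually_nhds_shift .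
    qed (use ns \<Psi>0 \<Psi>sq \<gamma>01 in auto)
    hence "continues_along \<gamma> (\<lambda>z. ws z / r z) (\<lambda>z. \<Psi> (z - \<omega>))"
      by (rule continues_along_cong) (use wsr \<gamma>01 in auto)
    moreover have "\<forall>\<^sub>F z in nhds x0. \<Psi> (z + \<omega> - \<omega>) = ws z / r z" using wsr by simp
    ultimately show ?thesis unfolding GLE_cycle_def using \<gamma> ran rsq by blast
  qed
  thus ?thesis using that[OF z0 \<Psi>an] \<Psi>sq by simp
qed

section \<open>The monodromy set as a conjugacy class\<close>

text \<open>Any solution row is \<Psi> times \<open>gauge_row\<close> times an invertible C, so its
  two matrices are conjugated by the same C. Conversely every invertible C occurs as the basis of a
  row on the cycles of \<open>GLE_cycles_exist\<close>.\<close>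

lemma period_monodromy_eq:
  assumes n: "n > 0" and T: "T ^ 2 = of_nat n * (of_nat n + 1) * wp p + B"
    and fg: "fund_pair (lame_q n B) (- lat) f g"
    and M1: "\<And>z. z \<notin> lat \<Longrightarrow> gauge_row f g T (z + 1) = gauge_row f g T z v* M\<^sub>1"
    and M2: "\<And>z. z \<notin> lat \<Longrightarrow> gauge_row f g T (z + \<tau>) = gauge_row f g T z v* M\<^sub>2"
  shows "period_monodromy n \<tau> p T = simultaneous_conjugacy_class M\<^sub>1 M\<^sub>2"
proof (intro equalityI subsetI)
  fix X assume "X \<in> period_monodromy n \<tau> p T"
  then obtain X1 X2 x0 Y \<gamma>1 \<gamma>2 where X: "X = (X1, X2)" and z0: "x0 \<notin> sing" and Y: "GLE_solution_row n \<tau> p T x0 Y"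
    and c1: "GLE_cycle \<tau> p x0 1 \<gamma>1" "monodromy_along \<gamma>1 1 Y X1"
    and c2: "GLE_cycle \<tau> p x0 \<tau> \<gamma>2" "monodromy_along \<gamma>2 \<tau> Y X2"
    unfolding period_monodromy_def by blast
  obtain r where r: "r analytic_on {x0}" "\<forall>\<^sub>F z in nhds x0. r z ^ 2 = ws (z - p) * ws (z + p)"
    using c1(1) unfolding GLE_cycle_def by blast
  note br = cycle_branch[OF z0 r]
  obtain C where C: "invertible C" and YC: "\<forall>\<^sub>F z in nhds x0. Y z = ((ws z / r z) *s gauge_row f g T z) v* C"
    by (rule solution_row_gauge_row[OF n T fg z0 br Y])
  have "X1 = matrix_inv C ** M\<^sub>1 ** C" using c1(2) monodromy_along_iff[OF n T fg z0 br YC C M1 c1(1)] by blast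
  moreover have "X2 = matrix_inv C ** M\<^sub>2 ** C" using c2(2) monodromy_along_iff[OF n T fg z0 br YC C M2 c2(1)] by blast
  ultimately show "X \<in> simultaneous_conjugacy_class M\<^sub>1 M\<^sub>2" using X C unfolding simultaneous_conjugacy_class_def by blast
next
  fix X assume "X \<in> simultaneous_conjugacy_class M\<^sub>1 M\<^sub>2"
  then obtain C where C: "invertible C" and X: "X = (matrix_inv C ** M\<^sub>1 ** C, matrix_inv C ** M\<^sub>2 ** C)"
    unfolding simultaneous_conjugacy_class_def by blast
  obtain x0 \<Psi> where z0: "x0 \<notin> sing" and \<Psi>: "\<Psi> analytic_on {x0}" "\<forall>\<^sub>F z in nhds x0. \<Psi> z ^ 2 = psi_sq z"
    and cyc: "\<And>\<omega>. \<omega> \<in> lat \<Longrightarrow> \<exists>\<gamma>. GLE_cycle \<tau> p x0 \<omega> \<gamma>" using GLE_cycles_exist by blast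
  obtain \<gamma>1 \<gamma>2 where g1: "GLE_cycle \<tau> p x0 1 \<gamma>1" and g2: "GLE_cycle \<tau> p x0 \<tau> \<gamma>2"
    using cyc[OF lat_1] cyc[OF lat_tau] by blast
  define Y where "Y z = (\<Psi> z *s gauge_row f g T z) v* C" for z
  have YC: "\<forall>\<^sub>F z in nhds x0. Y z = (\<Psi> z *s gauge_row f g T z) v* C" by (simp add: Y_def)
  have "GLE_solution_row n \<tau> p T x0 Y" unfolding Y_def[abs_def] by (rule gauge_row_solution_row[OF n T fg z0 \<Psi> C])
  moreover have "monodromy_along \<gamma>1 1 Y (matrix_inv C ** M\<^sub>1 ** C)"
    using monodromy_along_iff[OF n T fg z0 \<Psi> YC C M1 g1] by blast
  moreover have "monodromy_along \<gamma>2 \<tau> Y (matrix_inv C ** M\<^sub>2 ** C)"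
    using monodromy_along_iff[OF n T fg z0 \<Psi> YC C M2 g2] by blast
  ultimately show "X \<in> period_monodromy n \<tau> p T" unfolding period_monodromy_def X using z0 g1 g2 by blast
qed

end

theorem theorem1p5:
  fixes n :: nat and \<tau> B :: complex
  assumes "n > 0" and "Im \<tau> > 0"
  shows "(\<exists>M\<^sub>1 M\<^sub>2 :: complex ^ 2 ^ 2. \<forall>(p, T) \<in> GLE_cover n \<tau> B.
            period_monodromy n \<tau> p T = simultaneous_conjugacy_class M\<^sub>1 M\<^sub>2) \<and>
         (\<forall>(p, T) \<in> GLE_cover n \<tau> B.
            period_monodromy n \<tau> p (- T) = period_monodromy n \<tau> p T)"
proof -
  interpret tau_lattice \<tau> by unfold_locales (rule assms)
  \<comment> \<open>The pair f, g and its matrices are fixed before p and T are chosen; they are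
    therefore common to all points of the cover.\<close>
  obtain f g where fg: "fund_pair (lame_q n B) (- lat) f g" by (rule lame_pair_global)
  obtain M\<^sub>1 :: "complex ^ 2 ^ 2" where M1:
    "\<And>z. z \<notin> lat \<Longrightarrow> vector [f (z + 1), g (z + 1)] = (vector [f z, g z] :: complex ^ 2) v* M\<^sub>1"
    "\<And>z. z \<notin> lat \<Longrightarrow> vector [deriv f (z + 1), deriv g (z + 1)] = (vector [deriv f z, deriv g z] :: complex ^ 2) v* M\<^sub>1"
    using lame_monodromy[OF fg lat_1] by blast
  obtain M\<^sub>2 :: "complex ^ 2 ^ 2" where M2:
    "\<And>z. z \<notin> lat \<Longrightarrow> vector [f (z + \<tau>), g (z + \<tau>)] = (vector [f z, g z] :: complex ^ 2) v* M\<^sub>2"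
    "\<And>z. z \<notin> lat \<Longrightarrow> vector [deriv f (z + \<tau>), deriv g (z + \<tau>)] = (vector [deriv f z, deriv g z] :: complex ^ 2) v* M\<^sub>2"
    using lame_monodromy[OF fg lat_tau] by blast
  have main: "period_monodromy n \<tau> p T = simultaneous_conjugacy_class M\<^sub>1 M\<^sub>2" if "(p, T) \<in> GLE_cover n \<tau> B" for p T
  proof -
    interpret tau_lattice_point \<tau> p by unfold_locales (use that in \<open>auto simp: GLE_cover_def\<close>)
    have row: "gauge_row f g T z = vector [deriv f z, deriv g z] - T *s vector [f z, g z]" for z
      by (simp add: gauge_row_def vec_eq_iff forall_2)
    \<comment> \<open>T is constant in z, so y' - T y commutes with translation, and the matrix that
      y and y' share passes to it.\<close>
    have "gauge_row f g T (z + \<omega>) = gauge_row f g T z v* M"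
      if "vector [f (z + \<omega>), g (z + \<omega>)] = (vector [f z, g z] :: complex ^ 2) v* M"
        "vector [deriv f (z + \<omega>), deriv g (z + \<omega>)] = (vector [deriv f z, deriv g z] :: complex ^ 2) v* M" for z \<omega> M
      unfolding row that by (simp add: vec_eq_iff vector_matrix_mult_def sum_2 algebra_simps)
    thus ?thesis using assms(1) that M1 M2
      by (intro period_monodromy_eq[OF _ _ fg]) (auto simp: GLE_cover_def)
  qed
  have "(p, - T) \<in> GLE_cover n \<tau> B" if "(p, T) \<in> GLE_cover n \<tau> B" for p T
    using that by (simp add: GLE_cover_def)
  hence "\<forall>(p, T) \<in> GLE_cover n \<tau> B. period_monodromy n \<tau> p (- T) = period_monodromy n \<tau> p T"
    using main by auto
  thus ?thesis using main by blast
qed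

end
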